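(* Let $q\equiv3\pmod4$ be a prime power, $\mathbb{A}=\mathbb{F}_q[X]$, and $S\subseteq\mathbb{F}_q^*$ any set with $|S|=(q-1)/2$ such that $\alpha\in S$ implies $-\alpha\notin S$. Let $f=aP^e$, where $a\in\mathbb{F}_q^*$, $P$ is a monic irreducible polynomial of odd degree, and $e\ge 1$. Then $$G(f,S)\equiv(-1)^{e+\frac12(h(-P)-3)}\,\delta(S)\pmod f.$$
   Context: For non-zero $g\in\mathbb{A}$, $\mathrm{sgn}(g)$ is the leading coefficient of $g$. $\delta(S)=\prod_{a\in S}a$ (which equals $\pm1$ here). $G(f,S)=\prod g$, the product over all non-zero $g\in\mathbb{A}$ with $\mathrm{sgn}(g)\in S$, $0\le\deg g<\deg f$, $\gcd(g,f)=1$. $h(-P)$ is the class number of the quadratic function field $\mathbb{F}_q(X,\sqrt{-P})$; by a result of Artin, $h(-P)=\sum_{g\text{ monic},\,0\le\deg g<\deg P}\left(\frac gP\right)$ with $\left(\frac gP\right)=\pm1$ the Legendre symbol, $\left(\frac gP\right)\equiv g^{(q^{\deg P}-1)/2}\pmod P$. *)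

theory Defs
  imports
    "HOL-Library.Cardinality"
    "HOL-Algebra.Ideal"
    "HOL-Number_Theory.Cong"
    "HOL-Computational_Algebra.Polynomial_Factorial"
begin

text \<open>The pair \<open>(x, y)\<close> stands for \<open>x + y \<surd>D\<close>. For a non-square \<open>D\<close> this is the quadratic
  extension field of the ground field obtained by adjoining a square root of \<open>D\<close>.\<close>

definition quad_ext :: "'k::field \<Rightarrow> ('k \<times> 'k) ring" where
  "quad_ext D =
    \<lparr>carrier = UNIV,
     monoid.mult = (\<lambda>(a, b) (c, d). (a * c + D * b * d, a * d + b * c)),
     one = (1, 0),
     zero = (0, 0),
     add = (\<lambda>(a, b) (c, d). (a + c, b + d))\<rparr>"

lemma cring_quad_ext: "cring (quad_ext D)"
proof (rule cringI)
  show "abelian_group (quad_ext D)"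
  proof (rule abelian_groupI)
    fix x assume "x \<in> carrier (quad_ext D)"
    show "\<exists>y\<in>carrier (quad_ext D). y \<oplus>\<^bsub>quad_ext D\<^esub> x = \<zero>\<^bsub>quad_ext D\<^esub>"
      by (rule bexI[of _ "(- fst x, - snd x)"]) (auto simp: quad_ext_def split: prod.splits)
  qed (auto simp: quad_ext_def algebra_simps)
  show "comm_monoid (quad_ext D)"
    by (rule comm_monoidI) (auto simp: quad_ext_def algebra_simps)
qed (auto simp: quad_ext_def algebra_simps)

lemma field_quad_ext:
  assumes "\<And>x. x\<^sup>2 \<noteq> D"
  shows "field (quad_ext D)"
proof -
  interpret cring "quad_ext D" by (rule cring_quad_ext)
  have "\<exists>y\<in>carrier (quad_ext D). z \<otimes>\<^bsub>quad_ext D\<^esub> y = \<one>\<^bsub>quad_ext D\<^esub>"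
    if "z \<noteq> \<zero>\<^bsub>quad_ext D\<^esub>" for z
  proof -
    obtain a b where z: "z = (a, b)" by force
    define N where "N = a\<^sup>2 - D * b\<^sup>2"
    have "N \<noteq> 0"
    proof
      assume N: "N = 0"
      show False
      proof (cases "b = 0")
        case True
        with N that z show False by (simp add: N_def quad_ext_def)
      next
        case False
        with N have "(a / b)\<^sup>2 = D" by (simp add: N_def field_simps)
        with assms show False by blast
      qed
    qed
    hence "(a * (a / N) + D * b * (- b / N)) = 1"
      by (simp add: N_def divide_simps) (simp add: power2_eq_square algebra_simps)
    thus ?thesis
      by (intro bexI[of _ "(a / N, - b / N)"]) (auto simp: quad_ext_def z)
  qed
  moreover have "\<one>\<^bsub>quad_ext D\<^esub> \<noteq> \<zero>\<^bsub>quad_ext D\<^esub>"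
    by (simp add: quad_ext_def)
  ultimately show ?thesis
    by (intro cring_fieldI2) auto
qed

definition integral_over :: "('b, 'm) ring_scheme \<Rightarrow> 'b set \<Rightarrow> 'b \<Rightarrow> bool" where
  "integral_over R A z \<longleftrightarrow>
    (\<exists>n c. (\<forall>i<n. c i \<in> A) \<and>
      z [^]\<^bsub>R\<^esub> (n::nat) \<oplus>\<^bsub>R\<^esub> (\<Oplus>\<^bsub>R\<^esub>i\<in>{..<n}. c i \<otimes>\<^bsub>R\<^esub> z [^]\<^bsub>R\<^esub> i) = \<zero>\<^bsub>R\<^esub>)"

definition integral_closure :: "('b, 'm) ring_scheme \<Rightarrow> 'b set \<Rightarrow> ('b, 'm) ring_scheme" where
  "integral_closure R A = R\<lparr>carrier := {z \<in> carrier R. integral_over R A z}\<rparr>"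

text \<open>Every fractional ideal is equivalent to an integral one, so the ideal classes of a domain are
  represented by its non-zero ideals, where \<open>I\<close> and \<open>J\<close> lie in the same class iff
  \<open>\<alpha> I = \<beta> J\<close> for some non-zero \<open>\<alpha>, \<beta>\<close>.\<close>

definition nonzero_ideals :: "('b, 'm) ring_scheme \<Rightarrow> 'b set set" where
  "nonzero_ideals R = {I. ideal I R \<and> I \<noteq> {\<zero>\<^bsub>R\<^esub>}}"

definition ideal_class_rel :: "('b, 'm) ring_scheme \<Rightarrow> ('b set \<times> 'b set) set" where
  "ideal_class_rel R =
    {(I, J). I \<in> nonzero_ideals R \<and> J \<in> nonzero_ideals R \<and>
      (\<exists>\<alpha> \<in> carrier R - {\<zero>\<^bsub>R\<^esub>}. \<exists>\<beta> \<in> carrier R - {\<zero>\<^bsub>R\<^esub>}. \<alpha> <#\<^bsub>R\<^esub> I = \<beta> <#\<^bsub>R\<^esub> J)}"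

definition class_number :: "('b, 'm) ring_scheme \<Rightarrow> nat" where
  "class_number R = card (nonzero_ideals R // ideal_class_rel R)"

text \<open>The class number \<open>h(D)\<close> of the quadratic function field \<open>F(X, \<surd>D)\<close>, i.e. the ideal class
  number of the integral closure of \<open>F[X]\<close> in it.\<close>

definition quad_class_number :: "'a::field poly \<Rightarrow> nat" where
  "quad_class_number D =
    class_number (integral_closure (quad_ext (to_fract D)) (range (\<lambda>p. (to_fract p, 0))))"

text \<open>The leading coefficient \<open>sgn g\<close> of a non-zero \<open>g\<close> is the library's \<^term>\<open>lead_coeff g\<close>.\<close>

definition G :: "'a::field poly \<Rightarrow> 'a set \<Rightarrow> 'a poly" where
  "G f S = \<Prod>{g. g \<noteq> 0 \<and> lead_coeff g \<in> S \<and> degree g < degree f \<and> coprime g f}"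

definition \<delta> :: "'a::comm_monoid_mult set \<Rightarrow> 'a" where
  "\<delta> S = \<Prod>S"

end

(* Let q = CARD('a), d = deg P and chi the quadratic character modulo P. Writing every g as a constant times a
   monic polynomial, G(f,S) = delta(S)^N * M^((q-1)/2), where M is the product of the N monic polynomials of degree
   below deg f that are prime to P. The product of all units modulo P^e squares to 1 and -1 is not a square modulo P,
   so M^((q-1)/2) is +1 or -1 modulo P^e; being fixed by its own character, it equals the product of chi(m) over these
   m. Hence only N modulo 4 and H = sum of chi(m) modulo 4 matter; only degrees below d contribute to H.

   That H and h(-P) agree modulo 4 comes from counting the ideals of A[sqrt(-P)] of norm degree k. By quadratic
   reciprocity there are sum over deg m <= k of chi(m) q^(k - deg m) of them. On the other hand each class contains
   exactly q^(k-g) of them for large k, where d = 2g + 1: they are delta*J/a with delta in the conjugate of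
   J = (a, b + sqrt(-P)), and the norm u^2 + P v^2 of delta has no cancellation of leading terms because d is odd. *)

theory Submission
  imports "HOL-Algebra.Algebraic_Closure_Type" Defs
begin

section \<open>Polynomials over a finite field\<close>

text \<open>Comparing the two counts of the ideals of norm degree k for large k gives h q^g = sum
  over j <= 2g of s_j q^(2g-j), where h = h(-P) and s_j is the sum of chi over the monics of degree
  j. So h is q^g times the L-polynomial at 1/q, whereas H, the sum of the s_j, is its value at 1;
  modulo 4 h and H agree because q = -1 and every s_j is odd. Two obstacles shape the middle part.
  \<open>card\<close> of an infinite set is 0, so finiteness of the set of classes has to come out
  of the count itself, which bounds every finite set of classes. And
  \<open>quad_class_number\<close> speaks of an integral closure among pairs of fractions, while the
  count takes place in pairs of polynomials; the bridge is that a multiplier mapping a lattice into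
  itself lies in A[sqrt(-P)], which also shows that delta is unique up to constants. The sign in the
  theorem: if r of the N monics have chi = -1, then N - H = 2r, and N = (-1)^(e-1), H = h modulo 4
  give r and e + (h-3)/2 the same parity.\<close>

definition polys :: "nat \<Rightarrow> 'a::zero poly set" where
  "polys n = {p. \<forall>i\<ge>n. coeff p i = 0}"

definition monics :: "nat \<Rightarrow> 'a::{zero,one} poly set" where
  "monics n = {p. degree p = n \<and> lead_coeff p = 1}"

text \<open>\<open>polys n\<close> is defined through coefficients so that it is closed under
  addition and contains 0 for every \<open>n\<close>, even \<open>n = 0\<close>. In terms of
  \<open>degree\<close> the zero polynomial must be split off, since
  \<open>degree 0 = 0\<close>.\<close>

lemma polys_iff: "p \<in> polys n \<longleftrightarrow> p = 0 \<or> degree p < n"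
proof
  assume "p \<in> polys n"
  then show "p = 0 \<or> degree p < n"
    by (metis (mono_tags, lifting) leading_coeff_0_iff linorder_not_less mem_Collect_eq polys_def)
qed (auto simp: polys_def coeff_eq_0)

lemma zero_in_polys [simp]: "0 \<in> polys n"
  by (simp add: polys_def)

lemma polys_add: "p \<in> polys n \<Longrightarrow> r \<in> polys n \<Longrightarrow> p + r \<in> polys n"
  for p r :: "'a::comm_ring_1 poly"
  by (simp add: polys_def)

lemma polys_diff: "p \<in> polys n \<Longrightarrow> r \<in> polys n \<Longrightarrow> p - r \<in> polys n"
  for p r :: "'a::comm_ring_1 poly"
  by (simp add: polys_def)

lemma polys_uminus [simp]: "- p \<in> polys n \<longleftrightarrow> p \<in> polys n"
  for p :: "'a::comm_ring_1 poly"
  by (simp add: polys_def)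

lemma polys_mono: "m \<le> n \<Longrightarrow> polys m \<subseteq> polys n"
  by (auto simp: polys_def)

lemma polys_0 [simp]: "polys 0 = {0}"
  by (auto simp: polys_def poly_eq_iff)

lemma polys_mult:
  fixes f p :: "'a::field poly"
  assumes "p \<in> polys (n - degree f)" "degree f \<le> n"
  shows "f * p \<in> polys n"
  using assms by (cases "f = 0 \<or> p = 0") (auto simp: polys_iff degree_mult_eq)

lemma finite_card_polys:
  "finite (polys n :: 'a::{finite,field} poly set) \<and> card (polys n :: 'a poly set) = CARD('a) ^ n"
proof (induction n)
  case (Suc n)
  have eq: "polys (Suc n) = (\<lambda>(c, p). pCons c p) ` (UNIV \<times> (polys n :: 'a poly set))"
  proof (rule Set.set_eqI, rule iffI)
    fix p :: "'a poly" assume p: "p \<in> polys (Suc n)"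
    obtain c r where "p = pCons c r" by (cases p)
    with p have "r \<in> polys n"
      by (auto simp: polys_def coeff_pCons split: nat.splits)
    then show "p \<in> (\<lambda>(c, p). pCons c p) ` (UNIV \<times> polys n)" using \<open>p = pCons c r\<close> by auto
  qed (auto simp: polys_def coeff_pCons split: nat.splits)
  have inj: "inj_on (\<lambda>(c, p). pCons c p) (UNIV \<times> (polys n :: 'a poly set))"
    by (auto simp: inj_on_def)
  show ?case unfolding eq using Suc by (simp add: card_image[OF inj] card_cartesian_product)
qed simp

lemma finite_polys [simp]: "finite (polys n :: 'a::{finite,field} poly set)"
  and card_polys: "card (polys n :: 'a poly set) = CARD('a) ^ n"
  using finite_card_polys by auto

lemma monics_ne_0: "p \<in> monics n \<Longrightarrow> p \<noteq> 0" for p :: "'a::field poly"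
  by (auto simp: monics_def)

lemma monics_eq: "monics n = (\<lambda>r. monom (1::'a::field) n + r) ` polys n"
proof (rule Set.set_eqI, rule iffI)
  fix p :: "'a::field poly" assume p: "p \<in> monics n"
  have "p - monom 1 n \<in> polys n"
    using p by (auto simp: polys_def monics_def coeff_eq_0 le_less)
  then show "p \<in> (\<lambda>r. monom 1 n + r) ` polys n"
    by (intro image_eqI[where x = "p - monom 1 n"]) auto
next
  fix p :: "'a::field poly" assume "p \<in> (\<lambda>r. monom 1 n + r) ` polys n"
  then obtain r where r: "r \<in> polys n" "p = monom 1 n + r" by auto
  have "degree p = n"
  proof (cases "r = 0")
    case False
    with r have "degree r < degree (monom (1::'a) n)" by (auto simp: polys_iff degree_monom_eq)
    then show ?thesis using r by (simp add: degree_add_eq_left degree_monom_eq)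
  qed (use r in \<open>auto simp: degree_monom_eq\<close>)
  then show "p \<in> monics n" using r by (auto simp: monics_def polys_def)
qed

lemma finite_monics [simp]: "finite (monics n :: 'a::{finite,field} poly set)"
  and card_monics: "card (monics n :: 'a poly set) = CARD('a) ^ n"
proof -
  have "inj_on (\<lambda>r. monom 1 n + r) (polys n :: 'a poly set)" by (auto simp: inj_on_def)
  then show "finite (monics n :: 'a poly set)" "card (monics n :: 'a poly set) = CARD('a) ^ n"
    by (auto simp: monics_eq card_image card_polys)
qed

lemma disjoint_monics: "m \<noteq> n \<Longrightarrow> monics m \<inter> monics n = {}"
  by (auto simp: monics_def)

lemma monics_mult: "p \<in> monics m \<Longrightarrow> r \<in> monics n \<Longrightarrow> p * r \<in> monics (m + n)"
  for p r :: "'a::field poly"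
proof -
  assume a: "p \<in> monics m" "r \<in> monics n"
  then have "degree (p * r) = m + n" using monics_ne_0[OF a(1)] monics_ne_0[OF a(2)]
    by (subst degree_mult_eq) (auto simp: monics_def)
  moreover have "lead_coeff (p * r) = 1" using a by (subst lead_coeff_mult) (auto simp: monics_def)
  ultimately show ?thesis by (simp add: monics_def)
qed

lemma monics_0 [simp]: "monics 0 = {1 :: 'a::field poly}"
proof -
  have "p = 1" if "degree p = 0" "lead_coeff p = 1" for p :: "'a poly"
    using that by (metis degree_eq_zeroE lead_coeff_pCons(2) one_pCons pCons_0_0)
  then show ?thesis by (auto simp: monics_def)
qed

lemma monic_associated_eq:
  fixes a b :: "'a::field poly"
  assumes "lead_coeff a = 1" "lead_coeff b = 1" "a dvd b" "degree b \<le> degree a"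
  shows "a = b"
proof -
  obtain c where c: "b = a * c" using assms by auto
  have "b \<noteq> 0" using assms by auto
  then have "degree c = 0" using c assms by (auto simp: degree_mult_eq)
  then obtain k where k: "c = [:k:]" by (rule degree_eq_zeroE)
  have "lead_coeff b = lead_coeff a * lead_coeff c" using c by (simp add: lead_coeff_mult)
  then have "k = 1" using k assms by simp
  then show ?thesis using c k by (auto simp: one_pCons)
qed

lemma monic_dvd_antisym:
  fixes a b :: "'a::field poly"
  assumes "lead_coeff a = 1" "lead_coeff b = 1" "a dvd b" "b dvd a"
  shows "a = b"
proof -
  have "a \<noteq> 0" using assms by auto
  then show ?thesis using assms by (intro monic_associated_eq) (auto intro: dvd_imp_degree_le)
qed

lemma monic_multiple:
  fixes a :: "'a::field poly"
  assumes "a \<noteq> 0"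
  obtains b c where "a = smult c b" "lead_coeff b = 1" "c \<noteq> 0" "degree b = degree a"
proof
  have lc: "lead_coeff a \<noteq> 0" using assms by (rule leading_coeff_neq_0)
  show "a = smult (lead_coeff a) (smult (inverse (lead_coeff a)) a)"
    unfolding smult_smult right_inverse[OF lc] by (rule smult_1_left[symmetric])
  show "lead_coeff (smult (inverse (lead_coeff a)) a) = 1"
    unfolding lead_coeff_smult using lc by (rule left_inverse)
  show "lead_coeff a \<noteq> 0" by (rule lc)
  show "degree (smult (inverse (lead_coeff a)) a) = degree a"
    unfolding degree_smult_eq using lc by auto
qed

lemma mod_in_polys: "f \<noteq> 0 \<Longrightarrow> p mod f \<in> polys (degree f)" for f p :: "'a::field poly"
  unfolding polys_iff by (rule degree_mod_less)

lemma mod_polys: "p \<in> polys (degree f) \<Longrightarrow> p mod f = p" for f p :: "'a::field poly"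
  unfolding polys_iff by (elim disjE) (simp_all add: mod_poly_less)

lemma polys_cong_eq:
  fixes f x y :: "'a::field poly"
  assumes "x \<in> polys (degree f)" "y \<in> polys (degree f)" "[x = y] (mod f)"
  shows "x = y"
proof -
  have "x = x mod f" using mod_polys[OF assms(1)] by (rule sym)
  also have "\<dots> = y mod f" using assms(3) unfolding cong_def .
  also have "\<dots> = y" using assms(2) by (rule mod_polys)
  finally show ?thesis .
qed

lemma polys_dvd_eq_0: "a \<in> polys (degree f) \<Longrightarrow> f dvd a \<Longrightarrow> a = 0" for f a :: "'a::field poly"
  using mod_polys[of a f] by (metis mod_0_imp_dvd dvd_imp_mod_0)

text \<open>A residue class modulo \<open>f\<close> meets \<open>polys n\<close> in the translates
  \<open>f * w + c mod f\<close>, so it is counted by the free cofactor \<open>w\<close>. The bound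
  on \<open>degree f\<close> keeps the reduced representative inside \<open>polys n\<close>.\<close>

lemma card_polys_cong:
  fixes f c :: "'a::{finite,field} poly" and n :: nat
  assumes "f \<noteq> 0" "degree f \<le> n"
  shows "card {u \<in> polys n. f dvd u - c} = CARD('a) ^ (n - degree f)"
proof -
  have c: "c mod f \<in> polys n" using mod_in_polys[OF assms(1), of c] polys_mono assms by blast
  have d: "f dvd (c mod f) - c" by (metis mod_eq_dvd_iff mod_mod_trivial)
  have "bij_betw (\<lambda>w. f * w + c mod f) (polys (n - degree f)) {u \<in> polys n. f dvd u - c}"
    (is "bij_betw ?h _ _")
  proof (rule bij_betwI')
    fix u assume u: "u \<in> {u \<in> polys n. f dvd u - c}"
    then have "f dvd u - c mod f" using d by (metis (no_types, lifting) diff_diff_eq2 diff_add_cancel dvd_diff mem_Collect_eq add_diff_cancel_right')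
    then obtain w where w: "u = f * w + c mod f" by (metis diff_add_cancel dvd_def)
    have "f * w \<in> polys n" using u c w polys_diff by (metis (no_types, lifting) add_diff_cancel_right' mem_Collect_eq)
    then have "w \<in> polys (n - degree f)" using assms
      by (cases "w = 0") (auto simp: polys_iff degree_mult_eq)
    then show "\<exists>w\<in>polys (n - degree f). u = f * w + c mod f" using w by auto
  next
    fix w :: "'a poly" assume "w \<in> polys (n - degree f)"
    then have "f * w + c mod f \<in> polys n" using assms c by (intro polys_add polys_mult)
    moreover have "f dvd (f * w + c mod f) - c"
      using d by (metis add_diff_eq dvd_add dvd_triv_left)
    ultimately show "f * w + c mod f \<in> {u \<in> polys n. f dvd u - c}" by auto
  next
    fix w v :: "'a poly" assume "w \<in> polys (n - degree f)" "v \<in> polys (n - degree f)"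
    show "?h w = ?h v \<longleftrightarrow> w = v" using assms by auto
  qed
  from bij_betw_same_card[OF this] show ?thesis by (simp add: card_polys)
qed

text \<open>The quotient of a monic polynomial by the monic \<open>f\<close> is again monic, while
  the remainder is arbitrary. Hence monics of degree at least \<open>d\<close> are spread evenly
  over the residues modulo \<open>f\<close>, which makes character sums in high degree
  vanish.\<close>

lemma bij_betw_monics_division:
  fixes f :: "'a::field poly"
  assumes f: "f \<in> monics d"
  shows "bij_betw (\<lambda>(w, r). f * w + r) (monics k \<times> polys d) (monics (d + k))"
proof (rule bij_betw_byWitness[where f' = "\<lambda>p. (p div f, p mod f)"])
  have f0: "f \<noteq> 0" and df: "degree f = d" using f by (auto simp: monics_def)
  show "\<forall>a\<in>monics k \<times> polys d. (\<lambda>p. (p div f, p mod f)) (case a of (w, r) \<Rightarrow> f * w + r) = a"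
    using f0 df by (auto simp: polys_iff div_poly_less mod_poly_less)
  show "\<forall>a'\<in>monics (d + k). (case (a' div f, a' mod f) of (w, r) \<Rightarrow> f * w + r) = a'" by auto
  have *: "f * w + r \<in> monics (d + k)" if "w \<in> monics k" "r \<in> polys d" for w r
  proof -
    have fw: "f * w \<in> monics (d + k)" using monics_mult f that by blast
    have dl: "r = 0 \<or> degree r < degree (f * w)" using that fw by (auto simp: polys_iff monics_def)
    then have "degree (f * w + r) = degree (f * w)" by (auto simp: degree_add_eq_left)
    then show ?thesis using fw dl by (auto simp: monics_def coeff_eq_0)
  qed
  then show "(\<lambda>(w, r). f * w + r) ` (monics k \<times> polys d) \<subseteq> monics (d + k)" by auto
  have "p div f \<in> monics k" if p: "p \<in> monics (d + k)" for p
  proof -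
    have e: "p = f * (p div f) + p mod f" by simp
    have "degree p = d + k" using p by (auto simp: monics_def)
    have m: "p mod f = 0 \<or> degree (p mod f) < d" using degree_mod_less[OF f0] df by auto
    have nz: "p div f \<noteq> 0"
    proof
      assume z: "p div f = 0"
      then have "p = p mod f" using e by simp
      then show False using m \<open>degree p = d + k\<close> monics_ne_0[OF p] by (metis add_leD1 less_le_not_le order_refl)
    qed
    then have "degree (p mod f) < degree (f * (p div f)) \<or> p mod f = 0" using m df f0 by (auto simp: degree_mult_eq)
    then have "degree p = degree (f * (p div f)) \<and> lead_coeff p = lead_coeff (f * (p div f))"
      by (metis e add.right_neutral degree_add_eq_left lead_coeff_add_le add.commute)
    then have "degree p = degree f + degree (p div f)" "lead_coeff p = lead_coeff f * lead_coeff (p div f)"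
      using nz f0 by (metis degree_mult_eq, metis lead_coeff_mult)
    then have "degree f + degree (p div f) = d + k" "lead_coeff f * lead_coeff (p div f) = 1"
      using p by (auto simp: monics_def)
    then show ?thesis using f df by (simp add: monics_def)
  qed
  then show "(\<lambda>p. (p div f, p mod f)) ` monics (d + k) \<subseteq> monics k \<times> polys d"
    using mod_in_polys[OF f0] df by auto
qed

subsection \<open>Coprimality and prime factors\<close>

text \<open>A monic element of least degree generates, because the remainder of any \<open>x\<close>
  by it stays in \<open>I\<close>. The formulation for bare sets serves the combinations of two
  polynomials as well as coordinate projections and slices of ideals of A[sqrt(-P)].\<close>

lemma ideal_poly_principal:
  fixes I :: "'a::field poly set"
  assumes "\<And>x y. x \<in> I \<Longrightarrow> y \<in> I \<Longrightarrow> x + y \<in> I" and "\<And>x c. x \<in> I \<Longrightarrow> c * x \<in> I"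
    and "\<exists>x\<in>I. x \<noteq> 0"
  obtains g where "lead_coeff g = 1" "g \<in> I" "\<And>x. x \<in> I \<longleftrightarrow> g dvd x"
proof -
  define g0 where "g0 = arg_min degree (\<lambda>x. x \<in> I \<and> x \<noteq> 0)"
  have g0: "g0 \<in> I" "g0 \<noteq> 0" and min: "\<And>y. y \<in> I \<Longrightarrow> y \<noteq> 0 \<Longrightarrow> degree g0 \<le> degree y"
    using assms(3) arg_min_natI[of "\<lambda>x. x \<in> I \<and> x \<noteq> 0" _ degree]
      arg_min_nat_le[of "\<lambda>x. x \<in> I \<and> x \<noteq> 0" _ degree] unfolding g0_def by blast+
  define g where "g = smult (inverse (lead_coeff g0)) g0"
  have lg: "lead_coeff g = 1" "g \<noteq> 0" "degree g = degree g0" using g0 by (auto simp: g_def)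
  have gI: "g \<in> I" using assms(2)[OF g0(1), of "[:inverse (lead_coeff g0):]"] by (simp add: g_def)
  have "g dvd x" if "x \<in> I" for x
  proof (rule ccontr)
    assume "\<not> g dvd x"
    then have nz: "x mod g \<noteq> 0" by auto
    have "x mod g = x + (- (x div g)) * g" by (simp add: minus_div_mult_eq_mod[symmetric])
    then have "x mod g \<in> I" using that gI assms by metis
    then show False using min[OF _ nz] degree_mod_less[OF lg(2), of x] nz lg by auto
  qed
  moreover have "x \<in> I" if "g dvd x" for x using that gI assms(2) by (metis dvdE mult.commute)
  ultimately show ?thesis using that lg gI by blast
qed

text \<open>The monic generator of the ideal of all combinations of \<open>a\<close> and
  \<open>b\<close> is a common divisor, hence a unit when they are coprime; conversely a common
  divisor divides the combination 1.\<close>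

lemma coprime_bezout_poly:
  fixes a b :: "'a::field poly"
  shows "coprime a b \<longleftrightarrow> (\<exists>x y. x * a + y * b = 1)"
proof
  assume c: "coprime a b"
  define I where "I = {x * a + y * b | x y. True}"
  have mem: "x * a + y * b \<in> I" for x y unfolding I_def by blast
  have aI: "a \<in> I" "b \<in> I" using mem[of 1 0] mem[of 0 1] by simp_all
  have "a \<noteq> 0 \<or> b \<noteq> 0" using c by auto
  then have ex: "\<exists>x\<in>I. x \<noteq> 0" using aI by blast
  have addI: "x + y \<in> I" if "x \<in> I" "y \<in> I" for x y
  proof -
    have "\<exists>u v u' v'. x = u * a + v * b \<and> y = u' * a + v' * b" using that unfolding I_def by blast
    then obtain u v u' v' where "x = u * a + v * b" "y = u' * a + v' * b" by blast
    then have "x + y = (u + u') * a + (v + v') * b" by (simp add: algebra_simps)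
    then show ?thesis using mem by simp
  qed
  have mulI: "z * x \<in> I" if "x \<in> I" for x z
  proof -
    have "\<exists>u v. x = u * a + v * b" using that unfolding I_def by blast
    then obtain u v where "x = u * a + v * b" by blast
    then have "z * x = (z * u) * a + (z * v) * b" by (simp add: algebra_simps)
    then show ?thesis using mem by simp
  qed
  obtain g where g: "g \<in> I" "\<And>x. x \<in> I \<longleftrightarrow> g dvd x"
    using ideal_poly_principal[of I, OF addI mulI ex] by blast
  then have "g dvd a" "g dvd b" using aI by auto
  then have "g dvd 1" using c coprime_common_divisor by blast
  then have "1 \<in> I" using g by simp
  then show "\<exists>x y. x * a + y * b = 1" unfolding I_def mem_Collect_eq by metis
next
  assume "\<exists>x y. x * a + y * b = 1"
  then show "coprime a b" by (metis coprimeI dvd_add dvd_mult)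
qed

lemma coprime_dvd_mult_poly:
  fixes a b c :: "'a::field poly"
  assumes "coprime a b" "a dvd b * c" shows "a dvd c"
proof -
  obtain x y where "x * a + y * b = 1" using assms coprime_bezout_poly by blast
  then have "c * (x * a + y * b) = c" by simp
  then have "c = (x * c) * a + y * (b * c)" by (simp add: algebra_simps)
  moreover have "a dvd (x * c) * a + y * (b * c)" using dvd_mult[OF assms(2), of y] by (simp add: dvd_add)
  ultimately show ?thesis by simp
qed

lemma coprime_mult_poly:
  fixes a b c :: "'a::field poly"
  assumes "coprime a b" "coprime a c" shows "coprime a (b * c)"
proof (rule coprimeI)
  fix d assume d: "d dvd a" "d dvd b * c"
  have "coprime d b" using assms(1) by (rule coprime_imp_coprime) (use d(1) dvd_trans in blast)+
  then have "d dvd c" using d coprime_dvd_mult_poly by blast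
  then show "d dvd 1" using d assms coprime_common_divisor by blast
qed

lemma coprime_power_poly:
  fixes a b :: "'a::field poly"
  assumes "coprime a b" shows "coprime a (b ^ n)"
  by (induction n) (use assms in \<open>auto intro: coprime_mult_poly\<close>)

lemma coprime_mult_dvd_poly:
  fixes a b c :: "'a::field poly"
  assumes "coprime a b" "a dvd c" "b dvd c" shows "a * b dvd c"
proof -
  obtain d where d: "c = a * d" using assms by auto
  then have "b dvd d" using coprime_dvd_mult_poly[of b a d] assms by (auto simp: coprime_commute)
  then show ?thesis using d by auto
qed

lemma irreducible_coprime_poly:
  fixes Q a :: "'a::field poly"
  assumes "irreducible Q" shows "coprime Q a \<longleftrightarrow> \<not> Q dvd a"
proof
  assume "coprime Q a" then show "\<not> Q dvd a"
    using assms by (meson coprime_common_divisor dvd_refl irreducible_not_unit)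
next
  assume n: "\<not> Q dvd a"
  show "coprime Q a"
  proof (rule coprimeI)
    fix c assume c: "c dvd Q" "c dvd a"
    then have "\<not> Q dvd c" using n dvd_trans by blast
    then show "c dvd 1" using assms c irreducibleD' by blast
  qed
qed

lemma irreducible_dvd_mult_poly:
  fixes Q a :: "'a::field poly"
  assumes "irreducible Q" shows "Q dvd a * b \<longleftrightarrow> Q dvd a \<or> Q dvd b"
  using field_poly_irreducible_imp_prime[OF assms] by (simp add: prime_elem_dvd_mult_iff)

lemma irreducible_dvd_power_poly:
  fixes Q a :: "'a::field poly"
  assumes "irreducible Q" "Q dvd a ^ n" shows "Q dvd a"
  using field_poly_irreducible_imp_prime[OF assms(1)] assms(2) by (rule prime_elem_dvd_power)

lemma irreducible_degree_pos: "irreducible Q \<Longrightarrow> degree Q > 0" for Q :: "'a::field poly"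
  using is_unit_iff_degree[of Q] irreducible_not_unit[of Q] by (cases "Q = 0") auto

lemma monic_irreducible_factor:
  fixes n :: "'a::field poly"
  assumes "degree n > 0"
  obtains Q where "irreducible Q" "lead_coeff Q = 1" "Q dvd n"
proof -
  have "\<exists>Q. irreducible Q \<and> lead_coeff Q = 1 \<and> Q dvd n" using assms
  proof (induction "degree n" arbitrary: n rule: less_induct)
    case less
    show ?case
    proof (cases "irreducible n")
      case True
      have "n \<noteq> 0" using less.prems by auto
      then obtain b c where bc: "n = smult c b" "lead_coeff b = 1" "c \<noteq> 0"
        using monic_multiple[of n] by metis
      then have "n = b * [:c:]" "is_unit [:c:]" by (simp_all add: is_unit_const_poly_iff dvd_field_iff)
      have "irreducible b"
      proof (rule irreducibleI)
        show "b \<noteq> 0" using bc by auto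
        show "\<not> is_unit b" using True \<open>n = b * [:c:]\<close> \<open>is_unit [:c:]\<close> by (metis irreducible_not_unit is_unit_mult_iff)
        fix x y assume "b = x * y"
        then have "n = x * (y * [:c:])" using \<open>n = b * [:c:]\<close> by (simp only: mult.assoc)
        then show "is_unit x \<or> is_unit y" using True by (metis irreducibleD is_unit_mult_iff)
      qed
      then show ?thesis using bc \<open>n = b * [:c:]\<close> by (intro exI[of _ b]) (metis dvd_triv_left)
    next
      case False
      have "n \<noteq> 0" using less.prems by auto
      moreover from this have "\<not> is_unit n" using less.prems is_unit_iff_degree[of n] by auto
      ultimately obtain a b where ab: "n = a * b" "\<not> is_unit a" "\<not> is_unit b"
        using False unfolding irreducible_def by blast
      have "a \<noteq> 0" "b \<noteq> 0" using \<open>n \<noteq> 0\<close> ab by auto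
      then have "degree a > 0" "degree b > 0" "degree n = degree a + degree b"
        using ab by (auto simp: is_unit_iff_degree degree_mult_eq)
      then obtain Q where "irreducible Q" "lead_coeff Q = 1" "Q dvd a" using less.hyps[of a] by auto
      then show ?thesis using ab by (intro exI[of _ Q]) auto
    qed
  qed
  then show ?thesis using that by blast
qed

lemma irreducible_power_split:
  fixes Q n :: "'a::field poly"
  assumes "n \<noteq> 0" "irreducible Q"
  obtains k m where "n = Q ^ k * m" "\<not> Q dvd m"
proof -
  have "\<exists>k m. n = Q ^ k * m \<and> \<not> Q dvd m" using assms(1)
  proof (induction "degree n" arbitrary: n rule: less_induct)
    case less
    show ?case
    proof (cases "Q dvd n")
      case True
      then obtain n' where n': "n = Q * n'" by auto
      then have nz: "n' \<noteq> 0" "Q \<noteq> 0" using less.prems by auto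
      then have "degree n = degree Q + degree n'" unfolding n' by (rule degree_mult_eq[rotated])
      then have "degree n' < degree n" using irreducible_degree_pos[OF assms(2)] by simp
      then obtain k m where "n' = Q ^ k * m" "\<not> Q dvd m" using less.hyps[of n'] nz by blast
      then show ?thesis using n' by (intro exI[of _ "Suc k"] exI[of _ m]) (auto simp: mult.assoc)
    next
      case False
      then show ?thesis by (intro exI[of _ 0] exI[of _ n]) auto
    qed
  qed
  then show ?thesis using that by blast
qed

section \<open>Quadratic residues modulo an irreducible polynomial\<close>

text \<open>Multiplication by \<open>m\<close> permutes \<open>U\<close>, so it multiplies the
  non-zero product of \<open>U\<close> by \<open>m ^ card U\<close> without changing it. This yields
  Fermat's theorem both for F_q and for residue fields realised as subsets of a larger
  field.\<close>

lemma power_card_eq_1: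
  fixes m :: "'b::field"
  assumes "finite U" "0 \<notin> U" "m \<noteq> 0" "\<And>u. u \<in> U \<Longrightarrow> m * u \<in> U"
  shows "m ^ card U = 1"
proof -
  have inj: "inj_on ((*) m) U" using assms(3) by (auto simp: inj_on_def)
  have "(*) m ` U = U"
    using assms by (intro card_subset_eq) (auto simp: card_image[OF inj])
  then have "\<Prod>U = (\<Prod>u\<in>U. m * u)" using prod.reindex[OF inj, of "\<lambda>x. x"] by simp
  also have "\<dots> = m ^ card U * \<Prod>U" by (simp add: prod.distrib)
  finally have "\<Prod>U * (1 - m ^ card U) = 0" by (simp add: algebra_simps)
  moreover have "\<Prod>U \<noteq> 0" using assms by simp
  ultimately show ?thesis by auto
qed

lemma field_power_card: "(c :: 'a::{finite,field}) ^ CARD('a) = c"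
proof (cases "c = 0")
  case False
  have "c ^ card (UNIV - {0 :: 'a}) = 1" by (rule power_card_eq_1) (use False in auto)
  then have "c ^ (CARD('a) - 1) = 1" by (simp add: card_Diff_singleton)
  moreover have "CARD('a) = Suc (CARD('a) - 1)" by (simp add: card_gt_0_iff)
  ultimately show ?thesis by (metis mult.right_neutral power_Suc)
qed (simp add: card_gt_0_iff)

lemma prime_CHAR_finite_field: "prime CHAR('a::{finite,field})"
  using prime_CHAR_semidom[where 'a = 'a] finite_imp_CHAR_pos[where 'a = 'a] by simp

text \<open>An additively closed set \<open>W\<close> of \<open>p\<close>-power size, chosen as
  large as possible, must be everything: a missed element \<open>v\<close> would give the set of all
  i v + w, which is \<open>p\<close> times as large. The prime-power size is what makes the q-power
  map additive.\<close>

lemma card_finite_field_CHAR_power: "\<exists>n. CARD('a::{finite,field}) = CHAR('a) ^ n"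
proof -
  define p where "p = CHAR('a)"
  have p: "prime p" unfolding p_def by (rule prime_CHAR_finite_field)
  have p0: "of_nat p = (0::'a)" by (simp add: p_def)
  define sub where "sub W \<longleftrightarrow> 0 \<in> W \<and> (\<forall>x\<in>W. \<forall>y\<in>W. x + y \<in> W)" for W :: "'a set"
  define F where "F = {W. sub W \<and> (\<exists>n. card W = p ^ n)}"
  have "{0} \<in> F" by (auto simp: F_def sub_def intro: exI[of _ 0])
  then have "F \<noteq> {}" "finite F" by auto
  then have "Max (card ` F) \<in> card ` F" by (intro Max_in) auto
  then obtain W where W: "W \<in> F" "card W = Max (card ` F)" by auto
  have W2: "card V \<le> card W" if "V \<in> F" for V
    unfolding W(2) using that \<open>finite F\<close> by (intro Max_ge) auto
  obtain n where n: "card W = p ^ n" and sub: "sub W" using W(1) by (auto simp: F_def)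
  have mul: "of_nat t * x \<in> W" if "x \<in> W" for t x
  proof (induction t)
    case (Suc t)
    then show ?case using sub that by (simp add: sub_def distrib_right)
  qed (use sub in \<open>simp add: sub_def\<close>)
  have neg: "- x \<in> W" if "x \<in> W" for x
  proof -
    have "of_nat (p - 1) * x + x = of_nat (Suc (p - 1)) * x" by (simp only: of_nat_Suc distrib_right) simp
    also have "Suc (p - 1) = p" using p prime_gt_0_nat[of p] by simp
    finally have "- x = of_nat (p - 1) * x" using p0 by (metis add_eq_0_iff2 add.commute mult_zero_left)
    then show ?thesis using mul[OF that] by simp
  qed
  have "v \<in> W" for v
  proof (rule ccontr)
    assume v: "v \<notin> W"
    define h where "h = (\<lambda>(i, w). of_nat i * v + w)"
    define V where "V = h ` ({..<p} \<times> W)"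
    \<comment> \<open>If two representations coincide, then (j - i) v lies in \<open>W\<close>, and
      inverting \<open>j - i\<close> modulo \<open>p\<close> puts \<open>v\<close> itself into
      \<open>W\<close>.\<close>
    have key: False if "i < j" "j < p" "w \<in> W" "w' \<in> W" "of_nat i * v + w = of_nat j * v + w'" for i j w w'
    proof -
      have e: "of_nat (j - i) * v = w + - w'" using that by (simp add: of_nat_diff algebra_simps)
      have "w + - w' \<in> W" using neg that sub unfolding sub_def by blast
      have "coprime (j - i) p" using that p
        by (metis coprime_commute diff_le_self dual_order.strict_trans1 le_less_trans nat_dvd_not_less prime_imp_coprime zero_less_diff)
      then obtain t where "[(j - i) * t = Suc 0] (mod p)" using cong_solve_coprime_nat by blast
      then have "of_nat ((j - i) * t) = (of_nat 1 :: 'a)" unfolding of_nat_eq_iff_cong_CHAR p_def One_nat_def .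
      then have one: "of_nat t * of_nat (j - i) = (1::'a)" by (simp only: of_nat_mult of_nat_1 mult.commute)
      have "v = of_nat t * (w + - w')" unfolding e[symmetric] mult.assoc[symmetric] one by simp
      then have "v \<in> W" using mul[OF \<open>w + - w' \<in> W\<close>] by simp
      then show False using v by simp
    qed
    have inj: "inj_on h ({..<p} \<times> W)"
    proof (rule inj_onI)
      fix z z' assume z: "z \<in> {..<p} \<times> W" "z' \<in> {..<p} \<times> W" "h z = h z'"
      obtain i w j w' where zz: "z = (i, w)" "z' = (j, w')" by (cases z, cases z')
      then have a: "i \<in> {..<p}" "w \<in> W" "j \<in> {..<p}" "w' \<in> W" "h (i, w) = h (j, w')" using z by auto
      then have e: "of_nat i * v + w = of_nat j * v + w'" by (simp add: h_def)
      have "i = j" using key[of i j w w'] key[of j i w' w] a e by (metis lessThan_iff linorder_neqE_nat)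
      then show "z = z'" using e zz by simp
    qed
    have cV: "card V = p ^ Suc n" unfolding V_def by (simp add: card_image[OF inj] card_cartesian_product n)
    have "sub V" unfolding sub_def
    proof (intro conjI ballI)
      show "0 \<in> V" unfolding V_def using sub prime_gt_0_nat[OF p]
        by (intro image_eqI[where x = "(0, 0)"]) (auto simp: h_def sub_def)
      fix x y assume "x \<in> V" "y \<in> V"
      then obtain i w j w' where a: "w \<in> W" "w' \<in> W" "x = of_nat i * v + w" "y = of_nat j * v + w'"
        by (auto simp: V_def h_def)
      have "of_nat ((i + j) mod p) = (of_nat (i + j) :: 'a)"
        unfolding of_nat_eq_iff_cong_CHAR p_def cong_def by simp
      then have "x + y = h ((i + j) mod p, w + w')" using a by (simp add: h_def algebra_simps)
      then show "x + y \<in> V" unfolding V_def using a sub prime_gt_0_nat[OF p]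
        by (intro image_eqI) (auto simp: sub_def)
    qed
    then have "V \<in> F" using cV by (auto simp: F_def simp del: power_Suc)
    then show False using W2[of V] cV n p prime_gt_1_nat[OF p] by simp
  qed
  then have "W = UNIV" by auto
  then show ?thesis using n p_def by auto
qed

lemma finite_field_card_gt_1: "CARD('a::{finite,field}) > 1"
proof -
  have "card {0, 1 :: 'a} \<le> CARD('a)" by (rule card_mono) auto
  then show ?thesis by simp
qed

lemma two_ne_0_finite_field:
  assumes "odd CARD('a::{finite,field})" shows "(2::'a) \<noteq> 0"
proof
  assume "(2::'a) = 0"
  then have "of_nat 2 = (0::'a)" by simp
  then have "CHAR('a) dvd 2" by (simp only: of_nat_eq_0_iff_char_dvd)
  then have "CHAR('a) = 2" using prime_CHAR_finite_field[where 'a = 'a] two_is_prime_nat primes_dvd_imp_eq by blast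
  moreover obtain n where "CARD('a) = CHAR('a) ^ n" using card_finite_field_CHAR_power by blast
  moreover have "CARD('a) \<noteq> 1" using finite_field_card_gt_1[where 'a = 'a] by simp
  ultimately show False using assms by (cases n) (simp_all only: power_0 power_Suc even_mult_iff even_numeral simp_thms)
qed

section \<open>Residue fields inside the algebraic closure\<close>

definition ev :: "'a::field alg_closure \<Rightarrow> 'a poly \<Rightarrow> 'a alg_closure" where
  "ev x p = poly (map_poly to_ac p) x"

lemma ev_0 [simp]: "ev x 0 = 0" by (simp add: ev_def)

lemma ev_pCons [simp]: "ev x (pCons c p) = to_ac c + x * ev x p"
  by (simp add: ev_def map_poly_pCons)

lemma ev_1 [simp]: "ev x 1 = 1" by (simp add: one_pCons)

lemma ev_add [simp]: "ev x (p + r) = ev x p + ev x r"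
proof (induction p arbitrary: r)
  case (pCons c p)
  obtain b s where "r = pCons b s" by (cases r)
  then show ?case by (simp add: pCons.IH algebra_simps)
qed simp

lemma ev_smult [simp]: "ev x (smult c p) = to_ac c * ev x p"
  by (induction p) (simp_all add: algebra_simps)

lemma ev_mult [simp]: "ev x (p * r) = ev x p * ev x r"
  by (induction p) (simp_all add: algebra_simps)

lemma ev_uminus [simp]: "ev x (- p) = - ev x p"
  using ev_add[of x p "- p"] by (simp add: add_eq_0_iff2 del: ev_add)

lemma ev_diff [simp]: "ev x (p - r) = ev x p - ev x r"
  using ev_add[of x p "- r"] by (simp del: ev_add)

lemma ev_power [simp]: "ev x (p ^ n) = ev x p ^ n"
  by (induction n) simp_all

lemma ev_root_exists:
  assumes "degree Q > 0" obtains x where "ev x Q = 0"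
proof -
  have "degree (map_poly to_ac Q) > 0" using assms by (simp add: degree_map_poly)
  then show ?thesis using that alg_closed_imp_poly_has_root unfolding ev_def by blast
qed

text \<open>By Bezout a polynomial prime to \<open>Q\<close> cannot vanish at a root of
  \<open>Q\<close>. So \<open>ev x\<close> has kernel (Q) and its image is a copy of the residue
  field; residue fields of different primes thus lie in one field, where they can be
  compared.\<close>

lemma ev_eq_0_iff:
  assumes "irreducible Q" "ev x Q = 0"
  shows "ev x p = 0 \<longleftrightarrow> Q dvd p"
proof
  assume z: "ev x p = 0"
  show "Q dvd p"
  proof (rule ccontr)
    assume "\<not> Q dvd p"
    then obtain u v where "u * Q + v * p = 1"
      using assms(1) irreducible_coprime_poly coprime_bezout_poly by blast
    then have "ev x (u * Q + v * p) = 1" by simp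
    then show False using assms(2) z by simp
  qed
qed (use assms in auto)

lemma ev_mod: "ev x Q = 0 \<Longrightarrow> ev x (p mod Q) = ev x p"
  using ev_add[of x "Q * (p div Q)" "p mod Q"] by (simp del: ev_add)

lemma inj_on_ev:
  assumes "irreducible Q" "ev x Q = 0" shows "inj_on (ev x) (polys (degree Q))"
proof (rule inj_onI)
  fix a b assume ab: "a \<in> polys (degree Q)" "b \<in> polys (degree Q)" "ev x a = ev x b"
  then have "ev x (a - b) = 0" by simp
  then have "Q dvd a - b" using ev_eq_0_iff[OF assms] by blast
  then show "a = b" using ab polys_cong_eq by (metis cong_iff_dvd_diff)
qed

lemma power_card_add:
  fixes x y :: "'a::{finite,field} alg_closure"
  shows "(x + y) ^ CARD('a) = x ^ CARD('a) + y ^ CARD('a)"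
proof -
  obtain n where n: "CARD('a) = CHAR('a) ^ n" using card_finite_field_CHAR_power by blast
  show ?thesis
    by (rule freshmans_dream'[where n = n]) (use n prime_CHAR_finite_field[where 'a = 'a] in simp_all)
qed

text \<open>The q-power map is additive and fixes the coefficients, so it passes from the value to
  the point of evaluation. The powers x^(q^i) are therefore further roots of whatever polynomial
  vanishes at \<open>x\<close>.\<close>

lemma ev_frobenius:
  fixes p :: "'a::{finite,field} poly"
  shows "ev (x ^ CARD('a)) p = ev x p ^ CARD('a)"
proof (induction p)
  case (pCons c p)
  have "to_ac c ^ CARD('a) = to_ac c" by (metis to_ac_power field_power_card)
  then show ?case by (simp add: power_card_add pCons.IH power_mult_distrib)
qed (simp add: card_gt_0_iff)

lemma ev_frobenius_power:
  fixes p :: "'a::{finite,field} poly"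
  shows "ev (x ^ (CARD('a) ^ i)) p = ev x p ^ (CARD('a) ^ i)"
proof (induction i)
  case (Suc i)
  then show ?case using ev_frobenius[of "x ^ (CARD('a) ^ i)" p]
    by (simp add: power_mult[symmetric] mult.commute)
qed simp

lemma frobenius_power_inj:
  fixes x y :: "'a::{finite,field} alg_closure"
  assumes "x ^ (CARD('a) ^ i) = y ^ (CARD('a) ^ i)" shows "x = y"
  using assms
proof (induction i)
  case (Suc i)
  define u v where "u = x ^ (CARD('a) ^ i)" and "v = y ^ (CARD('a) ^ i)"
  have "u ^ CARD('a) = v ^ CARD('a)" using Suc.prems unfolding u_def v_def
    by (simp add: power_mult[symmetric] mult.commute)
  moreover have "u ^ CARD('a) = (u - v) ^ CARD('a) + v ^ CARD('a)" using power_card_add[of "u - v" v] by simp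
  ultimately have "u = v" by simp
  then show ?case using Suc.IH by (simp add: u_def v_def)
qed simp

lemma card_power_eq_le:
  fixes c :: "'b::idom"
  assumes "n > 0" shows "finite {x :: 'b. x ^ n = c} \<and> card {x :: 'b. x ^ n = c} \<le> n"
proof -
  define f where "f = monom 1 n + [:- c:]"
  have d: "degree f = n" unfolding f_def using assms
    by (subst degree_add_eq_left) (simp_all add: degree_monom_eq)
  then have f: "f \<noteq> 0" using assms by auto
  have "{x. poly f x = 0} = {x. x ^ n = c}" by (simp add: f_def poly_monom)
  then show ?thesis using poly_roots_finite[OF f] card_poly_roots_bound[OF f] d by simp
qed

lemma card_frobenius_fixed_le:
  fixes n :: nat
  assumes "n > 1" shows "finite {x :: 'b::idom. x ^ n = x} \<and> card {x :: 'b. x ^ n = x} \<le> n"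
proof -
  define f where "f = monom 1 n + [:0, - 1::'b:]"
  have d: "degree f = n" unfolding f_def using assms
    by (subst degree_add_eq_left) (simp_all add: degree_monom_eq)
  then have f: "f \<noteq> 0" using assms by auto
  have "{x. poly f x = 0} = {x. x ^ n = x}" by (simp add: f_def poly_monom)
  then show ?thesis using poly_roots_finite[OF f] card_poly_roots_bound[OF f] d by simp
qed

text \<open>Fermat's theorem in the residue field: the non-zero reduced residues give q^(deg Q) - 1
  values, a set preserved by multiplication with \<open>ev x p\<close>.\<close>

lemma residue_power_card:
  fixes Q :: "'a::{finite,field} poly"
  assumes Q: "irreducible Q" "ev x Q = 0" and p: "\<not> Q dvd p"
  shows "ev x p ^ (CARD('a) ^ degree Q - 1) = 1"
proof -
  let ?U = "ev x ` (polys (degree Q) - {0})"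
  have Q0: "Q \<noteq> 0" using Q by auto
  have nd: "\<not> Q dvd a" if "a \<in> polys (degree Q) - {0}" for a
    using that polys_dvd_eq_0 by blast
  have "ev x p ^ card ?U = 1"
  proof (rule power_card_eq_1)
    show "0 \<notin> ?U" using nd ev_eq_0_iff[OF Q] by force
    show "ev x p \<noteq> 0" using p ev_eq_0_iff[OF Q] by auto
    fix u assume "u \<in> ?U"
    then obtain a where a: "u = ev x a" "a \<in> polys (degree Q) - {0}" by blast
    have "\<not> Q dvd p * a" using a p nd Q(1) irreducible_dvd_mult_poly by blast
    then have "(p * a) mod Q \<noteq> 0" by auto
    moreover have "ev x p * u = ev x ((p * a) mod Q)" using ev_mod[OF Q(2)] a by simp
    ultimately show "ev x p * u \<in> ?U" using mod_in_polys[OF Q0] by blast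
  qed auto
  moreover have "card ?U = CARD('a) ^ degree Q - 1"
    using inj_on_subset[OF inj_on_ev[OF Q], of "polys (degree Q) - {0}"]
    by (simp add: card_image card_Diff_singleton card_polys)
  ultimately show ?thesis by simp
qed

lemma odd_card_power: "odd q \<Longrightarrow> 2 * ((q ^ k - 1) div 2) = q ^ k - (1::nat)"
  by simp

lemma residue_power_half_card:
  fixes Q :: "'a::{finite,field} poly"
  assumes Q: "irreducible Q" "ev x Q = 0" and p: "\<not> Q dvd p" and odd: "odd CARD('a)"
  shows "ev x p ^ ((CARD('a) ^ degree Q - 1) div 2) = 1 \<or> ev x p ^ ((CARD('a) ^ degree Q - 1) div 2) = - 1"
proof -
  let ?y = "ev x p ^ ((CARD('a) ^ degree Q - 1) div 2)"
  have "?y ^ 2 = ev x p ^ (2 * ((CARD('a) ^ degree Q - 1) div 2))" by (simp only: power_mult[symmetric] mult.commute)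
  also have "\<dots> = 1" using residue_power_card[OF Q p] odd_card_power[OF odd] by simp
  finally have "?y ^ 2 = 1" .
  then show ?thesis by (simp only: power2_eq_1_iff)
qed

text \<open>With n the exponent, squaring is at most two-to-one on the 2n non-zero residues, so
  there are at least n non-zero squares. All of them are roots of u^n = 1, which has at most n
  roots, so the two sets coincide.\<close>

lemma euler_criterion_poly:
  fixes Q :: "'a::{finite,field} poly"
  assumes Q: "irreducible Q" "ev x Q = 0" and p: "\<not> Q dvd p" and odd: "odd CARD('a)"
  shows "ev x p ^ ((CARD('a) ^ degree Q - 1) div 2) = 1 \<longleftrightarrow> (\<exists>b. Q dvd b\<^sup>2 - p)"
proof -
  let ?n = "(CARD('a) ^ degree Q - 1) div 2"
  let ?U = "ev x ` (polys (degree Q) - {0})"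
  have Q0: "Q \<noteq> 0" using Q by auto
  have dQ: "degree Q > 0" using irreducible_degree_pos Q by blast
  have n2: "2 * ?n = CARD('a) ^ degree Q - 1" by (rule odd_card_power[OF odd])
  have "CARD('a) ^ degree Q > 1" using finite_field_card_gt_1 dQ by (metis one_less_power)
  then have n0: "?n > 0" using n2 by linarith
  have sq: "(ev x b ^ 2) ^ ?n = 1" if "\<not> Q dvd b" for b
    unfolding power_mult[symmetric] n2 by (rule residue_power_card[OF Q that])
  have nd: "\<not> Q dvd a" if "a \<in> polys (degree Q) - {0}" for a
    using that polys_dvd_eq_0 by blast
  let ?S = "(\<lambda>u. u ^ 2) ` ?U" and ?R = "{u. u ^ ?n = (1 :: 'a alg_closure)}"
  have SR: "?S \<subseteq> ?R" using sq nd by auto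
  have fU: "finite ?U" by simp
  have cU: "card ?U = 2 * ?n"
    using inj_on_subset[OF inj_on_ev[OF Q], of "polys (degree Q) - {0}"] n2
    by (simp add: card_image card_Diff_singleton card_polys)
  have "card ?U = (\<Sum>s\<in>?S. card {u \<in> ?U. u ^ 2 = s})"
    using sum.image_gen[OF fU, of "\<lambda>_. 1::nat" "\<lambda>u. u ^ 2"] by simp
  also have "\<dots> \<le> (\<Sum>s\<in>?S. 2)"
  proof (rule sum_mono)
    fix s assume "s \<in> ?S"
    have "card {u \<in> ?U. u ^ 2 = s} \<le> card {u. u ^ 2 = s}"
      using card_power_eq_le[of 2 s] by (intro card_mono) auto
    then show "card {u \<in> ?U. u ^ 2 = s} \<le> 2" using card_power_eq_le[of 2 s] by simp
  qed
  finally have "?n \<le> card ?S" using cU by simp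
  then have "?S = ?R" using SR card_power_eq_le[OF n0, of "1 :: 'a alg_closure"] by (intro card_seteq) auto
  show ?thesis
  proof
    assume "ev x p ^ ?n = 1"
    then have "ev x p \<in> ?S" using \<open>?S = ?R\<close> by simp
    then obtain b where "ev x p = ev x b ^ 2" by auto
    then have "ev x (b\<^sup>2 - p) = 0" by simp
    then show "\<exists>b. Q dvd b\<^sup>2 - p" using ev_eq_0_iff[OF Q] by blast
  next
    assume "\<exists>b. Q dvd b\<^sup>2 - p"
    then obtain b where b: "Q dvd b\<^sup>2 - p" by blast
    then have e: "ev x p = ev x b ^ 2" using ev_eq_0_iff[OF Q, of "b\<^sup>2 - p"] by simp
    then have "\<not> Q dvd b" using p ev_eq_0_iff[OF Q] by (metis zero_power2)
    then show "ev x p ^ ?n = 1" using sq e by simp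
  qed
qed

text \<open>The conjugates x^(q^i) with i < deg Q are distinct roots of \<open>Q\<close>. As
  \<open>Q\<close> and the product over them are monic, their difference has degree below deg Q, yet
  it vanishes at all deg Q points.\<close>

lemma root_product:
  fixes Q :: "'a::{finite,field} poly"
  assumes Q: "irreducible Q" "ev x Q = 0" "lead_coeff Q = 1"
  shows "ev y Q = (\<Prod>i<degree Q. y - x ^ (CARD('a) ^ i))"
proof -
  let ?q = "CARD('a)"
  let ?Q = "map_poly to_ac Q"
  let ?T = "\<Prod>i<degree Q. [:- (x ^ (?q ^ i)), 1:]"
  have ninj: False if "i < j" "j < degree Q" "x ^ (?q ^ i) = x ^ (?q ^ j)" for i j
  proof -
    define t where "t = j - i"
    have t: "j = t + i" "0 < t" "t < degree Q" using that by (auto simp: t_def)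
    have "(x ^ (?q ^ t)) ^ (?q ^ i) = x ^ (?q ^ i)" using that(3) t(1) by (simp add: power_mult[symmetric] power_add[symmetric])
    \<comment> \<open>A coincidence of conjugates makes \<open>x\<close> a fixed point of a smaller
      Frobenius power. Then the whole residue field is fixed, and u^(q^t) = u has more than q^t
      roots.\<close>
    then have "x ^ (?q ^ t) = x" by (rule frobenius_power_inj)
    then have "ev x ` polys (degree Q) \<subseteq> {u. u ^ (?q ^ t) = u}" using ev_frobenius_power[of x t] by auto
    moreover have "?q ^ t > 1" using t finite_field_card_gt_1[where 'a = 'a] by (metis one_less_power)
    ultimately have "card (ev x ` polys (degree Q)) \<le> ?q ^ t"
      using card_frobenius_fixed_le[of "?q ^ t", where 'b = "'a alg_closure"] by (meson card_mono le_trans)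
    then have "?q ^ degree Q \<le> ?q ^ t" by (simp add: card_image inj_on_ev[OF Q(1,2)] card_polys)
    moreover have "?q ^ t < ?q ^ degree Q" using t finite_field_card_gt_1[where 'a = 'a]
      by (intro power_strict_increasing)
    ultimately show False by simp
  qed
  have inj: "inj_on (\<lambda>i. x ^ (?q ^ i)) {..<degree Q}"
    using ninj by (intro inj_onI) (metis lessThan_iff linorder_neqE_nat)
  have mon: "(\<Prod>i<n. [:- (x ^ (?q ^ i)), 1:]) \<in> monics n" for n
  proof (induction n)
    case (Suc n)
    have "[:- (x ^ (?q ^ n)), 1:] \<in> monics 1" by (simp add: monics_def)
    from monics_mult[OF Suc this] show ?case by simp
  qed simp
  have dQ: "degree ?Q = degree Q" by (simp add: degree_map_poly)
  have mQ: "?Q \<in> monics (degree Q)" using Q(3) dQ by (simp add: monics_def coeff_map_poly)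
  have "?Q - ?T \<in> polys (degree Q)"
    using mQ mon[of "degree Q"] polys_diff unfolding monics_eq by fastforce
  have "?Q = ?T"
  proof (rule ccontr)
    assume "?Q \<noteq> ?T"
    then have nz: "?Q - ?T \<noteq> 0" by simp
    then have "card {u. poly (?Q - ?T) u = 0} < degree Q"
      using card_poly_roots_bound[OF nz] \<open>?Q - ?T \<in> polys (degree Q)\<close> by (auto simp: polys_iff)
    moreover have "(\<lambda>i. x ^ (?q ^ i)) ` {..<degree Q} \<subseteq> {u. poly (?Q - ?T) u = 0}"
    proof (rule image_subsetI, rule CollectI)
      fix i assume i: "i \<in> {..<degree Q}"
      have "ev (x ^ (?q ^ i)) Q = 0" using ev_frobenius_power[of x i Q] Q(2) by (simp add: card_gt_0_iff)
      moreover have "poly ?T (x ^ (?q ^ i)) = 0" using i by (auto simp: poly_prod)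
      ultimately show "poly (?Q - ?T) (x ^ (?q ^ i)) = 0" by (simp add: ev_def)
    qed
    then have "card ((\<lambda>i. x ^ (?q ^ i)) ` {..<degree Q}) \<le> card {u. poly (?Q - ?T) u = 0}"
      using poly_roots_finite[OF nz] by (rule card_mono[rotated])
    ultimately show False by (simp add: card_image[OF inj])
  qed
  then show ?thesis by (simp add: ev_def poly_prod)
qed

text \<open>Splits Euler's exponent into 1 + q + ... + q^(k-1), which takes the norm down to F_q,
  and (q-1)/2, which is Euler's exponent in F_q.\<close>

lemma geometric_half:
  fixes q :: nat assumes "odd q"
  shows "(q ^ k - 1) div 2 = (\<Sum>i<k. q ^ i) * ((q - 1) div 2)"
proof -
  have q: "q = 2 * ((q - 1) div 2) + 1" using assms by (auto elim!: oddE)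
  have "(\<Sum>i<k. q ^ i) * (q - 1) + 1 = q ^ k"
  proof (induction k)
    case (Suc k)
    have "(\<Sum>i<Suc k. q ^ i) * (q - 1) + 1 = q ^ k * (q - 1) + q ^ k"
      using Suc by (simp add: algebra_simps)
    also have "\<dots> = q ^ Suc k" using q by (metis add.commute add_diff_cancel_right' mult.commute mult_Suc_right Suc_eq_plus1 power_Suc)
    finally show ?case .
  qed simp
  then have "q ^ k - 1 = (\<Sum>i<k. q ^ i) * (2 * ((q - 1) div 2))" using q by (metis add_diff_cancel_right')
  then show ?thesis by simp
qed

text \<open>The first factor of the exponent turns \<open>ev x Q\<close> into its norm, the product
  of the values of \<open>Q\<close> at the conjugates of \<open>x\<close>; splitting
  \<open>Q\<close> into its roots gives the resultant of the two polynomials.\<close>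

lemma residue_power_resultant:
  fixes P Q :: "'a::{finite,field} poly"
  assumes "irreducible P" "lead_coeff P = 1" "ev x P = 0"
    and "irreducible Q" "lead_coeff Q = 1" "ev y Q = 0" and "odd CARD('a)"
  shows "ev x Q ^ ((CARD('a) ^ degree P - 1) div 2) =
    (\<Prod>i<degree P. \<Prod>j<degree Q. x ^ (CARD('a) ^ i) - y ^ (CARD('a) ^ j)) ^ ((CARD('a) - 1) div 2)"
proof -
  have "ev x Q ^ (\<Sum>i<degree P. CARD('a) ^ i) = (\<Prod>i<degree P. ev (x ^ (CARD('a) ^ i)) Q)"
    by (simp add: power_sum ev_frobenius_power)
  also have "\<dots> = (\<Prod>i<degree P. \<Prod>j<degree Q. x ^ (CARD('a) ^ i) - y ^ (CARD('a) ^ j))"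
    by (intro prod.cong refl root_product assms)
  finally show ?thesis using geometric_half[OF assms(7)] by (simp add: power_mult)
qed

text \<open>Both sides of the reciprocity law are powers of the resultant of \<open>P\<close> and \<open>Q\<close>.\<close>

theorem quadratic_reciprocity_poly:
  fixes P Q :: "'a::{finite,field} poly"
  assumes q: "CARD('a) mod 4 = 3" and P: "irreducible P" "lead_coeff P = 1" "odd (degree P)"
    and Q: "irreducible Q" "lead_coeff Q = 1" "Q \<noteq> P"
  shows "(\<exists>b. P dvd b\<^sup>2 - Q) \<longleftrightarrow> (\<exists>b. Q dvd b\<^sup>2 + P)"
proof -
  obtain x where x: "ev x P = 0" using ev_root_exists irreducible_degree_pos P by blast
  obtain y where y: "ev y Q = 0" using ev_root_exists irreducible_degree_pos Q by blast
  have ndvd: "\<not> P dvd Q" "\<not> Q dvd P"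
  proof -
    have "\<not> is_unit P" "\<not> is_unit Q" using P Q by (auto simp: irreducible_not_unit)
    then show "\<not> P dvd Q" "\<not> Q dvd P"
      using P Q irreducibleD'[OF P(1), of Q] irreducibleD'[OF Q(1), of P] monic_dvd_antisym by blast+
  qed
  have odd: "odd CARD('a)" using q by presburger
  have h: "odd ((CARD('a) - 1) div 2)" using q by presburger
  let ?n = "(CARD('a) ^ degree Q - 1) div 2"
  have "odd (\<Sum>i<k. CARD('a) ^ i) \<longleftrightarrow> odd k" for k
    by (induction k) (use odd in auto)
  then have n: "odd ?n \<longleftrightarrow> odd (degree Q)" using h geometric_half[OF odd] by simp
  define R where "R = (\<Prod>i<degree P. \<Prod>j<degree Q. x ^ (CARD('a) ^ i) - y ^ (CARD('a) ^ j))"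
  have "(\<Prod>j<degree Q. \<Prod>i<degree P. y ^ (CARD('a) ^ j) - x ^ (CARD('a) ^ i))
      = (\<Prod>i<degree P. \<Prod>j<degree Q. (- 1) * (x ^ (CARD('a) ^ i) - y ^ (CARD('a) ^ j)))"
    by (subst prod.swap) simp
  also have "\<dots> = (\<Prod>i<degree P. \<Prod>j<degree Q. - 1) * R" unfolding R_def by (simp only: prod.distrib)
  also have "(\<Prod>i<degree P. \<Prod>j<degree Q. - 1) = (- 1 :: 'a alg_closure) ^ (degree Q * degree P)"
    by (simp add: power_mult)
  also have "\<dots> = (- 1) ^ degree Q" using P(3) by (metis power_mult power_minus_odd power_one mult.commute neg_one_odd_power)
  finally have R': "(\<Prod>j<degree Q. \<Prod>i<degree P. y ^ (CARD('a) ^ j) - x ^ (CARD('a) ^ i)) = (- 1) ^ degree Q * R" .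
  have "ev y (- P) ^ ?n = (- 1) ^ ?n * ev y P ^ ?n" by (simp add: power_minus[of "ev y P"])
  also have "ev y P ^ ?n = ((- 1) ^ degree Q * R) ^ ((CARD('a) - 1) div 2)"
    using residue_power_resultant[OF Q(1,2) y P(1,2) x odd] R' by simp
  \<comment> \<open>Exchanging the roles of \<open>P\<close> and \<open>Q\<close> in the resultant
    costs (-1)^(deg Q), as deg P is odd, and this survives the odd power (q-1)/2. Replacing P by -P
    costs (-1)^n with n of the same parity as deg Q, so the two signs cancel.\<close>
  also have "(- 1) ^ ?n * \<dots> = R ^ ((CARD('a) - 1) div 2)"
    using n h by (cases "odd (degree Q)") (simp_all add: power_mult_distrib)
  also have "\<dots> = ev x Q ^ ((CARD('a) ^ degree P - 1) div 2)"
    using residue_power_resultant[OF P(1,2) x Q(1,2) y odd] R_def by simp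
  finally have "ev y (- P) ^ ?n = ev x Q ^ ((CARD('a) ^ degree P - 1) div 2)" .
  moreover have "\<not> Q dvd - P" using ndvd by simp
  ultimately show ?thesis
    using euler_criterion_poly[OF P(1) x ndvd(1) odd] euler_criterion_poly[OF Q(1) y _ odd, of "- P"] by simp
qed

section \<open>The quadratic character and the number of ideals of given norm\<close>

lemma irreducible_power_mult_dvd_iff:
  fixes Q c m :: "'a::field poly"
  assumes Q: "irreducible Q" and c: "\<not> Q dvd c" and m: "\<not> Q dvd m"
  shows "Q ^ i * c dvd Q ^ k * m \<longleftrightarrow> i \<le> k \<and> c dvd m"
proof
  assume d: "Q ^ i * c dvd Q ^ k * m"
  have Q0: "Q \<noteq> 0" using Q by auto
  have "coprime c (Q ^ k)" using c Q irreducible_coprime_poly coprime_power_poly coprime_commute by metis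
  then have "c dvd m" using d coprime_dvd_mult_poly dvd_mult_right by blast
  moreover have "i \<le> k"
  proof (rule ccontr)
    assume "\<not> i \<le> k"
    then have "Q ^ k * Q dvd Q ^ i" by (metis Suc_leI le_imp_power_dvd linorder_not_le power_Suc2)
    then have "Q ^ k * Q dvd Q ^ k * m" using d dvd_mult_left dvd_trans by blast
    then show False using m Q0 by (simp add: dvd_mult_cancel_left)
  qed
  ultimately show "i \<le> k \<and> c dvd m" by blast
qed (simp add: le_imp_power_dvd mult_dvd_mono)

lemma monic_mult: "lead_coeff a = 1 \<Longrightarrow> lead_coeff b = 1 \<Longrightarrow> lead_coeff (a * b) = 1"
  for a b :: "'a::field poly"
  by (simp add: lead_coeff_mult)

lemma monic_power: "lead_coeff a = 1 \<Longrightarrow> lead_coeff (a ^ n) = 1"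
  for a :: "'a::field poly"
  by (simp add: lead_coeff_power)

lemma monic_factor: "lead_coeff (a * b) = 1 \<Longrightarrow> lead_coeff a = 1 \<Longrightarrow> lead_coeff b = 1"
  for a b :: "'a::field poly"
  by (simp add: lead_coeff_mult)

lemma finite_monic_divisors:
  fixes n :: "'a::{finite,field} poly"
  assumes "n \<noteq> 0" shows "finite {m. lead_coeff m = 1 \<and> m dvd n}"
proof (rule finite_subset)
  show "{m. lead_coeff m = 1 \<and> m dvd n} \<subseteq> polys (Suc (degree n))"
    using assms by (auto simp: polys_iff le_imp_less_Suc dvd_imp_degree_le)
qed simp

text \<open>Splits off the \<open>Q\<close>-part of a divisor. It is used with \<open>j = 1\<close>
  for divisors and \<open>j = 2\<close> for square divisors, so that both sides of the convolution
  identity lose one prime power at a time.\<close>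

lemma bij_betw_irreducible_power_mult:
  fixes Q m :: "'a::field poly" and j :: nat
  assumes Q: "irreducible Q" "lead_coeff Q = 1" and m: "\<not> Q dvd m" and j: "j > 0"
  shows "bij_betw (\<lambda>(i, c). Q ^ i * c) ({i. j * i \<le> k} \<times> {c. lead_coeff c = 1 \<and> c ^ j dvd m})
    {c. lead_coeff c = 1 \<and> c ^ j dvd Q ^ k * m}" (is "bij_betw ?f ?A ?B")
proof -
  have nd: "\<not> Q dvd c" if "c ^ j dvd m" for c
    using that m j by (metis dvd_power dvd_trans)
  have iff: "(Q ^ i * c) ^ j dvd Q ^ k * m \<longleftrightarrow> j * i \<le> k \<and> c ^ j dvd m" if "\<not> Q dvd c" for i c
  proof -
    have "\<not> Q dvd c ^ j" using that Q irreducible_dvd_power_poly by blast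
    from irreducible_power_mult_dvd_iff[OF Q(1) this m, of "i * j" k] show ?thesis
      by (simp add: power_mult_distrib power_mult[symmetric] mult.commute)
  qed
  have inj: "inj_on ?f ?A"
  proof (rule inj_onI)
    fix z z' assume z: "z \<in> ?A" "z' \<in> ?A" "?f z = ?f z'"
    obtain i c i' c' where zz: "z = (i, c)" "z' = (i', c')" by (cases z, cases z')
    then have a: "\<not> Q dvd c" "\<not> Q dvd c'" "lead_coeff c = 1" "lead_coeff c' = 1" and e: "Q ^ i * c = Q ^ i' * c'"
      using z nd by auto
    have "i \<le> i' \<and> c dvd c'" using irreducible_power_mult_dvd_iff[OF Q(1) a(1,2), of i i'] e by simp
    moreover have "i' \<le> i \<and> c' dvd c" using irreducible_power_mult_dvd_iff[OF Q(1) a(2,1), of i' i] e by simp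
    ultimately show "z = z'" using zz monic_dvd_antisym[OF a(3,4)] by simp
  qed
  have sub: "?f ` ?A \<subseteq> ?B"
  proof (rule image_subsetI)
    fix z assume z: "z \<in> ?A"
    obtain i c where zz: "z = (i, c)" by (cases z)
    have "lead_coeff (Q ^ i * c) = 1" using z zz Q by (simp add: monic_mult monic_power)
    then show "?f z \<in> ?B" using z zz iff[of c i] nd by simp
  qed
  have sup: "?B \<subseteq> ?f ` ?A"
  proof
    fix c assume c: "c \<in> ?B"
    then have "c \<noteq> 0" by auto
    then obtain i c' where c': "c = Q ^ i * c'" "\<not> Q dvd c'" using irreducible_power_split[OF _ Q(1)] by blast
    have "lead_coeff c' = 1" using c unfolding c'(1) by (intro monic_factor[of "Q ^ i" c'] monic_power Q(2)) simp
    then have "(i, c') \<in> ?A" using c c' iff[of c' i] by simp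
    then show "c \<in> ?f ` ?A" using c' by force
  qed
  show ?thesis unfolding bij_betw_def using inj sub sup by blast
qed

section \<open>The quadratic character modulo P and its sums over monics\<close>

locale odd_prime_poly =
  fixes P :: "'a::{finite,field} poly"
  assumes card_mod_4: "CARD('a) mod 4 = 3"
    and monic_P: "lead_coeff P = 1" and irreducible_P: "irreducible P" and odd_degree_P: "odd (degree P)"
begin

lemma odd_card: "odd CARD('a)"
  using card_mod_4 by presburger

lemma two_ne_0: "(2::'a) \<noteq> 0"
  using odd_card by (rule two_ne_0_finite_field)

lemma P_nonzero: "P \<noteq> 0"
  using monic_P by auto

lemma degree_P_pos: "degree P > 0"
  using odd_degree_P by presburger

definition root :: "'a alg_closure" where "root = (SOME x. ev x P = 0)"

lemma ev_root: "ev root P = 0"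
  unfolding root_def using ev_root_exists[OF degree_P_pos] by (rule someI_ex) blast

definition half :: nat where "half = (CARD('a) ^ degree P - 1) div 2"

lemma odd_geometric: "odd (\<Sum>i<k. CARD('a) ^ i) \<longleftrightarrow> odd k"
  by (induction k) (use odd_card in auto)

lemma odd_half: "odd half"
proof -
  have "odd ((CARD('a) - 1) div 2)" using card_mod_4 by presburger
  then show ?thesis unfolding half_def using odd_geometric odd_degree_P geometric_half[OF odd_card] by simp
qed

definition chi :: "'a poly \<Rightarrow> int" where
  "chi m = (if P dvd m then 0 else if \<exists>b. P dvd b\<^sup>2 - m then 1 else - 1)"

lemma minus_one_ne_one_alg_closure: "(- 1 :: 'a alg_closure) \<noteq> 1"
proof
  assume "(- 1 :: 'a alg_closure) = 1"
  then have "to_ac (1 + 1 :: 'a) = 0" by (metis add.left_inverse to_ac_add to_ac_1)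
  then have "(1 + 1 :: 'a) = 0" by (simp only: to_ac_eq_0_iff)
  then show False using two_ne_0 unfolding one_add_one by simp
qed

text \<open>Euler's criterion at the fixed root of \<open>P\<close>, valid for multiples of
  \<open>P\<close> as well because \<open>half\<close> is positive. The algebraic laws of
  \<open>chi\<close> are read off the right-hand side.\<close>

lemma of_int_chi: "of_int (chi m) = ev root m ^ half"
proof (cases "P dvd m")
  case True
  then have "ev root m = 0" using ev_eq_0_iff[OF irreducible_P ev_root] by simp
  moreover have "half > 0" using odd_half by (cases half) auto
  ultimately show ?thesis using True by (simp add: chi_def)
next
  case False
  show ?thesis
    using False euler_criterion_poly[OF irreducible_P ev_root False odd_card]
      residue_power_half_card[OF irreducible_P ev_root False odd_card]
    unfolding half_def chi_def by auto
qed

text \<open>\<open>of_int\<close> into the algebraic closure is not injective, but it separates -1,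
  0 and 1 because the characteristic is not 2.\<close>

lemma chi_eqI:
  assumes "of_int (chi m) = (of_int c :: 'a alg_closure)" "c = 0 \<or> c = 1 \<or> c = - 1"
  shows "chi m = c"
proof -
  have "chi m = 0 \<or> chi m = 1 \<or> chi m = - 1" by (auto simp: chi_def)
  then show ?thesis using assms minus_one_ne_one_alg_closure by auto
qed

lemma chi_cases: "chi m = 0 \<or> chi m = 1 \<or> chi m = - 1"
  by (auto simp: chi_def)

lemma chi_eq_0_iff: "chi m = 0 \<longleftrightarrow> P dvd m"
  by (auto simp: chi_def)

lemma chi_mult: "chi (m * n) = chi m * chi n"
  by (rule chi_eqI) (use chi_cases[of m] chi_cases[of n] in \<open>auto simp: of_int_chi power_mult_distrib\<close>)

lemma chi_1: "chi 1 = 1"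
  by (rule chi_eqI) (auto simp: of_int_chi)

lemma chi_power: "chi (m ^ n) = chi m ^ n"
  by (induction n) (simp_all add: chi_1 chi_mult)

lemma chi_prod: "chi (\<Prod>x\<in>A. f x) = (\<Prod>x\<in>A. chi (f x))"
  by (induction A rule: infinite_finite_induct) (simp_all add: chi_1 chi_mult)

text \<open>-1 is a non-residue: \<open>half\<close> is (q-1)/2 times a sum of deg P odd terms, and
  both factors are odd.\<close>

lemma chi_uminus: "chi (- m) = - chi m"
  by (rule chi_eqI) (use odd_half chi_cases[of m] in \<open>auto simp: of_int_chi\<close>)

lemma chi_cong:
  assumes "P dvd m - n" shows "chi m = chi n"
proof (rule chi_eqI[OF _ chi_cases])
  have "ev root (m - n) = 0" using ev_eq_0_iff[OF irreducible_P ev_root] assms by blast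
  then show "of_int (chi m) = (of_int (chi n) :: 'a alg_closure)" by (simp add: of_int_chi)
qed

text \<open>Negation permutes the residues and flips the sign of \<open>chi\<close>, so the sum
  equals its own negative.\<close>

lemma sum_chi_polys: "(\<Sum>r\<in>polys (degree P). chi r) = 0"
proof -
  have "(\<Sum>r\<in>polys (degree P). chi r) = (\<Sum>r\<in>polys (degree P). chi (- r))"
    by (rule sum.reindex_bij_witness[of _ uminus uminus]) auto
  then show ?thesis by (simp add: chi_uminus sum_negf)
qed

definition chi_sum :: "nat \<Rightarrow> int" where "chi_sum k = (\<Sum>m\<in>monics k. chi m)"

lemma P_in_monics: "P \<in> monics (degree P)"
  using monic_P by (simp add: monics_def)

text \<open>Division by \<open>P\<close> spreads the monics of such a degree evenly over all
  residues, whose characters cancel.\<close>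

lemma chi_sum_eq_0:
  assumes "k \<ge> degree P" shows "chi_sum k = 0"
proof -
  obtain j where j: "k = degree P + j" using assms le_iff_add by blast
  have c: "chi (P * w + r) = chi r" for w r by (rule chi_cong) simp
  have "chi_sum k = (\<Sum>(w, r)\<in>monics j \<times> polys (degree P). chi (P * w + r))"
    unfolding chi_sum_def j
    by (subst sum.reindex_bij_betw[OF bij_betw_monics_division[OF P_in_monics, of j], symmetric])
      (simp add: case_prod_unfold)
  also have "\<dots> = (\<Sum>w\<in>(monics j :: 'a poly set). \<Sum>r\<in>polys (degree P). chi r)"
    by (simp only: c sum.cartesian_product)
  finally show ?thesis by (simp add: sum_chi_polys)
qed

section \<open>Square roots of -P modulo a polynomial\<close>

definition rho_set :: "'a poly \<Rightarrow> 'a poly set" where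
  "rho_set a = {b \<in> polys (degree a). a dvd b\<^sup>2 + P}"

definition rho :: "'a poly \<Rightarrow> nat" where "rho a = card (rho_set a)"

lemma finite_rho_set [simp]: "finite (rho_set a)"
  by (simp add: rho_set_def)

lemma mod_rho_set_iff:
  assumes "a \<noteq> 0" shows "b mod a \<in> rho_set a \<longleftrightarrow> a dvd b\<^sup>2 + P"
proof -
  have "[(b mod a)\<^sup>2 + P = b\<^sup>2 + P] (mod a)" by (intro cong_add cong_pow) auto
  then show ?thesis using mod_in_polys[OF assms, of b] cong_dvd_iff by (auto simp: rho_set_def)
qed

lemma rho_1: "rho 1 = 1"
  by (simp add: rho_def rho_set_def)

text \<open>The Chinese remainder theorem for the solutions of b^2 = -P; the Bezout coefficients
  \<open>u\<close>, \<open>v\<close> give the simultaneous solution \<open>?w\<close>.\<close>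

lemma rho_mult:
  assumes "coprime a b" "a \<noteq> 0" "b \<noteq> 0" shows "rho (a * b) = rho a * rho b"
proof -
  obtain u v where uv: "u * a + v * b = 1" using assms coprime_bezout_poly by blast
  have ab: "a * b \<noteq> 0" using assms by simp
  have "bij_betw (\<lambda>s. (s mod a, s mod b)) (rho_set (a * b)) (rho_set a \<times> rho_set b)"
  proof (rule bij_betwI')
    fix s t assume st: "s \<in> rho_set (a * b)" "t \<in> rho_set (a * b)"
    show "((s mod a, s mod b) = (t mod a, t mod b)) = (s = t)"
    proof
      assume "(s mod a, s mod b) = (t mod a, t mod b)"
      then have "a dvd s - t" "b dvd s - t" by (auto simp: mod_eq_dvd_iff)
      then have "a * b dvd s - t" using assms coprime_mult_dvd_poly by blast
      then have "[s = t] (mod (a * b))" by (simp add: cong_iff_dvd_diff)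
      then show "s = t" using st polys_cong_eq[of s "a * b" t] by (auto simp: rho_set_def)
    qed auto
  next
    fix s assume "s \<in> rho_set (a * b)"
    then have "a dvd s\<^sup>2 + P" "b dvd s\<^sup>2 + P" by (auto simp: rho_set_def intro: dvd_mult_left dvd_mult_right)
    then show "(s mod a, s mod b) \<in> rho_set a \<times> rho_set b" using assms mod_rho_set_iff by auto
  next
    fix y assume y: "y \<in> rho_set a \<times> rho_set b"
    obtain s t where st: "y = (s, t)" by (cases y)
    let ?w = "s * (v * b) + t * (u * a)"
    have vb: "v * b = 1 - u * a" "u * a = 1 - v * b" using uv by (metis add_diff_cancel_left', metis add_diff_cancel_right')
    have "?w - s = a * (u * (t - s))" unfolding vb(1) by (simp add: algebra_simps)
    then have wa: "a dvd ?w - s" by simp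
    have "?w - t = b * (v * (s - t))" unfolding vb(2) by (simp add: algebra_simps)
    then have wb: "b dvd ?w - t" by simp
    have ma: "?w mod a = s" using wa y st mod_polys[of s a] by (auto simp: rho_set_def mod_eq_dvd_iff[symmetric])
    have mb: "?w mod b = t" using wb y st mod_polys[of t b] by (auto simp: rho_set_def mod_eq_dvd_iff[symmetric])
    have "a dvd ?w\<^sup>2 + P" "b dvd ?w\<^sup>2 + P" using mod_rho_set_iff[of a ?w] mod_rho_set_iff[of b ?w] ma mb y st assms by auto
    then have "a * b dvd ?w\<^sup>2 + P" using assms coprime_mult_dvd_poly by blast
    then have "?w mod (a * b) \<in> rho_set (a * b)" using mod_rho_set_iff[OF ab] by blast
    moreover have "(?w mod (a * b)) mod a = s" using ma by (simp add: mod_mod_cancel)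
    moreover have "(?w mod (a * b)) mod b = t" using mb by (simp add: mod_mod_cancel)
    ultimately show "\<exists>x\<in>rho_set (a * b). y = (x mod a, x mod b)" using st by metis
  qed
  from bij_betw_same_card[OF this] show ?thesis unfolding rho_def by (simp add: card_cartesian_product)
qed

lemma not_dvd_P:
  assumes Q: "irreducible Q" "Q \<noteq> P" "lead_coeff Q = 1" shows "\<not> Q dvd P"
proof
  assume d: "Q dvd P"
  have "\<not> is_unit Q" using Q irreducible_not_unit by blast
  then have "P dvd Q" using irreducibleD'[OF irreducible_P d] by blast
  then show False using d Q monic_P monic_dvd_antisym by blast
qed

text \<open>Away from \<open>P\<close> the roots of b^2 = -P are simple. This is the condition for
  lifting them to prime powers and for keeping \<open>b\<close> and \<open>- b\<close>
  apart.\<close>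

lemma not_dvd_twice_square_root:
  assumes Q: "irreducible Q" "Q \<noteq> P" "lead_coeff Q = 1" and b: "Q dvd b\<^sup>2 + P"
  shows "\<not> Q dvd smult 2 b"
proof
  assume "Q dvd smult 2 b"
  then have "Q dvd b" using two_ne_0 by (simp add: dvd_smult_iff)
  then have "Q dvd b\<^sup>2" by (simp add: power2_eq_square)
  then have "Q dvd P" using b dvd_add_right_iff by blast
  then show False using not_dvd_P[OF Q] by blast
qed

lemma hensel_square_root:
  assumes Q: "irreducible Q" "Q \<noteq> P" "lead_coeff Q = 1" and b: "Q dvd b\<^sup>2 + P"
  shows "\<exists>c. Q ^ Suc k dvd c\<^sup>2 + P"
proof (induction k)
  case 0
  then show ?case using b by auto
next
  case (Suc k)
  then obtain c e where c: "c\<^sup>2 + P = Q ^ Suc k * e" by (auto elim: dvdE)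
  have "Q dvd c\<^sup>2 + P" using c by simp
  then have "\<not> Q dvd smult 2 c" by (rule not_dvd_twice_square_root[OF Q])
  then obtain u v where uv: "u * Q + v * (smult 2 c) = 1" using Q(1) irreducible_coprime_poly coprime_bezout_poly by blast
  \<comment> \<open>Newton correction: \<open>v\<close> inverts 2c modulo \<open>Q\<close>, so this
    \<open>t\<close> makes e + 2ct divisible by \<open>Q\<close>, which raises the exponent by
    one.\<close>
  define t where "t = - (v * e)"
  have "e + smult 2 c * t = e * (u * Q)"
  proof -
    have "e + smult 2 c * t = e * (1 - v * smult 2 c)" by (simp add: t_def algebra_simps)
    also have "1 - v * smult 2 c = u * Q" using uv by (metis add_diff_cancel_right')
    finally show ?thesis .
  qed
  moreover have "(c + Q ^ Suc k * t)\<^sup>2 + P = Q ^ Suc k * (e + smult 2 c * t) + Q ^ Suc k * Q ^ Suc k * t\<^sup>2"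
  proof -
    have "smult 2 c = c + c" by (metis one_add_one smult_1_left smult_add_left)
    then have "Q ^ Suc k * (e + smult 2 c * t) + Q ^ Suc k * Q ^ Suc k * t\<^sup>2 = (c\<^sup>2 + P) + 2 * c * (Q ^ Suc k * t) + (Q ^ Suc k * t)\<^sup>2"
      unfolding c by (simp add: algebra_simps power2_eq_square)
    then show ?thesis by (simp add: power2_sum)
  qed
  ultimately have "(c + Q ^ Suc k * t)\<^sup>2 + P = Q ^ Suc (Suc k) * (e * u + Q ^ k * t\<^sup>2)"
    by (simp add: algebra_simps)
  then show ?case by (metis dvd_triv_left)
qed

text \<open>One formula for three cases. For \<open>Q = P\<close> there is one root modulo
  \<open>P\<close> and none modulo higher powers, matching 0^0 = 1. Otherwise reciprocity identifies
  \<open>chi Q\<close> with the character of -P modulo \<open>Q\<close>, and there are two roots at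
  every level or none.\<close>

lemma rho_prime_power:
  assumes Q: "irreducible Q" "lead_coeff Q = 1"
  shows "int (rho (Q ^ Suc k)) = chi Q ^ k * (1 + chi Q)"
proof (cases "Q = P")
  case True
  have chiP: "chi P = 0" by (simp add: chi_def)
  show ?thesis
  proof (cases k)
    case 0
    have "rho_set P = {0}"
    proof
      show "rho_set P \<subseteq> {0}"
      proof
        fix b assume b: "b \<in> rho_set P"
        then have "P dvd b\<^sup>2" by (simp add: rho_set_def)
        then have "P dvd b" using irreducible_P irreducible_dvd_power_poly by blast
        then show "b \<in> {0}" using b polys_dvd_eq_0 by (auto simp: rho_set_def)
      qed
    qed (simp add: rho_set_def)
    then show ?thesis using True 0 chiP by (simp add: rho_def)
  next
    case (Suc j)
    \<comment> \<open>If P^2 divided b^2 + P, then \<open>P\<close> would divide b, hence P^2 would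
      divide P.\<close>
    have "rho_set (P ^ Suc (Suc j)) = {}"
    proof (rule ccontr)
      assume "rho_set (P ^ Suc (Suc j)) \<noteq> {}"
      then obtain b where "P ^ Suc (Suc j) dvd b\<^sup>2 + P" by (auto simp: rho_set_def)
      then have b: "P * P dvd b\<^sup>2 + P" by (auto intro: dvd_mult_left simp: mult.assoc[symmetric])
      then have "P dvd b\<^sup>2" by (metis dvd_add_left_iff dvd_mult_left dvd_refl)
      then have "P dvd b" using irreducible_P irreducible_dvd_power_poly by blast
      then have "P * P dvd b\<^sup>2" unfolding power2_eq_square by (rule mult_dvd_mono[OF _ \<open>P dvd b\<close>])
      then have "P * P dvd P * 1" using b by (simp add: dvd_add_right_iff)
      then have "P dvd 1" using P_nonzero by (simp only: dvd_mult_cancel_left) simp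
      then show False using irreducible_P irreducible_not_unit by blast
    qed
    then show ?thesis using True Suc chiP by (simp add: rho_def)
  qed
next
  case QP: False
  have Q0: "Q \<noteq> 0" using Q by auto
  have "\<not> P dvd Q"
  proof
    assume d: "P dvd Q"
    have "\<not> is_unit P" using irreducible_P irreducible_not_unit by blast
    then have "Q dvd P" using irreducibleD'[OF Q(1) d] by blast
    then show False using not_dvd_P[OF Q(1) QP Q(2)] by blast
  qed
  then have chi: "chi Q = (if \<exists>b. Q dvd b\<^sup>2 + P then 1 else - 1)"
    using quadratic_reciprocity_poly[OF card_mod_4 irreducible_P monic_P odd_degree_P Q QP] by (simp add: chi_def)
  show ?thesis
  proof (cases "\<exists>b. Q dvd b\<^sup>2 + P")
    case False
    have "rho_set (Q ^ Suc k) = {}"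
    proof (rule ccontr)
      assume "rho_set (Q ^ Suc k) \<noteq> {}"
      then obtain b where "Q ^ Suc k dvd b\<^sup>2 + P" by (auto simp: rho_set_def)
      then have "Q dvd b\<^sup>2 + P" by (auto intro: dvd_mult_left)
      then show False using False by blast
    qed
    then show ?thesis using False chi by (simp add: rho_def)
  next
    case True
    let ?N = "Q ^ Suc k"
    have N0: "?N \<noteq> 0" using Q0 by simp
    obtain b where b: "?N dvd b\<^sup>2 + P" using True hensel_square_root[OF Q(1) QP Q(2)] by blast
    then have "Q dvd b\<^sup>2 + P" by (auto intro: dvd_mult_left)
    then have nd: "\<not> Q dvd smult 2 b" by (rule not_dvd_twice_square_root[OF Q(1) QP Q(2)])
    have two: "smult 2 b = b + b" by (metis one_add_one smult_1_left smult_add_left)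
    have b': "?N dvd (- b)\<^sup>2 + P" using b by simp
    have "rho_set ?N = {b mod ?N, (- b) mod ?N}"
    proof
      show "{b mod ?N, (- b) mod ?N} \<subseteq> rho_set ?N" using b b' mod_rho_set_iff[OF N0] by blast
      show "rho_set ?N \<subseteq> {b mod ?N, (- b) mod ?N}"
      proof
        fix c assume c: "c \<in> rho_set ?N"
        have cN: "c = c mod ?N" using c mod_polys[of c ?N] by (simp add: rho_set_def del: power_Suc)
        have "?N dvd (c\<^sup>2 + P) - (b\<^sup>2 + P)" using b c by (intro dvd_diff) (simp_all add: rho_set_def)
        then have d: "?N dvd (c - b) * (c + b)" by (simp add: power2_eq_square algebra_simps)
        \<comment> \<open>\<open>Q\<close> cannot divide both factors, since they differ by 2b; the
          factor prime to \<open>Q\<close> can be cancelled, and the other one absorbs the full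
          power.\<close>
        have "\<not> Q dvd c - b \<or> \<not> Q dvd c + b"
        proof (rule ccontr)
          assume "\<not> ?thesis"
          then have "Q dvd (c + b) - (c - b)" using dvd_diff by blast
          then show False using nd two by simp
        qed
        then have "?N dvd c - b \<or> ?N dvd c + b"
        proof
          assume "\<not> Q dvd c - b"
          then have "coprime ?N (c - b)"
            using irreducible_coprime_poly[OF Q(1)] coprime_power_poly coprime_commute by metis
          then show ?thesis using d coprime_dvd_mult_poly by blast
        next
          assume "\<not> Q dvd c + b"
          then have "coprime ?N (c + b)"
            using irreducible_coprime_poly[OF Q(1)] coprime_power_poly coprime_commute by metis
          then show ?thesis using d coprime_dvd_mult_poly by (metis mult.commute)
        qed
        then have "c mod ?N = b mod ?N \<or> c mod ?N = (- b) mod ?N"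
          unfolding mod_eq_dvd_iff by (simp only: diff_minus_eq_add)
        then show "c \<in> {b mod ?N, (- b) mod ?N}" using cN by (metis insertCI)
      qed
    qed
    moreover have "b mod ?N \<noteq> (- b) mod ?N"
    proof
      assume "b mod ?N = (- b) mod ?N"
      then have "?N dvd smult 2 b" unfolding mod_eq_dvd_iff two by simp
      then show False using nd by (auto dest: dvd_mult_left)
    qed
    ultimately have "rho ?N = 2" unfolding rho_def by (simp del: power_Suc)
    then show ?thesis using True chi by simp
  qed
qed

text \<open>Passing from j to j + 2 adds the term with i = 0, namely chi^(j+1) (1 + chi), which
  supplies exactly the missing powers chi^(j+1) and chi^(j+2). This is the local factor of the
  identity between ideal counts and character sums.\<close>

lemma sum_rho_prime_power:
  assumes Q: "irreducible Q" "lead_coeff Q = 1"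
  shows "(\<Sum>i | 2 * i \<le> k. int (rho (Q ^ (k - 2 * i)))) = (\<Sum>i\<le>k. chi Q ^ i)"
proof (induction k rule: less_induct)
  case (less k)
  consider "k = 0" | "k = 1" | j where "k = Suc (Suc j)" by (metis One_nat_def not0_implies_Suc)
  then show ?case
  proof cases
    case 1
    then show ?thesis by (simp add: rho_1)
  next
    case 2
    have "{i. 2 * i \<le> Suc 0} = {0}" by auto
    then show ?thesis using 2 rho_prime_power[OF Q, of 0] by simp
  next
    case (3 j)
    have "{i. 2 * i \<le> k} = insert 0 (Suc ` {i. 2 * i \<le> j})"
    proof (rule Set.set_eqI)
      fix i show "i \<in> {i. 2 * i \<le> k} \<longleftrightarrow> i \<in> insert 0 (Suc ` {i. 2 * i \<le> j})"
        using 3 by (cases i) auto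
    qed
    moreover have "finite {i. 2 * i \<le> j}" by (rule finite_subset[of _ "{..j}"]) auto
    ultimately have "(\<Sum>i | 2 * i \<le> k. int (rho (Q ^ (k - 2 * i)))) =
        int (rho (Q ^ k)) + (\<Sum>i | 2 * i \<le> j. int (rho (Q ^ (j - 2 * i))))"
      using 3 by (simp add: sum.reindex)
    also have "\<dots> = chi Q ^ Suc j * (1 + chi Q) + (\<Sum>i\<le>j. chi Q ^ i)"
      using less[of j] 3 rho_prime_power[OF Q, of "Suc j"] by simp
    finally show ?thesis using 3 by (simp add: algebra_simps)
  qed
qed

definition square_divisors :: "'a poly \<Rightarrow> 'a poly set" where
  "square_divisors n = {c. lead_coeff c = 1 \<and> c\<^sup>2 dvd n}"

definition monic_divisors :: "'a poly \<Rightarrow> 'a poly set" where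
  "monic_divisors n = {c. lead_coeff c = 1 \<and> c dvd n}"

text \<open>The coefficientwise form of "zeta of A[sqrt(-P)] is zeta of A times L(chi)": the left
  side counts the triples with c^2 a = n, the right side is the convolution of 1 with chi. The
  induction strips one full prime power \<open>Q ^ k\<close> from n, where both sides factor and the
  local identity applies.\<close>

lemma sum_rho_eq_sum_chi:
  assumes "lead_coeff n = 1"
  shows "(\<Sum>c\<in>square_divisors n. int (rho (n div c\<^sup>2))) = (\<Sum>m\<in>monic_divisors n. chi m)"
  using assms
proof (induction "degree n" arbitrary: n rule: less_induct)
  case less
  show ?case
  proof (cases "degree n = 0")
    case True
    then have "n \<in> monics 0" using less.prems unfolding monics_def by blast
    then have n: "n = 1" by simp
    have unit: "c = 1" if "lead_coeff c = 1" "c dvd 1" for c :: "'a poly"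
      using that monic_dvd_antisym[of c 1] by simp
    have "square_divisors n = {1}" "monic_divisors n = {1}"
      using unit unfolding square_divisors_def monic_divisors_def n
      by (auto simp: is_unit_power_iff)
    then show ?thesis using n by (simp add: rho_1 chi_1)
  next
    case False
    then obtain Q where Q: "irreducible Q" "lead_coeff Q = 1" "Q dvd n" using monic_irreducible_factor[of n] by auto
    have n0: "n \<noteq> 0" using less.prems by auto
    have Q0: "Q \<noteq> 0" using Q by auto
    obtain k m where km: "n = Q ^ k * m" "\<not> Q dvd m" using irreducible_power_split[OF n0 Q(1)] by blast
    have k: "k \<noteq> 0" using km Q by (cases k) auto
    have m: "lead_coeff m = 1" using less.prems unfolding km(1) by (intro monic_factor[of "Q ^ k" m] monic_power Q(2))
    then have m0: "m \<noteq> 0" by auto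
    have "degree n = k * degree Q + degree m" unfolding km(1) using Q0 m0 by (simp add: degree_mult_eq degree_power_eq)
    then have "degree m < degree n" using k irreducible_degree_pos[OF Q(1)] by simp
    then have IH: "(\<Sum>c\<in>square_divisors m. int (rho (m div c\<^sup>2))) = (\<Sum>m\<in>monic_divisors m. chi m)"
      using less.hyps m by blast
    have summand: "int (rho (n div (Q ^ i * c)\<^sup>2)) = int (rho (Q ^ (k - 2 * i))) * int (rho (m div c\<^sup>2))"
      if i: "2 * i \<le> k" and c: "c \<in> square_divisors m" for i c
    proof -
      have "c\<^sup>2 dvd m" "c\<^sup>2 \<noteq> 0" using c by (auto simp: square_divisors_def)
      then obtain e where e: "m = c\<^sup>2 * e" by auto
      have "n = (Q ^ i * c)\<^sup>2 * (Q ^ (k - 2 * i) * e)"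
      proof -
        have "Q ^ k = Q ^ (2 * i) * Q ^ (k - 2 * i)" using i by (simp add: power_add[symmetric])
        then show ?thesis unfolding km(1) e by (simp add: power_mult_distrib power_mult mult_ac power2_eq_square)
      qed
      then have q1: "n div (Q ^ i * c)\<^sup>2 = Q ^ (k - 2 * i) * e"
        using Q0 \<open>c\<^sup>2 \<noteq> 0\<close> by (simp add: nonzero_mult_div_cancel_left)
      have q2: "m div c\<^sup>2 = e" unfolding e using \<open>c\<^sup>2 \<noteq> 0\<close> by simp
      have "\<not> Q dvd e" using km(2) e by auto
      then have "coprime (Q ^ (k - 2 * i)) e"
        using irreducible_coprime_poly[OF Q(1)] coprime_power_poly coprime_commute by metis
      moreover have "e \<noteq> 0" using m0 e by auto
      ultimately show ?thesis unfolding q1 q2 using rho_mult Q0 by simp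
    qed
    have b2: "bij_betw (\<lambda>(i, c). Q ^ i * c) ({i. 2 * i \<le> k} \<times> square_divisors m) (square_divisors n)"
      unfolding square_divisors_def km(1) by (rule bij_betw_irreducible_power_mult[OF Q(1,2) km(2)]) simp
    have b1: "bij_betw (\<lambda>(i, c). Q ^ i * c) ({..k} \<times> monic_divisors m) (monic_divisors n)"
      using bij_betw_irreducible_power_mult[OF Q(1,2) km(2), of 1 k]
      unfolding monic_divisors_def km(1) by (simp add: atMost_def)
    have "(\<Sum>c\<in>square_divisors n. int (rho (n div c\<^sup>2)))
        = (\<Sum>(i, c)\<in>{i. 2 * i \<le> k} \<times> square_divisors m. int (rho (n div (Q ^ i * c)\<^sup>2)))"
      by (subst sum.reindex_bij_betw[OF b2, symmetric]) (simp add: case_prod_unfold)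
    also have "\<dots> = (\<Sum>(i, c)\<in>{i. 2 * i \<le> k} \<times> square_divisors m. int (rho (Q ^ (k - 2 * i))) * int (rho (m div c\<^sup>2)))"
      by (rule sum.cong) (auto simp: summand)
    also have "\<dots> = (\<Sum>i | 2 * i \<le> k. int (rho (Q ^ (k - 2 * i)))) * (\<Sum>c\<in>square_divisors m. int (rho (m div c\<^sup>2)))"
      by (simp add: sum_product sum.cartesian_product)
    also have "\<dots> = (\<Sum>i\<le>k. chi Q ^ i) * (\<Sum>c\<in>monic_divisors m. chi c)"
      using sum_rho_prime_power[OF Q(1,2)] IH by simp
    also have "\<dots> = (\<Sum>(i, c)\<in>{..k} \<times> monic_divisors m. chi (Q ^ i * c))"
      by (simp add: sum_product sum.cartesian_product chi_mult chi_power)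
    also have "\<dots> = (\<Sum>c\<in>monic_divisors n. chi c)"
      by (subst sum.reindex_bij_betw[OF b1, symmetric]) (simp add: case_prod_unfold)
    finally show ?thesis .
  qed
qed

text \<open>The triple \<open>(c, a, b)\<close> stands for the ideal with basis \<open>c a\<close>, \<open>c (b + \<surd>(-P))\<close>, of norm \<open>c\<^sup>2 a\<close>.\<close>

definition ideal_triples :: "nat \<Rightarrow> ('a poly \<times> 'a poly \<times> 'a poly) set" where
  "ideal_triples k = {(c, a, b). lead_coeff c = 1 \<and> lead_coeff a = 1 \<and> b \<in> rho_set a \<and>
     2 * degree c + degree a = k}"

lemma card_ideal_triples_rho:
  "finite (ideal_triples k) \<and>
   card (ideal_triples k) = (\<Sum>n\<in>monics k. \<Sum>c\<in>square_divisors n. rho (n div c\<^sup>2))"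
proof -
  let ?X = "SIGMA n : monics k. SIGMA c : square_divisors n. rho_set (n div c\<^sup>2)"
  have deg: "degree (c\<^sup>2 * a) = 2 * degree c + degree a" if "lead_coeff c = 1" "lead_coeff a = 1" for a c :: "'a poly"
  proof -
    have "c \<noteq> 0" "a \<noteq> 0" using that by auto
    then show ?thesis by (simp add: degree_mult_eq degree_power_eq)
  qed
  have bij: "bij_betw (\<lambda>(n, c, b). (c, n div c\<^sup>2, b)) ?X (ideal_triples k)"
  proof (rule bij_betw_byWitness[where f' = "\<lambda>(c, a, b). (c\<^sup>2 * a, c, b)"])
    show "\<forall>z\<in>?X. (\<lambda>(c, a, b). (c\<^sup>2 * a, c, b)) ((\<lambda>(n, c, b). (c, n div c\<^sup>2, b)) z) = z"
      by (auto simp: square_divisors_def)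
    show "\<forall>z\<in>ideal_triples k. (\<lambda>(n, c, b). (c, n div c\<^sup>2, b)) ((\<lambda>(c, a, b). (c\<^sup>2 * a, c, b)) z) = z"
      by (auto simp: ideal_triples_def)
    show "(\<lambda>(n, c, b). (c, n div c\<^sup>2, b)) ` ?X \<subseteq> ideal_triples k"
    proof (rule image_subsetI)
      fix z assume z: "z \<in> ?X"
      obtain n c b where zz: "z = (n, c, b)" by (cases z)
      have n: "degree n = k" "lead_coeff n = 1" and c: "lead_coeff c = 1" "c\<^sup>2 dvd n" and b: "b \<in> rho_set (n div c\<^sup>2)"
        using z zz by (auto simp: monics_def square_divisors_def)
      obtain a where a: "n = c\<^sup>2 * a" using c by auto
      have "c\<^sup>2 \<noteq> 0" using c by auto
      then have "n div c\<^sup>2 = a" using a by simp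
      moreover have "lead_coeff a = 1" using n(2) unfolding a by (intro monic_factor[of "c\<^sup>2" a] monic_power c(1))
      ultimately show "(case z of (n, c, b) \<Rightarrow> (c, n div c\<^sup>2, b)) \<in> ideal_triples k"
        using zz b c(1) n(1) deg[of c a] a by (simp add: ideal_triples_def)
    qed
    show "(\<lambda>(c, a, b). (c\<^sup>2 * a, c, b)) ` ideal_triples k \<subseteq> ?X"
    proof (rule image_subsetI)
      fix z assume z: "z \<in> ideal_triples k"
      obtain c a b where zz: "z = (c, a, b)" by (cases z)
      have c: "lead_coeff c = 1" and a: "lead_coeff a = 1" and b: "b \<in> rho_set a" and k: "2 * degree c + degree a = k"
        using z zz by (auto simp: ideal_triples_def)
      have "c\<^sup>2 \<noteq> 0" using c by auto
      then have "(c\<^sup>2 * a) div c\<^sup>2 = a" by simp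
      moreover have "lead_coeff (c\<^sup>2 * a) = 1" using a c by (intro monic_mult monic_power)
      ultimately show "(case z of (c, a, b) \<Rightarrow> (c\<^sup>2 * a, c, b)) \<in> ?X"
        using zz c b deg[OF c a] k by (simp add: monics_def square_divisors_def)
    qed
  qed
  have fin: "finite (square_divisors n)" if "n \<in> monics k" for n
  proof (rule finite_subset)
    show "square_divisors n \<subseteq> {m. lead_coeff m = 1 \<and> m dvd n}"
      by (auto simp: square_divisors_def power2_eq_square dest: dvd_mult_left)
    show "finite {m. lead_coeff m = 1 \<and> m dvd n}" using that finite_monic_divisors monics_ne_0 by blast
  qed
  have "finite ?X" using fin by (intro finite_SigmaI) auto
  moreover have "card ?X = (\<Sum>n\<in>monics k. \<Sum>c\<in>square_divisors n. rho (n div c\<^sup>2))"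
    using fin by (simp add: card_SigmaI rho_def)
  ultimately show ?thesis using bij_betw_finite[OF bij] bij_betw_same_card[OF bij] by simp
qed

lemma finite_ideal_triples: "finite (ideal_triples k)"
  using card_ideal_triples_rho by blast

text \<open>Summing the convolution over all n of degree k pairs each divisor m with a free monic
  cofactor of degree k - deg m, of which there are q^(k - deg m).\<close>

lemma card_ideal_triples:
  "int (card (ideal_triples k)) = (\<Sum>j\<le>k. chi_sum j * int CARD('a) ^ (k - j))"
proof -
  have "int (card (ideal_triples k)) = (\<Sum>n\<in>monics k. \<Sum>c\<in>square_divisors n. int (rho (n div c\<^sup>2)))"
    using card_ideal_triples_rho by simp
  also have "\<dots> = (\<Sum>n\<in>monics k. \<Sum>m\<in>monic_divisors n. chi m)"
    by (rule sum.cong) (auto simp: monics_def intro: sum_rho_eq_sum_chi)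
  also have "\<dots> = (\<Sum>(n, m)\<in>(SIGMA n : monics k. monic_divisors n). chi m)"
    using finite_monic_divisors monics_ne_0 unfolding monic_divisors_def by (intro sum.Sigma) auto
  also have "\<dots> = (\<Sum>(j, m, w)\<in>(SIGMA j : {..k}. monics j \<times> (monics (k - j) :: 'a poly set)). chi m)"
  proof (rule sum.reindex_bij_witness[of _ "\<lambda>(j, m, w). (m * w, m)" "\<lambda>(n, m). (degree m, m, n div m)"])
    fix z assume z: "z \<in> (SIGMA n : monics k. monic_divisors n)"
    obtain n m where zz: "z = (n, m)" by (cases z)
    have n: "degree n = k" "lead_coeff n = 1" and m: "lead_coeff m = 1" "m dvd n"
      using z zz by (auto simp: monics_def monic_divisors_def)
    obtain w where w: "n = m * w" using m by auto
    have m0: "m \<noteq> 0" "w \<noteq> 0" using m n w by auto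
    have "lead_coeff w = 1" using n(2) unfolding w by (rule monic_factor[OF _ m(1)])
    moreover have "k = degree m + degree w" using m0 n w by (simp add: degree_mult_eq)
    ultimately show "(case z of (n, m) \<Rightarrow> (degree m, m, n div m)) \<in> (SIGMA j : {..k}. monics j \<times> monics (k - j))"
      using zz m w m0 by (simp add: monics_def)
    show "(case case z of (n, m) \<Rightarrow> (degree m, m, n div m) of (j, m, w) \<Rightarrow> (m * w, m)) = z"
      using zz m by simp
    show "(case case z of (n, m) \<Rightarrow> (degree m, m, n div m) of (j, m, w) \<Rightarrow> chi m) = (case z of (n, m) \<Rightarrow> chi m)"
      using zz by simp
  next
    fix z :: "nat \<times> 'a poly \<times> 'a poly" assume z: "z \<in> (SIGMA j : {..k}. monics j \<times> monics (k - j))"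
    obtain j m w where zz: "z = (j, m, w)" by (cases z)
    have a: "j \<le> k" "m \<in> monics j" "w \<in> monics (k - j)" using z zz by auto
    then have "m * w \<in> monics k" using monics_mult[OF a(2,3)] by simp
    then show "(case z of (j, m, w) \<Rightarrow> (m * w, m)) \<in> (SIGMA n : monics k. monic_divisors n)"
      using zz a by (auto simp: monic_divisors_def monics_def)
    show "(case case z of (j, m, w) \<Rightarrow> (m * w, m) of (n, m) \<Rightarrow> (degree m, m, n div m)) = z"
      using zz a monics_ne_0[OF a(2)] by (auto simp: monics_def)
  qed
  also have "\<dots> = (\<Sum>j\<le>k. \<Sum>(m, w)\<in>monics j \<times> (monics (k - j) :: 'a poly set). chi m)"
    by (subst sum.Sigma[symmetric]) (auto simp: case_prod_unfold)
  also have "\<dots> = (\<Sum>j\<le>k. chi_sum j * int CARD('a) ^ (k - j))"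
    unfolding sum.cartesian_product[symmetric] chi_sum_def
    by (simp add: card_monics sum_distrib_right mult.commute)
  finally show ?thesis .
qed

section \<open>Ideals of the quadratic order\<close>

text \<open>The pair \<open>(x, y)\<close> of polynomials stands for \<open>x + y \<surd>(-P)\<close>.\<close>

definition qm :: "'a poly \<times> 'a poly \<Rightarrow> 'a poly \<times> 'a poly \<Rightarrow> 'a poly \<times> 'a poly" where
  "qm z w = (fst z * fst w - P * snd z * snd w, fst z * snd w + snd z * fst w)"

definition qa :: "'a poly \<times> 'a poly \<Rightarrow> 'a poly \<times> 'a poly \<Rightarrow> 'a poly \<times> 'a poly" where
  "qa z w = (fst z + fst w, snd z + snd w)"

definition qn :: "'a poly \<times> 'a poly \<Rightarrow> 'a poly" where
  "qn z = (fst z)\<^sup>2 + P * (snd z)\<^sup>2"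

definition qc :: "'a poly \<times> 'a poly \<Rightarrow> 'a poly \<times> 'a poly" where
  "qc z = (fst z, - snd z)"

lemma qm_comm: "qm z w = qm w z"
  by (simp add: qm_def algebra_simps)

lemma qm_assoc: "qm (qm z w) v = qm z (qm w v)"
  by (simp add: qm_def algebra_simps)

lemma qm_left_comm: "qm z (qm w v) = qm w (qm z v)"
  by (simp add: qm_def algebra_simps)

lemma qm_qa: "qm z (qa w v) = qa (qm z w) (qm z v)"
  by (simp add: qm_def qa_def algebra_simps)

lemma qm_scalar [simp]: "qm (n, 0) z = (n * fst z, n * snd z)"
  by (simp add: qm_def)

lemma qm_zero [simp]: "qm z (0, 0) = (0, 0)"
  by (simp add: qm_def)

lemma qm_qc: "qm z (qc z) = (qn z, 0)" "qm (qc z) z = (qn z, 0)"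
  by (simp_all add: qm_def qc_def qn_def power2_eq_square algebra_simps)

lemma qn_qm: "qn (qm z w) = qn z * qn w"
  by (simp add: qm_def qn_def power2_eq_square algebra_simps)

text \<open>The degrees of u^2 and P v^2 have different parity, so the degree of the norm is the
  larger one. Zero components are separated, since \<open>degree 0 = 0\<close> would otherwise turn
  v = 0 into the constraint deg P <= M.\<close>

lemma qn_degree:
  assumes "(u, v) \<noteq> (0, 0)"
  shows "qn (u, v) \<noteq> 0"
    and "degree (qn (u, v)) \<le> M \<longleftrightarrow> (u = 0 \<or> 2 * degree u \<le> M) \<and> (v = 0 \<or> 2 * degree v + degree P \<le> M)"
proof -
  have du: "degree (u\<^sup>2) = 2 * degree u" if "u \<noteq> 0" using that by (simp add: degree_power_eq)
  have dv: "degree (P * v\<^sup>2) = 2 * degree v + degree P" if "v \<noteq> 0"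
    using that P_nonzero by (simp add: degree_mult_eq degree_power_eq)
  consider "u = 0" "v \<noteq> 0" | "v = 0" "u \<noteq> 0" | "u \<noteq> 0" "v \<noteq> 0" using assms by auto
  then have "qn (u, v) \<noteq> 0 \<and> (degree (qn (u, v)) \<le> M \<longleftrightarrow>
    (u = 0 \<or> 2 * degree u \<le> M) \<and> (v = 0 \<or> 2 * degree v + degree P \<le> M))"
  proof cases
    case 1 then show ?thesis using P_nonzero dv by (simp add: qn_def)
  next
    case 2 then show ?thesis using du by (simp add: qn_def)
  next
    case 3
    have "degree (u\<^sup>2) \<noteq> degree (P * v\<^sup>2)" using du dv 3 odd_degree_P
      by (metis even_add even_mult_iff even_numeral)
    then consider "degree (u\<^sup>2) < degree (P * v\<^sup>2)" | "degree (P * v\<^sup>2) < degree (u\<^sup>2)" by linarith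
    then show ?thesis
    proof cases
      case 1
      then have "degree (qn (u, v)) = degree (P * v\<^sup>2)" by (simp add: qn_def degree_add_eq_right)
      then show ?thesis using 1 3 du dv by auto
    next
      case 2
      then have "degree (qn (u, v)) = degree (u\<^sup>2)" by (simp add: qn_def degree_add_eq_left)
      then show ?thesis using 2 3 du dv by auto
    qed
  qed
  then show "qn (u, v) \<noteq> 0"
    and "degree (qn (u, v)) \<le> M \<longleftrightarrow> (u = 0 \<or> 2 * degree u \<le> M) \<and> (v = 0 \<or> 2 * degree v + degree P \<le> M)"
    by blast+
qed

lemma qn_eq_0_iff: "qn z = 0 \<longleftrightarrow> z = (0, 0)"
  using qn_degree(1)[of "fst z" "snd z"] by (cases z) (auto simp: qn_def)

lemma qm_eq_0_iff: "qm z w = (0, 0) \<longleftrightarrow> z = (0, 0) \<or> w = (0, 0)"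
proof -
  have "qm z w = (0, 0) \<longleftrightarrow> qn z * qn w = 0" by (simp only: qn_eq_0_iff[symmetric] qn_qm)
  then show ?thesis by (simp only: mult_eq_0_iff qn_eq_0_iff)
qed

lemma qm_left_cancel: assumes "z \<noteq> (0, 0)" shows "qm z w = qm z v \<longleftrightarrow> w = v"
proof
  assume "qm z w = qm z v"
  then have "qm (qc z) (qm z w) = qm (qc z) (qm z v)" by simp
  then have "qm (qn z, 0) w = qm (qn z, 0) v" unfolding qm_assoc[symmetric] qm_qc .
  then show "w = v" using assms qn_eq_0_iff by (auto simp: prod_eq_iff)
qed simp

text \<open>Additive inverses are covered as multiples by \<open>(- 1, 0)\<close>. Ideals are plain
  sets of pairs here, and are matched with the ideals of the integral closure later.\<close>

definition qideal :: "('a poly \<times> 'a poly) set \<Rightarrow> bool" where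
  "qideal J \<longleftrightarrow> (0, 0) \<in> J \<and> (\<forall>z\<in>J. \<forall>w\<in>J. qa z w \<in> J) \<and> (\<forall>z\<in>J. \<forall>w. qm w z \<in> J)"

lemma qideal_image: "qideal J \<Longrightarrow> qideal (qm z ` J)"
  unfolding qideal_def
proof (intro conjI ballI allI)
  assume J: "(0, 0) \<in> J \<and> (\<forall>z\<in>J. \<forall>w\<in>J. qa z w \<in> J) \<and> (\<forall>z\<in>J. \<forall>w. qm w z \<in> J)"
  show "(0, 0) \<in> qm z ` J" using J by (intro image_eqI[where x = "(0, 0)"]) auto
  fix x assume "x \<in> qm z ` J"
  then obtain x' where x': "x = qm z x'" "x' \<in> J" by auto
  show "qm w x \<in> qm z ` J" for w
  proof (rule image_eqI)
    show "qm w x = qm z (qm w x')" unfolding x' by (rule qm_left_comm)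
    show "qm w x' \<in> J" using J x'(2) by blast
  qed
  fix y assume "y \<in> qm z ` J"
  then obtain y' where y': "y = qm z y'" "y' \<in> J" by auto
  show "qa x y \<in> qm z ` J"
    using x' y' J by (intro image_eqI[where x = "qa x' y'"]) (auto simp: qm_qa)
qed

lemma qideal_vimage: "qideal J \<Longrightarrow> qideal {w. qm z w \<in> J}"
  unfolding qideal_def
proof (intro conjI ballI allI)
  assume J: "(0, 0) \<in> J \<and> (\<forall>z\<in>J. \<forall>w\<in>J. qa z w \<in> J) \<and> (\<forall>z\<in>J. \<forall>w. qm w z \<in> J)"
  show "(0, 0) \<in> {w. qm z w \<in> J}" using J by simp
  fix x assume "x \<in> {w. qm z w \<in> J}"
  then have x: "qm z x \<in> J" by simp
  show "qm w x \<in> {w. qm z w \<in> J}" for w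
    unfolding mem_Collect_eq qm_left_comm[of z w x] using J x by blast
  fix y assume "y \<in> {w. qm z w \<in> J}"
  then show "qa x y \<in> {w. qm z w \<in> J}" unfolding mem_Collect_eq qm_qa using J x by blast
qed

text \<open>The Hermite normal form of a lattice: the content \<open>c\<close> times the primitive
  ideal generated by \<open>a\<close> and b + sqrt(-P).\<close>

definition L :: "'a poly \<Rightarrow> 'a poly \<Rightarrow> 'a poly \<Rightarrow> ('a poly \<times> 'a poly) set" where
  "L c a b = {(c * (a * x + b * y), c * y) | x y. True}"

lemma L_iff: "c \<noteq> 0 \<Longrightarrow> (u, v) \<in> L c a b \<longleftrightarrow> c dvd v \<and> c * a dvd u - b * v"
proof
  assume "(u, v) \<in> L c a b"
  then obtain x y where "u = c * (a * x + b * y)" "v = c * y" by (auto simp: L_def)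
  moreover from this have "u - b * v = (c * a) * x" by (simp add: algebra_simps)
  ultimately show "c dvd v \<and> c * a dvd u - b * v" by simp
next
  assume "c dvd v \<and> c * a dvd u - b * v"
  then obtain x y where "v = c * y" "u - b * v = (c * a) * x" by (auto elim!: dvdE)
  then have "u = c * (a * x + b * y)" by (simp add: algebra_simps)
  then show "(u, v) \<in> L c a b" using \<open>v = c * y\<close> by (auto simp: L_def)
qed

text \<open>The divisibility of b^2 + P by \<open>a\<close> gives stability under sqrt(-P): writing
  P = a e - b^2 exposes the factor \<open>c * a\<close> in the product.\<close>

lemma qideal_L:
  assumes c: "c \<noteq> 0" and b: "a dvd b\<^sup>2 + P" shows "qideal (L c a b)"
  unfolding qideal_def
proof (intro conjI ballI allI)
  show "(0, 0) \<in> L c a b" using c by (simp add: L_iff)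
next
  fix z w assume "z \<in> L c a b" "w \<in> L c a b"
  then obtain u v u' v' where z: "z = (u, v)" "w = (u', v')" "c dvd v" "c * a dvd u - b * v" "c dvd v'" "c * a dvd u' - b * v'"
    using c L_iff by (metis surj_pair)
  have "(u + u') - b * (v + v') = (u - b * v) + (u' - b * v')" by (simp add: algebra_simps)
  then have "c * a dvd (u + u') - b * (v + v')" using z dvd_add by metis
  then show "qa z w \<in> L c a b" using c z by (simp add: L_iff qa_def)
next
  fix z w :: "'a poly \<times> 'a poly" assume "z \<in> L c a b"
  then obtain x y where z: "z = (c * (a * x + b * y), c * y)" by (auto simp: L_def)
  obtain s t where w: "w = (s, t)" by (cases w)
  obtain e where e: "b\<^sup>2 + P = a * e" using b by auto
  have P: "P = a * e - b\<^sup>2" using e by (metis add_diff_cancel_left')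
  let ?u = "s * (c * (a * x + b * y)) - P * t * (c * y)" and ?v = "s * (c * y) + t * (c * (a * x + b * y))"
  have "?u - b * ?v = (c * a) * (s * x - e * t * y - b * t * x)"
    unfolding P by (simp add: algebra_simps power2_eq_square)
  moreover have "?v = c * (s * y + t * (a * x + b * y))" by (simp add: algebra_simps)
  ultimately have "c dvd ?v \<and> c * a dvd ?u - b * ?v" by (metis dvd_triv_left)
  then show "qm w z \<in> L c a b" unfolding z w qm_def fst_conv snd_conv using L_iff[OF c] by blast
qed

text \<open>Hermite reduction over A: \<open>c\<close> generates the second coordinates,
  \<open>g\<close> the elements with second coordinate 0. Stability under sqrt(-P) makes
  \<open>c\<close> divide the first coordinates too, so that it splits off the whole ideal, and then
  forces \<open>a\<close> to divide b^2 + P.\<close>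

lemma qideal_eq_L:
  assumes J: "qideal J" "J \<noteq> {(0, 0)}"
  obtains c a b where "lead_coeff c = 1" "lead_coeff a = 1" "b \<in> rho_set a" "J = L c a b"
proof -
  have J0: "(0, 0) \<in> J" and Ja: "\<And>z w. z \<in> J \<Longrightarrow> w \<in> J \<Longrightarrow> qa z w \<in> J" and Jm: "\<And>z w. z \<in> J \<Longrightarrow> qm w z \<in> J"
    using J(1) by (auto simp: qideal_def)
  have Js: "(k * u, k * v) \<in> J" if "(u, v) \<in> J" for k u v using Jm[OF that, of "(k, 0)"] by simp
  have Jd: "(- (P * v), u) \<in> J" if "(u, v) \<in> J" for u v using Jm[OF that, of "(0, 1)"] by (simp add: qm_def)
  obtain u0 v0 where uv0: "(u0, v0) \<in> J" "(u0, v0) \<noteq> (0, 0)" using J J0 by auto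
  define A where "A = {u. (u, 0) \<in> J}"
  define C where "C = snd ` J"
  \<comment> \<open>The norm of a non-zero element of \<open>J\<close> is a non-zero scalar in
    \<open>J\<close>; its product with sqrt(-P) then shows that \<open>C\<close> is non-zero
    too.\<close>
  have "qn (u0, v0) \<in> A" using Jm[OF uv0(1), of "qc (u0, v0)"] by (simp add: qm_qc A_def)
  then have A1: "\<exists>x\<in>A. x \<noteq> 0" using uv0 qn_eq_0_iff by blast
  then obtain n where n: "(n, 0) \<in> J" "n \<noteq> 0" by (auto simp: A_def)
  then have "n \<in> C" using Jd[OF n(1)] by (force simp: C_def)
  then have C1: "\<exists>x\<in>C. x \<noteq> 0" using n by blast
  have A2: "x + y \<in> A" if "x \<in> A" "y \<in> A" for x y using Ja[of "(x, 0)" "(y, 0)"] that by (simp add: A_def qa_def)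
  have A3: "k * x \<in> A" if "x \<in> A" for x k using Js[of x 0 k] that by (simp add: A_def)
  have C2: "x + y \<in> C" if "x \<in> C" "y \<in> C" for x y
  proof -
    obtain u u' where "(u, x) \<in> J" "(u', y) \<in> J" using \<open>x \<in> C\<close> \<open>y \<in> C\<close> by (auto simp: C_def)
    then have "(u + u', x + y) \<in> J" using Ja[of "(u, x)" "(u', y)"] by (simp add: qa_def)
    then show ?thesis by (force simp: C_def)
  qed
  have C3: "k * x \<in> C" if "x \<in> C" for x k
  proof -
    obtain u where "(u, x) \<in> J" using \<open>x \<in> C\<close> by (auto simp: C_def)
    then have "(k * u, k * x) \<in> J" by (rule Js)
    then show ?thesis by (force simp: C_def)
  qed
  obtain g where g: "lead_coeff g = 1" "g \<in> A" "\<And>x. x \<in> A \<longleftrightarrow> g dvd x"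
    using ideal_poly_principal[OF A2 A3 A1] by metis
  obtain c where c: "lead_coeff c = 1" "c \<in> C" "\<And>x. x \<in> C \<longleftrightarrow> c dvd x"
    using ideal_poly_principal[OF C2 C3 C1] by metis
  have c0: "c \<noteq> 0" using c by auto
  have cfst: "c dvd u" if "(u, v) \<in> J" for u v
  proof -
    have "u \<in> C" using Jd[OF that] by (force simp: C_def)
    then show ?thesis using c by blast
  qed
  have "(g, 0) \<in> J" using g by (simp add: A_def)
  then have "c dvd g" by (rule cfst)
  then obtain a where a: "g = c * a" by (rule dvdE)
  obtain s where s: "(s, c) \<in> J" using c(2) by (auto simp: C_def)
  then have "c dvd s" by (rule cfst)
  then obtain b0 where b0: "s = c * b0" by (rule dvdE)
  have la: "lead_coeff a = 1" using g(1) unfolding a by (rule monic_factor[OF _ c(1)])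
  then have a0: "a \<noteq> 0" by auto
  have diff: "(u - u', 0) \<in> J" if "(u, v) \<in> J" "(u', v) \<in> J" for u u' v
    using Ja[OF that(1) Js[OF that(2), of "- 1"]] by (simp add: qa_def)
  have JL: "J = L c a b0"
  proof
    show "J \<subseteq> L c a b0"
    proof
      fix z assume z: "z \<in> J"
      obtain u v where uv: "z = (u, v)" by (cases z)
      then have "v \<in> C" using z by (force simp: C_def)
      then have "c dvd v" using c by blast
      then obtain y where y: "v = c * y" by (rule dvdE)
      have "(y * s, v) \<in> J" using Js[OF s, of y] y by (simp add: mult.commute)
      then have "(u - y * s, 0) \<in> J" using diff z uv by blast
      then have "g dvd u - y * s" using g by (simp add: A_def)
      then have "c * a dvd u - b0 * v" unfolding a b0 y by (simp add: mult_ac)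
      then show "z \<in> L c a b0" using uv y c0 by (simp add: L_iff)
    qed
    show "L c a b0 \<subseteq> J"
    proof
      fix z assume "z \<in> L c a b0"
      then obtain x y where z: "z = (c * (a * x + b0 * y), c * y)" by (auto simp: L_def)
      have "qa (x * g, x * 0) (y * s, y * c) \<in> J" by (rule Ja[OF Js[OF \<open>(g, 0) \<in> J\<close>] Js[OF s]])
      moreover have "qa (x * g, x * 0) (y * s, y * c) = z" unfolding z a b0 qa_def by (simp add: algebra_simps)
      ultimately show "z \<in> J" by simp
    qed
  qed
  \<comment> \<open>The basis vector \<open>(s, c)\<close> times sqrt(-P) lies in the lattice again;
    after cancelling \<open>c\<close> this says that \<open>a\<close> divides b0^2 + P.\<close>
  have "(- (P * c), s) \<in> J" using Jd[OF s] .
  then have "c * a dvd - (P * c) - b0 * s" using JL c0 L_iff by blast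
  then have "c * a dvd c * (- (b0\<^sup>2 + P))" unfolding b0 by (simp add: algebra_simps power2_eq_square)
  then have ab: "a dvd b0\<^sup>2 + P" unfolding dvd_mult_cancel_left dvd_minus_iff using c0 by blast
  have "L c a b0 = L c a (b0 mod a)"
  proof (rule Set.set_eqI)
    fix z :: "'a poly \<times> 'a poly"
    obtain u v where z: "z = (u, v)" by (cases z)
    have "c * a dvd u - b0 * v \<longleftrightarrow> c * a dvd u - (b0 mod a) * v" if "c dvd v"
    proof -
      from that obtain y where y: "v = c * y" by (rule dvdE)
      have "b0 * v = (c * a) * ((b0 div a) * y) + (b0 mod a) * v"
        unfolding y by (metis (no_types, lifting) div_mult_mod_eq distrib_right mult.assoc mult.commute)
      then have "u - (b0 mod a) * v = (u - b0 * v) + (c * a) * ((b0 div a) * y)" by simp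
      then show ?thesis by (metis dvd_add_times_triv_right_iff mult.commute)
    qed
    then show "z \<in> L c a b0 \<longleftrightarrow> z \<in> L c a (b0 mod a)" unfolding z L_iff[OF c0] by blast
  qed
  then show ?thesis using that c(1) la JL ab mod_rho_set_iff[OF a0, of b0] by blast
qed

text \<open>The test vectors (b c, c) and (c a, 0) recover \<open>c\<close>, then \<open>a\<close>,
  and finally \<open>b\<close> modulo \<open>a\<close>, which is already reduced. So the triples
  count ideals without repetition.\<close>

lemma L_inj:
  assumes 1: "lead_coeff c = 1" "lead_coeff a = 1" "b \<in> rho_set a"
    and 2: "lead_coeff c' = 1" "lead_coeff a' = 1" "b' \<in> rho_set a'" and e: "L c a b = L c' a' b'"
  shows "c = c' \<and> a = a' \<and> b = b'"
proof -
  have c0: "c \<noteq> 0" "c' \<noteq> 0" using 1 2 by auto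
  have m: "(u, v) \<in> L c a b \<longleftrightarrow> (u, v) \<in> L c' a' b'" for u v using e by simp
  have i: "c dvd v \<and> c * a dvd u - b * v \<longleftrightarrow> c' dvd v \<and> c' * a' dvd u - b' * v" for u v
    using m[of u v] L_iff c0 by blast
  have "c' dvd c" using i[of c "b * c"] by simp
  moreover have "c dvd c'" using i[of c' "b' * c'"] by simp
  ultimately have cc: "c = c'" using monic_dvd_antisym 1 2 by blast
  have "c * a dvd c * a'" using i[of 0 "c' * a'"] cc by simp
  moreover have "c * a' dvd c * a" using i[of 0 "c * a"] cc by simp
  ultimately have aa: "a = a'" using c0 monic_dvd_antisym 1 2 by simp
  have "c * a dvd b * c - b' * c" using i[of c "b * c"] cc aa by simp
  then have "c * a dvd c * (b - b')" by (simp add: algebra_simps)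
  then have "a dvd b - b'" using c0 by simp
  then have "b = b'" using polys_cong_eq[of b a b'] 1 2 aa by (simp add: rho_set_def cong_iff_dvd_diff)
  then show ?thesis using cc aa by blast
qed

section \<open>Lattices, determinants and multipliers\<close>

definition qspan :: "'a poly \<times> 'a poly \<Rightarrow> 'a poly \<times> 'a poly \<Rightarrow> ('a poly \<times> 'a poly) set" where
  "qspan e f = {(x * fst e + y * fst f, x * snd e + y * snd f) | x y. True}"

definition qdet :: "'a poly \<times> 'a poly \<Rightarrow> 'a poly \<times> 'a poly \<Rightarrow> 'a poly" where
  "qdet e f = fst e * snd f - snd e * fst f"

lemma qspan_basis: "e \<in> qspan e f" "f \<in> qspan e f"
proof -
  have "e = (1 * fst e + 0 * fst f, 1 * snd e + 0 * snd f)" by simp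
  then show "e \<in> qspan e f" unfolding qspan_def by blast
  have "f = (0 * fst e + 1 * fst f, 0 * snd e + 1 * snd f)" by simp
  then show "f \<in> qspan e f" unfolding qspan_def by blast
qed

lemma qdet_dvd:
  assumes "e' \<in> qspan e f" "f' \<in> qspan e f" shows "qdet e f dvd qdet e' f'"
proof -
  obtain x y where e': "e' = (x * fst e + y * fst f, x * snd e + y * snd f)" using assms(1) by (auto simp: qspan_def)
  obtain s t where f': "f' = (s * fst e + t * fst f, s * snd e + t * snd f)" using assms(2) by (auto simp: qspan_def)
  have "qdet e' f' = qdet e f * (x * t - y * s)" unfolding e' f' qdet_def by (simp add: algebra_simps)
  then show ?thesis by simp
qed

text \<open>Two bases of one lattice have determinants dividing each other. The degree of the
  determinant thus serves as degree of the norm for ideals that are not given in normal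
  form.\<close>

lemma qspan_eq_degree:
  assumes "qspan e f = qspan e' f'" shows "degree (qdet e f) = degree (qdet e' f')"
proof -
  have d: "qdet e f dvd qdet e' f'" "qdet e' f' dvd qdet e f"
    using qdet_dvd qspan_basis assms by metis+
  show ?thesis
  proof (cases "qdet e f = 0")
    case True
    then show ?thesis using d by simp
  next
    case False
    then have "qdet e' f' \<noteq> 0" using d by auto
    then show ?thesis using d False dvd_imp_degree_le le_antisym by blast
  qed
qed

lemma L_eq_qspan: "L c a b = qspan (c * a, 0) (c * b, c)"
  unfolding L_def qspan_def by (simp add: algebra_simps)

lemma image_qspan: "qm z ` qspan e f = qspan (qm z e) (qm z f)"
proof -
  have "qm z (x * fst e + y * fst f, x * snd e + y * snd f) =
    (x * fst (qm z e) + y * fst (qm z f), x * snd (qm z e) + y * snd (qm z f))" for x y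
    by (simp add: qm_def algebra_simps)
  then show ?thesis unfolding qspan_def by (auto simp: image_def) metis+
qed

text \<open>\<open>P\<close> is square-free. Stripping a prime \<open>Q\<close> from
  \<open>n\<close>: either \<open>Q\<close> differs from \<open>P\<close> and must divide v^2, or
  P^2 divides P v^2 and one factor \<open>P\<close> is left over for v^2.\<close>

lemma square_dvd_P_times_square:
  assumes "n\<^sup>2 dvd P * v\<^sup>2" "n \<noteq> 0" shows "n dvd v"
  using assms
proof (induction "degree n" arbitrary: n v rule: less_induct)
  case less
  show ?case
  proof (cases "degree n = 0")
    case True
    then have "is_unit n" using less.prems is_unit_iff_degree by blast
    then show ?thesis by (rule unit_imp_dvd)
  next
    case False
    then obtain Q where Q: "irreducible Q" "lead_coeff Q = 1" "Q dvd n" using monic_irreducible_factor[of n] by auto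
    then obtain n' where n': "n = Q * n'" by auto
    have Q0: "Q \<noteq> 0" using Q by auto
    have "Q * Q dvd n\<^sup>2" unfolding n' power2_eq_square by (simp add: mult_dvd_mono)
    then have QQ: "Q * Q dvd P * v\<^sup>2" using less.prems dvd_trans by blast
    have "Q dvd v\<^sup>2"
    proof (cases "Q = P")
      case True
      then show ?thesis using QQ P_nonzero by simp
    next
      case False
      then have "\<not> Q dvd P" using not_dvd_P Q by blast
      moreover have "Q dvd P * v\<^sup>2" using QQ dvd_mult_left by blast
      ultimately show ?thesis using Q(1) irreducible_dvd_mult_poly by blast
    qed
    then have "Q dvd v" using Q irreducible_dvd_power_poly by blast
    then obtain v' where v': "v = Q * v'" by auto
    have "Q\<^sup>2 * n'\<^sup>2 dvd Q\<^sup>2 * (P * v'\<^sup>2)" using less.prems(1) unfolding n' v' by (simp add: power_mult_distrib mult_ac)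
    then have *: "n'\<^sup>2 dvd P * v'\<^sup>2" using Q0 by simp
    have n'0: "n' \<noteq> 0" using less.prems n' by auto
    have "degree n = degree Q + degree n'" unfolding n' using Q0 n'0 by (rule degree_mult_eq)
    then have "degree n' < degree n" using irreducible_degree_pos[OF Q(1)] by simp
    then have "n' dvd v'" using less.hyps * n'0 by blast
    then show ?thesis unfolding n' v' by (simp add: mult_dvd_mono)
  qed
qed

text \<open>Comparing traces and determinants on the lattice: the order is its own multiplier ring, because \<open>P\<close> is
  square-free.\<close>

lemma multiplier_integral:
  assumes n: "n \<noteq> 0" and a: "a \<noteq> 0" and sub: "qm w ` L 1 a b \<subseteq> qm (n, 0) ` L 1 a b"
  obtains e where "w = qm (n, 0) e"
proof -
  obtain u v where w: "w = (u, v)" by (cases w)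
  have e1: "(a, 0) \<in> L 1 a b" and e2: "(b, 1) \<in> L 1 a b" by (simp_all add: L_iff)
  have "qm w (a, 0) \<in> qm (n, 0) ` L 1 a b" "qm w (b, 1) \<in> qm (n, 0) ` L 1 a b" using sub e1 e2 by blast+
  then obtain z1 z2 where z: "z1 \<in> L 1 a b" "z2 \<in> L 1 a b" "qm w (a, 0) = qm (n, 0) z1" "qm w (b, 1) = qm (n, 0) z2"
    by blast
  obtain x1 y1 x2 y2 where zz: "z1 = (a * x1 + b * y1, y1)" "z2 = (a * x2 + b * y2, y2)"
    using z(1,2) by (auto simp: L_def)
  \<comment> \<open>In the basis \<open>(a, 0)\<close>, \<open>(b, 1)\<close> multiplication by
    \<open>w\<close> has n times the matrix with rows (x1, y1) and (x2, y2). Its trace is 2u and its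
    determinant the norm of \<open>w\<close>, whence n divides u and n^2 divides u^2 + P
    v^2.\<close>
  have *: "u * a = n * (a * x1 + b * y1)" "v * a = n * y1"
    "u * b - P * v = n * (a * x2 + b * y2)" "u + v * b = n * y2"
    using z(3,4) unfolding w zz by (simp_all add: qm_def mult.commute add.commute)
  have "a * u = a * (n * x1 + v * b)" using *(1,2) by (simp add: algebra_simps)
  then have u: "u = n * x1 + v * b" using a by simp
  have "smult 2 u = u + u" by (metis one_add_one smult_1_left smult_add_left)
  also have "\<dots> = n * (x1 + y2)" using u *(4) by (simp add: algebra_simps)
  finally have "n dvd smult 2 u" by simp
  then have nu: "n dvd u" using two_ne_0 by (simp add: dvd_smult_iff)
  have "a * (u\<^sup>2 + P * v\<^sup>2) = (u * a) * (u + v * b) - (v * a) * (u * b - P * v)"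
    by (simp add: algebra_simps power2_eq_square)
  also have "\<dots> = a * (n\<^sup>2 * (x1 * y2 - x2 * y1))" unfolding * by (simp add: algebra_simps power2_eq_square)
  finally have "u\<^sup>2 + P * v\<^sup>2 = n\<^sup>2 * (x1 * y2 - x2 * y1)" using a by simp
  moreover have "n\<^sup>2 dvd u\<^sup>2" using nu by (simp add: dvd_power_same)
  ultimately have "n\<^sup>2 dvd P * v\<^sup>2" by (metis dvd_add_right_iff dvd_triv_left)
  then have "n dvd v" using square_dvd_P_times_square n by blast
  then obtain s t where "u = n * s" "v = n * t" using nu by (auto elim!: dvdE)
  then show ?thesis using that[of "(s, t)"] w by simp
qed

section \<open>Counting the ideals in a class\<close>

definition qideals :: "('a poly \<times> 'a poly) set set" where
  "qideals = {J. qideal J \<and> J \<noteq> {(0, 0)}}"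

definition qrel :: "(('a poly \<times> 'a poly) set \<times> ('a poly \<times> 'a poly) set) set" where
  "qrel = {(I, J). I \<in> qideals \<and> J \<in> qideals \<and>
    (\<exists>z w. z \<noteq> (0, 0) \<and> w \<noteq> (0, 0) \<and> qm z ` I = qm w ` J)}"

definition ideals_of_degree :: "nat \<Rightarrow> ('a poly \<times> 'a poly) set set" where
  "ideals_of_degree k = (\<lambda>(c, a, b). L c a b) ` ideal_triples k"

lemma L_in_qideals:
  assumes "lead_coeff c = 1" "lead_coeff a = 1" "b \<in> rho_set a" shows "L c a b \<in> qideals"
proof -
  have nz: "c \<noteq> 0" "a \<noteq> 0" using assms by auto
  have "(c * a, 0) \<in> L c a b" using nz by (simp add: L_iff)
  moreover have "(c * a, 0) \<noteq> (0, 0)" using nz by simp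
  ultimately have "L c a b \<noteq> {(0, 0)}" by blast
  moreover have "qideal (L c a b)" using assms(3) nz(1) by (intro qideal_L) (simp_all add: rho_set_def)
  ultimately show ?thesis by (simp add: qideals_def)
qed

lemma ideals_of_degree_subset: "ideals_of_degree k \<subseteq> qideals"
  unfolding ideals_of_degree_def ideal_triples_def by (auto intro: L_in_qideals)

lemma finite_ideals_of_degree: "finite (ideals_of_degree k)"
  unfolding ideals_of_degree_def using finite_ideal_triples by blast

lemma card_ideals_of_degree: "card (ideals_of_degree k) = card (ideal_triples k)"
  unfolding ideals_of_degree_def
proof (rule card_image, rule inj_onI)
  fix z w assume zw: "z \<in> ideal_triples k" "w \<in> ideal_triples k"
    "(\<lambda>(c, a, b). L c a b) z = (\<lambda>(c, a, b). L c a b) w"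
  obtain c a b c' a' b' where e: "z = (c, a, b)" "w = (c', a', b')" by (cases z, cases w)
  have "c = c' \<and> a = a' \<and> b = b'"
    by (rule L_inj) (use zw e in \<open>auto simp: ideal_triples_def\<close>)
  then show "z = w" using e by simp
qed

lemma degree_qdet_L:
  assumes "c \<noteq> 0" "a \<noteq> 0" shows "degree (qdet (c * a, 0) (c * b, c)) = 2 * degree c + degree a"
  using assms by (simp add: qdet_def degree_mult_eq)

lemma qideals_eq_L:
  assumes "J \<in> qideals"
  obtains c a b where "lead_coeff c = 1" "lead_coeff a = 1" "b \<in> rho_set a" "J = L c a b"
  using assms unfolding qideals_def mem_Collect_eq by (elim conjE) (rule qideal_eq_L)

text \<open>Any basis may be used, because the degree of the determinant does not depend on it; for
  the normal form the determinant is c^2 a.\<close>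

lemma ideals_of_degree_iff:
  assumes J: "J \<in> qideals" "J = qspan e f"
  shows "J \<in> ideals_of_degree k \<longleftrightarrow> degree (qdet e f) = k"
proof -
  obtain c a b where L: "lead_coeff c = 1" "lead_coeff a = 1" "b \<in> rho_set a" "J = L c a b"
    by (rule qideals_eq_L[OF J(1)])
  then have nz: "c \<noteq> 0" "a \<noteq> 0" by auto
  have "degree (qdet e f) = degree (qdet (c * a, 0) (c * b, c))"
    using J(2) L(4) by (intro qspan_eq_degree) (simp add: L_eq_qspan)
  then have d: "degree (qdet e f) = 2 * degree c + degree a" using degree_qdet_L nz by simp
  show ?thesis
  proof
    assume "J \<in> ideals_of_degree k"
    then obtain c' a' b' where L': "lead_coeff c' = 1" "lead_coeff a' = 1" "b' \<in> rho_set a'" "J = L c' a' b'"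
      "2 * degree c' + degree a' = k" by (auto simp: ideals_of_degree_def ideal_triples_def)
    have "c = c' \<and> a = a' \<and> b = b'" by (rule L_inj) (use L L' in simp_all)
    then show "degree (qdet e f) = k" using L' d by simp
  next
    assume "degree (qdet e f) = k"
    then have "(c, a, b) \<in> ideal_triples k" using L d by (simp add: ideal_triples_def)
    then show "J \<in> ideals_of_degree k" unfolding ideals_of_degree_def L(4) by force
  qed
qed

lemma image_qm_qm: "qm z ` (qm w ` J) = qm (qm z w) ` J"
  by (simp add: image_image qm_assoc)

lemma image_qm_cancel:
  assumes "z \<noteq> (0, 0)" "qm z ` I = qm z ` J" shows "I = J"
  using assms by (simp add: inj_image_eq_iff inj_def qm_left_cancel)

lemma qrelI:
  "I \<in> qideals \<Longrightarrow> J \<in> qideals \<Longrightarrow> z \<noteq> (0, 0) \<Longrightarrow> w \<noteq> (0, 0) \<Longrightarrow> qm z ` I = qm w ` J \<Longrightarrow> (I, J) \<in> qrel"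
  unfolding qrel_def mem_Collect_eq prod.case by (intro conjI exI)

lemma qrelE:
  assumes "(I, J) \<in> qrel"
  obtains z w where "I \<in> qideals" "J \<in> qideals" "z \<noteq> (0, 0)" "w \<noteq> (0, 0)" "qm z ` I = qm w ` J"
  using assms unfolding qrel_def mem_Collect_eq prod.case by (elim conjE exE)

lemma equiv_qrel: "equiv qideals qrel"
proof (rule equivI)
  show "qrel \<subseteq> qideals \<times> qideals" by (auto simp: qrel_def)
  show "refl_on qideals qrel"
  proof (rule refl_onI)
    fix I assume "I \<in> qideals"
    then show "(I, I) \<in> qrel" by (intro qrelI[of I I "(1, 0)" "(1, 0)"]) simp_all
  qed
  show "sym qrel"
  proof (rule symI)
    fix I J assume "(I, J) \<in> qrel"
    then obtain z w where "I \<in> qideals" "J \<in> qideals" "z \<noteq> (0, 0)" "w \<noteq> (0, 0)" "qm z ` I = qm w ` J"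
      by (rule qrelE)
    then show "(J, I) \<in> qrel" by (intro qrelI[of J I w z]) simp_all
  qed
  show "trans qrel"
  proof (rule transI)
    fix I J K assume IJ: "(I, J) \<in> qrel" and JK: "(J, K) \<in> qrel"
    obtain z w where zw: "I \<in> qideals" "J \<in> qideals" "z \<noteq> (0, 0)" "w \<noteq> (0, 0)" "qm z ` I = qm w ` J"
      using IJ by (rule qrelE)
    obtain s t where st: "K \<in> qideals" "s \<noteq> (0, 0)" "t \<noteq> (0, 0)" "qm s ` J = qm t ` K"
      using JK by (rule qrelE)
    have "qm (qm s z) ` I = qm s ` (qm z ` I)" by (simp only: image_qm_qm)
    also have "\<dots> = qm (qm w s) ` J" unfolding zw(5) image_qm_qm qm_comm[of s w] ..
    also have "\<dots> = qm (qm w t) ` K" unfolding image_qm_qm[symmetric] st(4) ..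
    finally have "qm (qm s z) ` I = qm (qm w t) ` K" .
    moreover have "qm s z \<noteq> (0, 0)" "qm w t \<noteq> (0, 0)" using zw st by (simp_all add: qm_eq_0_iff)
    ultimately show "(I, K) \<in> qrel" using zw(1) st(1) by (intro qrelI)
  qed
qed

end

text \<open>The ideals equivalent to the ideal \<open>J\<close> with basis \<open>a\<close>, \<open>b + \<surd>(-P)\<close> are the ideals
  \<open>\<delta> J / a\<close> with \<open>\<delta>\<close> in the conjugate of \<open>J\<close>, and \<open>\<delta>\<close> is determined up to a constant.\<close>

locale reduced_ideal = odd_prime_poly P for P :: "'a::{finite,field} poly" +
  fixes a b :: "'a poly"
  assumes monic_a: "lead_coeff a = 1" and b_rho: "b \<in> rho_set a"
begin

definition conj_ideal :: "('a poly \<times> 'a poly) set" where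
  "conj_ideal = {(u, v). a dvd u + b * v}"

definition quotient_ideal :: "'a poly \<times> 'a poly \<Rightarrow> ('a poly \<times> 'a poly) set" where
  "quotient_ideal z = {w. qm (a, 0) w \<in> qm z ` L 1 a b}"

lemma a_nonzero: "a \<noteq> 0"
  using monic_a by auto

lemma L_in_qideals': "L 1 a b \<in> qideals"
  using L_in_qideals[of 1 a b] monic_a b_rho by simp

text \<open>The product of the ideal and its conjugate consists of multiples of \<open>a\<close>, so
  \<open>a\<close> divides every element of the image under \<open>z\<close>, and the preimage that
  defines \<open>quotient_ideal\<close> loses nothing.\<close>

lemma image_quotient_ideal:
  assumes z: "z \<in> conj_ideal" shows "qm (a, 0) ` quotient_ideal z = qm z ` L 1 a b"
proof
  show "qm (a, 0) ` quotient_ideal z \<subseteq> qm z ` L 1 a b" by (auto simp: quotient_ideal_def)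
  show "qm z ` L 1 a b \<subseteq> qm (a, 0) ` quotient_ideal z"
  proof
    fix w assume w: "w \<in> qm z ` L 1 a b"
    then obtain x y where xy: "w = qm z (a * x + b * y, y)" by (auto simp: L_def)
    obtain u v where uv: "z = (u, v)" by (cases z)
    have "a dvd u + b * v" using z uv by (simp add: conj_ideal_def)
    then obtain m where m: "u + b * v = a * m" by (rule dvdE)
    have "a dvd b\<^sup>2 + P" using b_rho by (simp add: rho_set_def)
    then obtain e where e: "b\<^sup>2 + P = a * e" by (rule dvdE)
    have "u * (a * x + b * y) - P * v * y = a * (u * x + y * (b * m - e * v))"
    proof -
      have "u * (a * x + b * y) - P * v * y = a * (u * x) + y * (b * (u + b * v) - (b\<^sup>2 + P) * v)"
        by (simp add: power2_eq_square algebra_simps)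
      also have "\<dots> = a * (u * x + y * (b * m - e * v))" unfolding m e by (simp add: algebra_simps)
      finally show ?thesis .
    qed
    moreover have "u * y + v * (a * x + b * y) = a * (y * m + v * x)"
    proof -
      have "u * y + v * (a * x + b * y) = y * (u + b * v) + a * (v * x)" by (simp add: algebra_simps)
      also have "\<dots> = a * (y * m + v * x)" unfolding m by (simp add: algebra_simps)
      finally show ?thesis .
    qed
    ultimately have "w = qm (a, 0) (u * x + y * (b * m - e * v), y * m + v * x)"
      unfolding xy uv qm_scalar unfolding qm_def by simp
    moreover from this have "(u * x + y * (b * m - e * v), y * m + v * x) \<in> quotient_ideal z"
      using w unfolding quotient_ideal_def by simp
    ultimately show "w \<in> qm (a, 0) ` quotient_ideal z" by blast
  qed
qed

lemma a0_nonzero: "(a, 0) \<noteq> (0, 0)"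
  using a_nonzero by simp

lemma quotient_ideal_in_qideals:
  assumes z: "z \<in> conj_ideal" "z \<noteq> (0, 0)" shows "quotient_ideal z \<in> qideals"
proof -
  have "qideal (quotient_ideal z)"
    unfolding quotient_ideal_def using L_in_qideals' by (intro qideal_vimage qideal_image) (simp add: qideals_def)
  moreover have "quotient_ideal z \<noteq> {(0, 0)}"
  proof
    assume "quotient_ideal z = {(0, 0)}"
    then have "qm z ` L 1 a b = {(0, 0)}" using image_quotient_ideal[OF z(1)] by simp
    moreover have "(a, 0) \<in> L 1 a b" by (simp add: L_iff)
    ultimately have "qm z (a, 0) = (0, 0)" by blast
    then show False using z a0_nonzero qm_eq_0_iff by blast
  qed
  ultimately show ?thesis by (simp add: qideals_def)
qed

lemma quotient_ideal_rel:
  assumes z: "z \<in> conj_ideal" "z \<noteq> (0, 0)" shows "(L 1 a b, quotient_ideal z) \<in> qrel"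
  by (rule qrelI[OF L_in_qideals' quotient_ideal_in_qideals[OF z] z(2) a0_nonzero])
    (rule image_quotient_ideal[OF z(1), symmetric])

text \<open>Write J for \<open>L 1 a b\<close>. From s J = t I, multiplication by the conjugate of t
  makes the factor of I a scalar: g J = n I. As \<open>a\<close> lies in J, g a = n z for some z in
  I, and cancelling n leaves a I = z J.\<close>

lemma rel_quotient_ideal:
  assumes I: "(L 1 a b, I) \<in> qrel"
  obtains z where "z \<in> conj_ideal" "z \<noteq> (0, 0)" "I = quotient_ideal z"
proof -
  obtain s t where st: "s \<noteq> (0, 0)" "t \<noteq> (0, 0)" "qm s ` L 1 a b = qm t ` I" and Iq: "I \<in> qideals"
    using I by (rule qrelE)
  let ?n = "(qn t, 0 :: 'a poly)" and ?g = "qm (qc t) s"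
  have n0: "?n \<noteq> (0, 0)" using st qn_eq_0_iff by simp
  have "qm ?g ` L 1 a b = qm (qc t) ` (qm t ` I)" unfolding st(3)[symmetric] image_qm_qm ..
  then have nI: "qm ?g ` L 1 a b = qm ?n ` I" unfolding image_qm_qm qm_qc .
  have "(a, 0) \<in> L 1 a b" by (simp add: L_iff)
  then have "qm ?g (a, 0) \<in> qm ?n ` I" using nI by blast
  then obtain z where z: "z \<in> I" "qm ?g (a, 0) = qm ?n z" by blast
  have "qc t \<noteq> (0, 0)" using st by (cases t) (auto simp: qc_def)
  then have "?g \<noteq> (0, 0)" using st qm_eq_0_iff by blast
  then have "qm ?n z \<noteq> (0, 0)" using z(2) a0_nonzero qm_eq_0_iff by metis
  then have z0: "z \<noteq> (0, 0)" using qm_eq_0_iff by blast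
  have "qm ?n ` (qm (a, 0) ` I) = qm (a, 0) ` (qm ?g ` L 1 a b)"
    unfolding nI image_qm_qm qm_comm[of ?n "(a, 0)"] ..
  also have "\<dots> = qm ?n ` (qm z ` L 1 a b)"
    unfolding image_qm_qm qm_comm[of "(a, 0)" ?g] z(2) ..
  finally have aI: "qm (a, 0) ` I = qm z ` L 1 a b" using image_qm_cancel n0 by blast
  have "(b, 1) \<in> L 1 a b" by (simp add: L_iff)
  then have "qm z (b, 1) \<in> qm (a, 0) ` I" using aI by blast
  \<comment> \<open>\<open>(b, 1)\<close> lies in the ideal as well; that \<open>a\<close> divides
    the second coordinate of its product with \<open>z\<close> is the defining condition of
    \<open>conj_ideal\<close>.\<close>
  then have "a dvd snd (qm z (b, 1))" by auto
  then have "z \<in> conj_ideal" by (cases z) (simp add: qm_def conj_ideal_def mult.commute)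
  moreover have inj: "inj (qm (a, 0))" unfolding inj_def qm_left_cancel[OF a0_nonzero] by blast
  have "I = quotient_ideal z"
    by (simp only: quotient_ideal_def aI[symmetric] inj_image_mem_iff[OF inj] Collect_mem_eq)
  ultimately show ?thesis using that z0 by blast
qed

text \<open>Determinants are compared in a I = z J, with I the quotient ideal and J =
  \<open>L 1 a b\<close> of determinant \<open>a\<close>: a^2 det I and N(z) a have the same
  degree.\<close>

lemma quotient_ideal_degree:
  assumes z: "z \<in> conj_ideal" "z \<noteq> (0, 0)"
  shows "quotient_ideal z \<in> ideals_of_degree k \<longleftrightarrow> degree (qn z) = k + degree a"
proof -
  have Q: "quotient_ideal z \<in> qideals" using quotient_ideal_in_qideals[OF z] .
  obtain c' a' b' where L: "lead_coeff c' = 1" "lead_coeff a' = 1" "b' \<in> rho_set a'" "quotient_ideal z = L c' a' b'"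
    by (rule qideals_eq_L[OF Q])
  then have nz: "c' \<noteq> 0" "a' \<noteq> 0" by auto
  let ?e = "(c' * a', 0 :: 'a poly)" and ?f = "(c' * b', c')"
  have Qs: "quotient_ideal z = qspan ?e ?f" using L by (simp add: L_eq_qspan)
  have "qm (a, 0) ` qspan ?e ?f = qm z ` qspan (a, 0) (b, 1)"
    using image_quotient_ideal[OF z(1)] Qs L_eq_qspan[of 1 a b] by simp
  then have "degree (qdet (qm (a, 0) ?e) (qm (a, 0) ?f)) = degree (qdet (qm z (a, 0)) (qm z (b, 1)))"
    unfolding image_qspan by (rule qspan_eq_degree)
  moreover have "qdet (qm (a, 0) ?e) (qm (a, 0) ?f) = a\<^sup>2 * qdet ?e ?f"
    by (simp add: qdet_def power2_eq_square)
  moreover have "qdet (qm z (a, 0)) (qm z (b, 1)) = qn z * a"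
    by (simp add: qdet_def qm_def qn_def power2_eq_square algebra_simps)
  moreover have "qdet ?e ?f \<noteq> 0" using nz by (simp add: qdet_def)
  moreover have "qn z \<noteq> 0" using z qn_eq_0_iff by blast
  ultimately have "degree (qdet ?e ?f) + 2 * degree a = degree (qn z) + degree a"
    using a_nonzero by (simp add: degree_mult_eq degree_power_eq)
  then show ?thesis using ideals_of_degree_iff[OF Q Qs, of k] by auto
qed

text \<open>If z J = w J for J = \<open>L 1 a b\<close>, then z and w are multiples of each other
  within the order, so their quotient has a norm of degree 0; as deg P > 0, it is a non-zero
  constant. In effect the only units of the order are the constants.\<close>

lemma quotient_ideal_eq_iff:
  assumes z: "z \<in> conj_ideal" "z \<noteq> (0, 0)" and w: "w \<in> conj_ideal" "w \<noteq> (0, 0)"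
  shows "quotient_ideal z = quotient_ideal w \<longleftrightarrow> (\<exists>c. c \<noteq> 0 \<and> w = qm ([:c:], 0) z)"
proof
  assume "quotient_ideal z = quotient_ideal w"
  then have e: "qm z ` L 1 a b = qm w ` L 1 a b"
    using image_quotient_ideal[OF z(1)] image_quotient_ideal[OF w(1)] by simp
  \<comment> \<open>Division by \<open>s\<close> is replaced by multiplication with its conjugate,
    which leaves the scalar \<open>qn s\<close> that \<open>multiplier_integral\<close> divides
    out.\<close>
  have ex: "\<exists>x. t = qm x s" if s: "s \<noteq> (0, 0)" and st: "qm s ` L 1 a b = qm t ` L 1 a b" for s t
  proof -
    have eqq: "qm (qm (qc s) t) ` L 1 a b = qm (qn s, 0) ` L 1 a b"
      unfolding image_qm_qm[symmetric] st[symmetric] unfolding image_qm_qm qm_qc ..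
    have nz: "qn s \<noteq> 0" using s qn_eq_0_iff by blast
    obtain x where x: "qm (qc s) t = qm (qn s, 0) x"
      by (rule multiplier_integral[OF nz a_nonzero eq_refl[OF eqq]])
    have "qm (qn s, 0) t = qm (qm s (qc s)) t" unfolding qm_qc ..
    also have "\<dots> = qm s (qm (qc s) t)" by (rule qm_assoc)
    also have "\<dots> = qm (qn s, 0) (qm s x)" unfolding x by (rule qm_left_comm)
    finally have "t = qm s x" using nz by (subst (asm) qm_left_cancel) simp_all
    then show ?thesis unfolding qm_comm[of s x] by blast
  qed
  obtain x where x: "w = qm x z" using ex[OF z(2) e] by blast
  obtain y where y: "z = qm y w" using ex[OF w(2) e[symmetric]] by blast
  have "qn w = qn x * qn y * qn w" using x y qn_qm by (metis mult.assoc)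
  then have xy: "qn x * qn y = 1" using w qn_eq_0_iff by (metis mult_cancel_right1)
  then have d: "degree (qn x) = 0" by (metis degree_1 degree_mult_eq_0 mult_eq_0_iff one_neq_zero)
  obtain u v where uv: "x = (u, v)" by (cases x)
  have "x \<noteq> (0, 0)" using x w by auto
  then have "(u = 0 \<or> 2 * degree u \<le> 0) \<and> (v = 0 \<or> 2 * degree v + degree P \<le> 0)"
    using qn_degree(2)[of u v 0] d uv by simp
  then have "v = 0" "degree u = 0" using degree_P_pos by auto
  then obtain c where "u = [:c:]" by (metis degree_eq_zeroE)
  moreover have "c \<noteq> 0" using \<open>x \<noteq> (0, 0)\<close> \<open>v = 0\<close> \<open>u = [:c:]\<close> uv by auto
  ultimately show "\<exists>c. c \<noteq> 0 \<and> w = qm ([:c:], 0) z" using x uv \<open>v = 0\<close> by blast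
next
  assume "\<exists>c. c \<noteq> 0 \<and> w = qm ([:c:], 0) z"
  then obtain c where c: "c \<noteq> 0" "w = qm ([:c:], 0) z" by blast
  have Lq: "qideal (L 1 a b)" using L_in_qideals' by (simp add: qideals_def)
  have sub: "qm ([:k:], 0) ` L 1 a b \<subseteq> L 1 a b" for k using Lq unfolding qideal_def by blast
  have "L 1 a b = qm ([:c:], 0) ` (qm ([:inverse c:], 0) ` L 1 a b)"
    unfolding image_qm_qm using c(1) by (simp add: one_pCons[symmetric])
  then have "L 1 a b \<subseteq> qm ([:c:], 0) ` L 1 a b" using sub[of "inverse c"] by blast
  then have Lc: "qm ([:c:], 0) ` L 1 a b = L 1 a b" using sub by blast
  have "qm w ` L 1 a b = qm z ` (qm ([:c:], 0) ` L 1 a b)" unfolding c(2) image_qm_qm qm_comm[of z] ..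
  then show "quotient_ideal z = quotient_ideal w" unfolding quotient_ideal_def Lc by simp
qed

definition conj_ideal_upto :: "nat \<Rightarrow> ('a poly \<times> 'a poly) set" where
  "conj_ideal_upto M = {z \<in> conj_ideal. z = (0, 0) \<or> degree (qn z) \<le> M}"

text \<open>Without cancellation in the norm, its degree bound is a bound on each coordinate:
  \<open>v\<close> has (M - deg P) div 2 + 1 free coefficients, and for each \<open>v\<close> the
  coordinate \<open>u\<close> runs through one residue class modulo \<open>a\<close> among the
  polynomials with M div 2 + 1 coefficients.\<close>

lemma card_conj_ideal_upto:
  assumes "degree P \<le> M" "degree a \<le> M div 2 + 1"
  shows "finite (conj_ideal_upto M) \<and>
    card (conj_ideal_upto M) = CARD('a) ^ (M div 2 + 1 - degree a + ((M - degree P) div 2 + 1))"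
proof -
  let ?V = "polys ((M - degree P) div 2 + 1) :: 'a poly set" and ?U = "\<lambda>v. {u \<in> polys (M div 2 + 1). a dvd u - (- (b * v))}"
  have "conj_ideal_upto M = (\<lambda>(v, u). (u, v)) ` (SIGMA v : ?V. ?U v)" (is "_ = ?R")
  proof (rule Set.set_eqI)
    fix z :: "'a poly \<times> 'a poly"
    obtain u v where z: "z = (u, v)" by (cases z)
    have "u \<in> polys (M div 2 + 1) \<and> v \<in> ?V \<longleftrightarrow> (u = 0 \<or> 2 * degree u \<le> M) \<and> (v = 0 \<or> 2 * degree v + degree P \<le> M)"
      using assms(1) unfolding polys_iff by auto
    also have "\<dots> \<longleftrightarrow> z = (0, 0) \<or> degree (qn z) \<le> M"
      using qn_degree(2)[of u v M] z by auto
    finally show "z \<in> conj_ideal_upto M \<longleftrightarrow> z \<in> ?R"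
      unfolding conj_ideal_upto_def conj_ideal_def z by force
  qed
  moreover have "inj_on (\<lambda>(v, u). (u, v)) (SIGMA v : ?V. ?U v)" by (auto simp: inj_on_def)
  moreover have "card (SIGMA v : ?V. ?U v) = CARD('a) ^ (M div 2 + 1 - degree a + ((M - degree P) div 2 + 1))"
  proof -
    have "card (SIGMA v : ?V. ?U v) = (\<Sum>v\<in>?V. card (?U v))" by (rule card_SigmaI) auto
    also have "\<dots> = (\<Sum>v\<in>?V. CARD('a) ^ (M div 2 + 1 - degree a))"
      by (intro sum.cong refl card_polys_cong a_nonzero assms(2))
    finally show ?thesis by (simp only: sum_constant card_polys power_add mult.commute of_nat_id)
  qed
  moreover have "finite (SIGMA v : ?V. ?U v)" by (intro finite_SigmaI) auto
  ultimately show ?thesis by (simp add: card_image)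
qed

text \<open>The elements of norm degree exactly k + deg a number (q-1) q^(k-g), a difference of two
  bounded counts, and each ideal arises from q - 1 of them, the constant multiples of one. The lower
  bound on \<open>k\<close> puts both counts in range.\<close>

lemma card_class_of_degree:
  assumes d: "degree P = 2 * g + 1" and k: "k > degree P + degree a"
  shows "card {I \<in> ideals_of_degree k. (L 1 a b, I) \<in> qrel} = CARD('a) ^ (k - g)"
proof -
  define M where "M = k + degree a"
  define B where "B = conj_ideal_upto M - conj_ideal_upto (M - 1)"
  have M: "degree P \<le> M - 1" "degree a \<le> (M - 1) div 2 + 1" "degree P \<le> M" "degree a \<le> M div 2 + 1" "M > 0"
    unfolding M_def using k by linarith+
  \<comment> \<open>As deg P is odd, exactly one of the two halvings rounds down, so the exponent is
    the same linear expression for both parities of \<open>m\<close>.\<close>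
  have ex: "m div 2 + 1 - degree a + ((m - degree P) div 2 + 1) = m + 1 - g - degree a"
    if "degree P \<le> m" "degree a \<le> m div 2 + 1" for m
  proof (cases "even m")
    case True
    then obtain n where n: "m = 2 * n" by (rule evenE)
    then have "g + 1 \<le> n" using that(1) d by linarith
    then obtain r where r: "n = g + 1 + r" using le_iff_add by blast
    have "m - degree P = 2 * r + 1" unfolding n r d by simp
    then have e1: "(m - degree P) div 2 = r" by simp
    have e2: "m div 2 = g + 1 + r" unfolding n r by simp
    from that(2) obtain s where s: "g + 1 + r + 1 = degree a + s" unfolding e2 using le_iff_add by blast
    have "m + 1 - g = g + 1 + r + 1 + (r + 1)" unfolding n r by simp
    then show ?thesis unfolding e1 e2 s by simp
  next
    case False
    then obtain n where n: "m = 2 * n + 1" by (rule oddE)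
    then have "g \<le> n" using that(1) d by linarith
    then obtain r where r: "n = g + r" using le_iff_add by blast
    have "m - degree P = 2 * r" unfolding n r d by simp
    then have e1: "(m - degree P) div 2 = r" by simp
    have e2: "m div 2 = g + r" unfolding n r by simp
    from that(2) obtain s where s: "g + r + 1 = degree a + s" unfolding e2 using le_iff_add by blast
    have "m + 1 - g = g + r + 1 + (r + 1)" unfolding n r by simp
    then show ?thesis unfolding e1 e2 s by simp
  qed
  have "conj_ideal_upto (M - 1) \<subseteq> conj_ideal_upto M" by (auto simp: conj_ideal_upto_def)
  then have "card B = card (conj_ideal_upto M) - card (conj_ideal_upto (M - 1))"
    unfolding B_def using card_conj_ideal_upto[OF M(1,2)] by (intro card_Diff_subset) blast+
  also have "\<dots> = CARD('a) ^ (M + 1 - g - degree a) - CARD('a) ^ (M - 1 + 1 - g - degree a)"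
    using card_conj_ideal_upto[OF M(1,2)] card_conj_ideal_upto[OF M(3,4)]
    unfolding ex[OF M(1,2)] ex[OF M(3,4)] by (elim conjE) (simp only:)
  also have "M + 1 - g - degree a = Suc (k - g)" using k d by (simp add: M_def)
  also have "M - 1 + 1 - g - degree a = k - g" using M(5) by (simp add: M_def)
  finally have cB: "card B = (CARD('a) - 1) * CARD('a) ^ (k - g)" by (simp add: algebra_simps)
  have finB: "finite B" using card_conj_ideal_upto[OF M(3,4)] by (simp add: B_def)
  have B: "z \<in> B \<longleftrightarrow> z \<in> conj_ideal \<and> z \<noteq> (0, 0) \<and> degree (qn z) = k + degree a" for z
    using M(5) unfolding B_def conj_ideal_upto_def M_def by auto
  have img: "quotient_ideal ` B = {I \<in> ideals_of_degree k. (L 1 a b, I) \<in> qrel}"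
  proof
    show "quotient_ideal ` B \<subseteq> {I \<in> ideals_of_degree k. (L 1 a b, I) \<in> qrel}"
      using B quotient_ideal_degree quotient_ideal_rel by blast
    show "{I \<in> ideals_of_degree k. (L 1 a b, I) \<in> qrel} \<subseteq> quotient_ideal ` B"
    proof
      fix I assume I: "I \<in> {I \<in> ideals_of_degree k. (L 1 a b, I) \<in> qrel}"
      then obtain z where z: "z \<in> conj_ideal" "z \<noteq> (0, 0)" "I = quotient_ideal z" using rel_quotient_ideal by blast
      then have "z \<in> B" using I B quotient_ideal_degree by blast
      then show "I \<in> quotient_ideal ` B" using z by blast
    qed
  qed
  have fib: "card {w \<in> B. quotient_ideal w = I} = CARD('a) - 1" if "I \<in> quotient_ideal ` B" for I
  proof -
    from that obtain z where z: "z \<in> B" "I = quotient_ideal z" by blast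
    have z': "z \<in> conj_ideal" "z \<noteq> (0, 0)" "degree (qn z) = k + degree a" using z B by auto
    have "{w \<in> B. quotient_ideal w = I} = (\<lambda>c. qm ([:c:], 0) z) ` (UNIV - {0})"
    proof (rule Set.set_eqI, rule iffI)
      fix w assume w: "w \<in> {w \<in> B. quotient_ideal w = I}"
      then have "w \<in> conj_ideal" "w \<noteq> (0, 0)" "quotient_ideal z = quotient_ideal w" using B z by auto
      then show "w \<in> (\<lambda>c. qm ([:c:], 0) z) ` (UNIV - {0})" using quotient_ideal_eq_iff[OF z'(1,2), of w] by blast
    next
      fix w assume "w \<in> (\<lambda>c. qm ([:c:], 0) z) ` (UNIV - {0})"
      then obtain c where c: "c \<noteq> 0" "w = qm ([:c:], 0) z" by blast
      have "w \<noteq> (0, 0)" using c z' qm_eq_0_iff by (metis Pair_inject pCons_eq_0_iff)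
      moreover have "w \<in> conj_ideal"
      proof -
        obtain u v where "z = (u, v)" by (cases z)
        then have "smult c u + b * smult c v = smult c (u + b * v)" "a dvd u + b * v"
          using z'(1) by (auto simp: conj_ideal_def smult_add_right)
        then show ?thesis using c \<open>z = (u, v)\<close> by (simp add: conj_ideal_def dvd_smult)
      qed
      moreover have "qn w = smult (c * c) (qn z)"
        unfolding c(2) by (simp add: qn_def power2_eq_square smult_add_right)
      then have "degree (qn w) = k + degree a" using c z' by simp
      ultimately show "w \<in> {w \<in> B. quotient_ideal w = I}"
        using B z quotient_ideal_eq_iff[OF z'(1,2), of w] c by auto
    qed
    moreover have "inj_on (\<lambda>c. qm ([:c:], 0) z) (UNIV - {0})"
    proof (rule inj_onI)
      fix c c' :: 'a assume "qm ([:c:], 0) z = qm ([:c':], 0) z"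
      then have "[:c:] * fst z = [:c':] * fst z" "[:c:] * snd z = [:c':] * snd z" by (simp_all only: qm_scalar prod.inject)
      moreover have "fst z \<noteq> 0 \<or> snd z \<noteq> 0" using z'(2) by (auto simp: prod_eq_iff)
      ultimately have "[:c:] = [:c':]" using mult_right_cancel by blast
      then show "c = c'" by simp
    qed
    ultimately show ?thesis by (simp add: card_image card_Diff_singleton)
  qed
  have "card B = (\<Sum>I\<in>quotient_ideal ` B. card {w \<in> B. quotient_ideal w = I})"
    using sum.image_gen[OF finB, of "\<lambda>_. 1::nat" quotient_ideal] by simp
  also have "\<dots> = (CARD('a) - 1) * card (quotient_ideal ` B)" using fib by simp
  finally show ?thesis using cB img finite_field_card_gt_1[where 'a = 'a] by simp
qed

end

section \<open>The class number\<close>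

context odd_prime_poly
begin

definition R :: "('a poly fract \<times> 'a poly fract) ring" where
  "R = quad_ext (to_fract (- P))"

definition O_ring :: "('a poly fract \<times> 'a poly fract) ring" where
  "O_ring = integral_closure R (range (\<lambda>p. (to_fract p, 0)))"

definition emb :: "'a poly \<times> 'a poly \<Rightarrow> 'a poly fract \<times> 'a poly fract" where
  "emb z = (to_fract (fst z), to_fract (snd z))"

lemma cring_R: "cring R"
  unfolding R_def by (rule cring_quad_ext)

lemma R_simps [simp]:
  "carrier R = UNIV" "\<zero>\<^bsub>R\<^esub> = (0, 0)" "\<one>\<^bsub>R\<^esub> = (1, 0)"
  "x \<oplus>\<^bsub>R\<^esub> y = (fst x + fst y, snd x + snd y)"
  "x \<otimes>\<^bsub>R\<^esub> y = (fst x * fst y - to_fract P * snd x * snd y, fst x * snd y + snd x * fst y)"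
  by (simp_all add: R_def quad_ext_def split: prod.splits)

lemma emb_qm: "emb (qm z w) = emb z \<otimes>\<^bsub>R\<^esub> emb w"
  by (simp add: emb_def qm_def)

lemma emb_qa: "emb (qa z w) = emb z \<oplus>\<^bsub>R\<^esub> emb w"
  by (simp add: emb_def qa_def)

lemma emb_zero: "emb (0, 0) = \<zero>\<^bsub>R\<^esub>" and emb_one: "emb (1, 0) = \<one>\<^bsub>R\<^esub>"
  by (simp_all add: emb_def)

lemma inj_emb: "inj emb"
  by (auto simp: inj_def emb_def prod_eq_iff)

lemma emb_eq_iff: "emb z = emb w \<longleftrightarrow> z = w"
  using inj_emb by (rule inj_eq)

lemma emb_scalar: "emb (n, 0) \<otimes>\<^bsub>R\<^esub> x = (to_fract n * fst x, to_fract n * snd x)"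
  by (simp add: emb_def)

lemma emb_scalar_cancel:
  assumes "n \<noteq> 0" "emb (n, 0) \<otimes>\<^bsub>R\<^esub> x = emb (n, 0) \<otimes>\<^bsub>R\<^esub> y" shows "x = y"
  using assms unfolding emb_scalar by (simp add: prod_eq_iff)

lemma fract_denominator: "\<exists>n m. n \<noteq> 0 \<and> to_fract n * x = to_fract m"
  for x :: "'b::idom fract"
proof (cases x)
  case (Fract m n)
  then have "to_fract n * x = to_fract m" by (simp add: to_fract_def eq_fract)
  then show ?thesis using Fract(2) by blast
qed

lemma common_denominator: "\<exists>n w. n \<noteq> 0 \<and> emb (n, 0) \<otimes>\<^bsub>R\<^esub> x = emb w"
proof -
  obtain n m where n: "n \<noteq> 0" "to_fract n * fst x = to_fract m" using fract_denominator by blast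
  obtain n' m' where n': "n' \<noteq> 0" "to_fract n' * snd x = to_fract m'" using fract_denominator by blast
  have "to_fract (n * n') * fst x = to_fract (n' * m)" "to_fract (n * n') * snd x = to_fract (n * m')"
    using n n' by (simp_all add: mult_ac flip: n(2) n'(2))
  then have "emb (n * n', 0) \<otimes>\<^bsub>R\<^esub> x = emb (n' * m, n * m')" unfolding emb_scalar by (simp add: emb_def)
  moreover have "n * n' \<noteq> 0" using n n' by simp
  ultimately show ?thesis by blast
qed

section \<open>The integral closure of A is A[sqrt(-P)]\<close>

lemma integral_emb: "integral_over R (range (\<lambda>p. (to_fract p, 0))) (emb z)"
proof -
  interpret R: cring R by (rule cring_R)
  \<comment> \<open>The coefficients of T^2 - 2u T + N(z), whose roots are z = u + v sqrt(-P) and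
    its conjugate.\<close>
  define c where "c i = (if i = 0 then (to_fract (qn z), 0) else (to_fract (- (2 * fst z)), 0 :: 'a poly fract))" for i :: nat
  have two: "{..<2::nat} = {0, 1}" by auto
  have to_fract_2: "to_fract (2 :: 'a poly) = 2" by (metis one_add_one to_fract_1 to_fract_add)
  have sq: "emb z [^]\<^bsub>R\<^esub> (2::nat) = emb z \<otimes>\<^bsub>R\<^esub> emb z"
    by (simp only: numeral_2_eq_2 R.nat_pow_Suc R.nat_pow_0 R.l_one R_simps(1) UNIV_I)
  have s: "(\<Oplus>\<^bsub>R\<^esub>i\<in>{..<2::nat}. c i \<otimes>\<^bsub>R\<^esub> emb z [^]\<^bsub>R\<^esub> i) = c 0 \<oplus>\<^bsub>R\<^esub> c 1 \<otimes>\<^bsub>R\<^esub> emb z"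
    unfolding two by (simp del: R_simps add: R_simps(1) R.finsum_insert)
  have "emb z [^]\<^bsub>R\<^esub> (2::nat) \<oplus>\<^bsub>R\<^esub> (\<Oplus>\<^bsub>R\<^esub>i\<in>{..<2::nat}. c i \<otimes>\<^bsub>R\<^esub> emb z [^]\<^bsub>R\<^esub> i) = \<zero>\<^bsub>R\<^esub>"
    unfolding s sq by (simp add: to_fract_2 c_def emb_def qn_def power2_eq_square algebra_simps)
  moreover have "c i \<in> range (\<lambda>p. (to_fract p, 0))" for i
    unfolding c_def by (cases "i = 0") (simp_all del: to_fract_mult to_fract_uminus)
  then have "\<forall>i<2. c i \<in> range (\<lambda>p. (to_fract p, 0))" by blast
  ultimately show ?thesis unfolding integral_over_def by blast
qed

definition clears :: "'a poly \<Rightarrow> 'a poly fract \<times> 'a poly fract \<Rightarrow> bool" where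
  "clears m y \<longleftrightarrow> emb (m, 0) \<otimes>\<^bsub>R\<^esub> y \<in> range emb"

lemma clears_iff: "clears m y \<longleftrightarrow> (\<exists>s. emb (m, 0) \<otimes>\<^bsub>R\<^esub> y = emb s)"
  unfolding clears_def by blast

lemma clears_add:
  assumes "clears m u" "clears m v" shows "clears m (u \<oplus>\<^bsub>R\<^esub> v)"
proof -
  interpret R: cring R by (rule cring_R)
  obtain s t where "emb (m, 0) \<otimes>\<^bsub>R\<^esub> u = emb s" "emb (m, 0) \<otimes>\<^bsub>R\<^esub> v = emb t"
    using assms unfolding clears_iff by blast
  then have "emb (m, 0) \<otimes>\<^bsub>R\<^esub> (u \<oplus>\<^bsub>R\<^esub> v) = emb (qa s t)"
    unfolding emb_qa by (simp del: R_simps add: R_simps(1) R.r_distr)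
  then show ?thesis unfolding clears_iff by blast
qed

lemma clears_scale:
  assumes "u \<in> range (\<lambda>p. (to_fract p, 0))" "clears m v" shows "clears m (u \<otimes>\<^bsub>R\<^esub> v)"
proof -
  interpret R: cring R by (rule cring_R)
  obtain p where p: "u = emb (p, 0)" using assms(1) by (auto simp: emb_def)
  obtain s where s: "emb (m, 0) \<otimes>\<^bsub>R\<^esub> v = emb s" using assms(2) unfolding clears_iff by blast
  have "emb (m, 0) \<otimes>\<^bsub>R\<^esub> (u \<otimes>\<^bsub>R\<^esub> v) = emb (p, 0) \<otimes>\<^bsub>R\<^esub> (emb (m, 0) \<otimes>\<^bsub>R\<^esub> v)"
    unfolding p by (simp del: R_simps add: R_simps(1) R.m_lcomm)
  also have "\<dots> = emb (qm (p, 0) s)" unfolding s emb_qm ..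
  finally show ?thesis unfolding clears_iff by blast
qed

lemma clears_sum:
  fixes A :: "nat set"
  assumes "finite A" "\<And>i. i \<in> A \<Longrightarrow> clears m (f i)" shows "clears m (finsum R f A)"
proof -
  interpret R: cring R by (rule cring_R)
  show ?thesis using assms
  proof (induction A rule: finite_induct)
    case empty
    have "emb (m, 0) \<otimes>\<^bsub>R\<^esub> \<zero>\<^bsub>R\<^esub> = emb (0, 0)" by (simp add: emb_def)
    then have "clears m \<zero>\<^bsub>R\<^esub>" unfolding clears_iff by (rule exI)
    moreover have "finsum R f {} = \<zero>\<^bsub>R\<^esub>" by simp
    ultimately show ?case by (rule ssubst[rotated])
  next
    case (insert i A)
    have "finsum R f (insert i A) = f i \<oplus>\<^bsub>R\<^esub> finsum R f A"
      using insert.hyps by (rule R.finsum_insert) (simp_all only: R_simps(1) UNIV_I Pi_UNIV)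
    moreover have "clears m (f i \<oplus>\<^bsub>R\<^esub> finsum R f A)"
      using insert.prems insert.IH by (intro clears_add) blast+
    ultimately show ?case by (rule ssubst)
  qed
qed

lemma clears_neg:
  assumes "u \<oplus>\<^bsub>R\<^esub> v = \<zero>\<^bsub>R\<^esub>" "clears m v" shows "clears m u"
proof -
  have "u = (- fst v, - snd v)" using assms(1) by (cases u) (simp add: add_eq_0_iff2)
  then have u: "u = emb (- 1, 0) \<otimes>\<^bsub>R\<^esub> v" by (simp add: emb_def)
  have "emb (- 1, 0) \<in> range (\<lambda>p. (to_fract p, 0))" unfolding emb_def by (intro image_eqI[where x = "- 1"]) auto
  then show ?thesis unfolding u using assms(2) by (rule clears_scale)
qed

text \<open>If \<open>e\<close> is a denominator of \<open>x\<close>, then e^n clears all powers up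
  to x^n, and the integral equation expresses every higher power through lower ones with
  coefficients in A. So one denominator serves all powers.\<close>

lemma almost_integral:
  assumes "integral_over R (range (\<lambda>p. (to_fract p, 0))) x"
  obtains m where "m \<noteq> 0" "\<And>k::nat. emb (m, 0) \<otimes>\<^bsub>R\<^esub> x [^]\<^bsub>R\<^esub> k \<in> range emb"
proof -
  interpret R: cring R by (rule cring_R)
  obtain n c where c: "\<forall>i<n. c i \<in> range (\<lambda>p. (to_fract p, 0))"
    and eq: "x [^]\<^bsub>R\<^esub> (n::nat) \<oplus>\<^bsub>R\<^esub> (\<Oplus>\<^bsub>R\<^esub>i\<in>{..<n}. c i \<otimes>\<^bsub>R\<^esub> x [^]\<^bsub>R\<^esub> i) = \<zero>\<^bsub>R\<^esub>"
    using assms unfolding integral_over_def by blast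
  obtain e w where e: "e \<noteq> 0" "emb (e, 0) \<otimes>\<^bsub>R\<^esub> x = emb w" using common_denominator by blast
  have mem: "u \<otimes>\<^bsub>R\<^esub> v \<in> range emb" if "u \<in> range emb" "v \<in> range emb" for u v
    using that by (elim rangeE) (simp only: emb_qm[symmetric] rangeI)
  have emb_power: "emb (e ^ (k + j), 0) = emb (e ^ k, 0) \<otimes>\<^bsub>R\<^esub> emb (e ^ j, 0)" for k j
    by (simp add: emb_def power_add)
  have 1: "emb (e ^ k, 0) \<otimes>\<^bsub>R\<^esub> x [^]\<^bsub>R\<^esub> k \<in> range emb" for k
  proof (induction k)
    case 0
    have "emb (e ^ 0, 0) \<otimes>\<^bsub>R\<^esub> x [^]\<^bsub>R\<^esub> (0::nat) = emb (1, 0)" by (simp add: emb_def)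
    then show ?case by simp
  next
    case (Suc k)
    have "emb (e ^ Suc k, 0) \<otimes>\<^bsub>R\<^esub> x [^]\<^bsub>R\<^esub> Suc k = (emb (e ^ k, 0) \<otimes>\<^bsub>R\<^esub> x [^]\<^bsub>R\<^esub> k) \<otimes>\<^bsub>R\<^esub> (emb (e, 0) \<otimes>\<^bsub>R\<^esub> x)"
      using emb_power[of k 1] by (simp del: R_simps add: R_simps(1) R.m_ac)
    then show ?case using Suc mem e(2) by (metis rangeI)
  qed
  have small: "clears (e ^ n) (x [^]\<^bsub>R\<^esub> k)" if "k \<le> n" for k :: nat
  proof -
    have "emb (e ^ n, 0) \<otimes>\<^bsub>R\<^esub> x [^]\<^bsub>R\<^esub> k = emb (e ^ (n - k), 0) \<otimes>\<^bsub>R\<^esub> (emb (e ^ k, 0) \<otimes>\<^bsub>R\<^esub> x [^]\<^bsub>R\<^esub> k)"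
      using emb_power[of "n - k" k] that by (simp del: R_simps add: R_simps(1) R.m_assoc)
    then show ?thesis unfolding clears_def using mem[OF rangeI 1[of k]] by simp
  qed
  have "clears (e ^ n) (x [^]\<^bsub>R\<^esub> k)" for k :: nat
  proof (induction k rule: less_induct)
    case (less k)
    show ?case
    proof (cases "k \<le> n")
      case False
      then obtain l where l: "k = n + l" "l > 0" using less_imp_add_positive by (metis linorder_not_le)
      let ?S = "\<Oplus>\<^bsub>R\<^esub>i\<in>{..<n}. c i \<otimes>\<^bsub>R\<^esub> x [^]\<^bsub>R\<^esub> i"
      \<comment> \<open>The equation times x^l writes x^(n+l) through the powers x^(i+l) with i < n,
        to which the induction applies.\<close>
      have "(x [^]\<^bsub>R\<^esub> n \<oplus>\<^bsub>R\<^esub> ?S) \<otimes>\<^bsub>R\<^esub> x [^]\<^bsub>R\<^esub> l = \<zero>\<^bsub>R\<^esub>" unfolding eq by (simp del: R_simps add: R_simps(1))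
      then have sum0: "x [^]\<^bsub>R\<^esub> k \<oplus>\<^bsub>R\<^esub> ?S \<otimes>\<^bsub>R\<^esub> x [^]\<^bsub>R\<^esub> l = \<zero>\<^bsub>R\<^esub>"
        unfolding l(1) by (simp del: R_simps add: R_simps(1) R.l_distr R.nat_pow_mult)
      have ldistr: "?S \<otimes>\<^bsub>R\<^esub> x [^]\<^bsub>R\<^esub> l = (\<Oplus>\<^bsub>R\<^esub>i\<in>{..<n}. (c i \<otimes>\<^bsub>R\<^esub> x [^]\<^bsub>R\<^esub> i) \<otimes>\<^bsub>R\<^esub> x [^]\<^bsub>R\<^esub> l)"
        by (rule R.finsum_ldistr) (simp_all del: R_simps(2-) add: R_simps(1))
      have "clears (e ^ n) (\<Oplus>\<^bsub>R\<^esub>i\<in>{..<n}. (c i \<otimes>\<^bsub>R\<^esub> x [^]\<^bsub>R\<^esub> i) \<otimes>\<^bsub>R\<^esub> x [^]\<^bsub>R\<^esub> l)"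
      proof (rule clears_sum)
        show "finite {..<n}" by simp
        fix i assume "i \<in> {..<n}"
        then have i: "i < n" by simp
        have "(c i \<otimes>\<^bsub>R\<^esub> x [^]\<^bsub>R\<^esub> i) \<otimes>\<^bsub>R\<^esub> x [^]\<^bsub>R\<^esub> l = c i \<otimes>\<^bsub>R\<^esub> x [^]\<^bsub>R\<^esub> (i + l)"
          by (simp del: R_simps add: R_simps(1) R.m_assoc R.nat_pow_mult)
        moreover have "clears (e ^ n) (c i \<otimes>\<^bsub>R\<^esub> x [^]\<^bsub>R\<^esub> (i + l))"
          by (rule clears_scale) (use less i l c in simp_all)
        ultimately show "clears (e ^ n) ((c i \<otimes>\<^bsub>R\<^esub> x [^]\<^bsub>R\<^esub> i) \<otimes>\<^bsub>R\<^esub> x [^]\<^bsub>R\<^esub> l)" by (rule ssubst)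
      qed
      then have "clears (e ^ n) (?S \<otimes>\<^bsub>R\<^esub> x [^]\<^bsub>R\<^esub> l)" unfolding ldistr .
      then show ?thesis by (rule clears_neg[OF sum0])
    qed (rule small)
  qed
  then have m: "emb (e ^ n, 0) \<otimes>\<^bsub>R\<^esub> x [^]\<^bsub>R\<^esub> k \<in> range emb" for k :: nat unfolding clears_def .
  have "e ^ n \<noteq> 0" using e by simp
  then show ?thesis using m by (rule that)
qed

text \<open>The elements z for which every z x^k lies in the order form an ideal \<open>M\<close>
  that \<open>x\<close> maps into itself; it is non-zero by \<open>almost_integral\<close>. With
  \<open>M\<close> in normal form and x = w / e, the multiplier lemma gives w = e y, so x = y lies
  in the order.\<close>

lemma integral_in_range_emb:
  assumes "integral_over R (range (\<lambda>p. (to_fract p, 0))) x" shows "x \<in> range emb"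
proof -
  interpret R: cring R by (rule cring_R)
  obtain m where m: "m \<noteq> 0" "\<And>k::nat. emb (m, 0) \<otimes>\<^bsub>R\<^esub> x [^]\<^bsub>R\<^esub> k \<in> range emb"
    using almost_integral[OF assms] by blast
  define M where "M = {z. \<forall>k::nat. emb z \<otimes>\<^bsub>R\<^esub> x [^]\<^bsub>R\<^esub> k \<in> range emb}"
  have mM: "(m, 0) \<in> M" using m unfolding M_def by blast
  have "qideal M" unfolding qideal_def
  proof (intro conjI ballI allI)
    have "emb (0, 0) \<otimes>\<^bsub>R\<^esub> y = emb (0, 0)" for y by (simp add: emb_def)
    then show "(0, 0) \<in> M" unfolding M_def mem_Collect_eq by (simp only: rangeI simp_thms)
    fix z assume z: "z \<in> M"
    show "qm w z \<in> M" for w unfolding M_def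
    proof (intro CollectI allI)
      fix k :: nat
      have "emb z \<otimes>\<^bsub>R\<^esub> x [^]\<^bsub>R\<^esub> k \<in> range emb" using z unfolding M_def mem_Collect_eq by (rule spec)
      then obtain s where "emb z \<otimes>\<^bsub>R\<^esub> x [^]\<^bsub>R\<^esub> k = emb s" by (rule rangeE)
      then have "emb (qm w z) \<otimes>\<^bsub>R\<^esub> x [^]\<^bsub>R\<^esub> k = emb (qm w s)"
        unfolding emb_qm by (simp del: R_simps add: R_simps(1) R.m_assoc)
      then show "emb (qm w z) \<otimes>\<^bsub>R\<^esub> x [^]\<^bsub>R\<^esub> k \<in> range emb" by simp
    qed
    fix w assume w: "w \<in> M"
    show "qa z w \<in> M" unfolding M_def
    proof (intro CollectI allI)
      fix k :: nat
      have "emb z \<otimes>\<^bsub>R\<^esub> x [^]\<^bsub>R\<^esub> k \<in> range emb" using z unfolding M_def mem_Collect_eq by (rule spec)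
      then obtain s where s: "emb z \<otimes>\<^bsub>R\<^esub> x [^]\<^bsub>R\<^esub> k = emb s" by (rule rangeE)
      have "emb w \<otimes>\<^bsub>R\<^esub> x [^]\<^bsub>R\<^esub> k \<in> range emb" using w unfolding M_def mem_Collect_eq by (rule spec)
      then obtain t where t: "emb w \<otimes>\<^bsub>R\<^esub> x [^]\<^bsub>R\<^esub> k = emb t" by (rule rangeE)
      from s t have "emb (qa z w) \<otimes>\<^bsub>R\<^esub> x [^]\<^bsub>R\<^esub> k = emb (qa s t)"
        unfolding emb_qa by (simp del: R_simps add: R_simps(1) R.l_distr)
      then show "emb (qa z w) \<otimes>\<^bsub>R\<^esub> x [^]\<^bsub>R\<^esub> k \<in> range emb" by simp
    qed
  qed
  moreover have "M \<noteq> {(0, 0)}" using mM m by auto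
  ultimately have "M \<in> qideals" by (simp add: qideals_def)
  then obtain c a b where L: "lead_coeff c = 1" "lead_coeff a = 1" "b \<in> rho_set a" "M = L c a b"
    by (rule qideals_eq_L)
  have c0: "(c, 0) \<noteq> (0, 0)" and a0: "a \<noteq> 0" using L by auto
  have Lc: "L c a b = qm (c, 0) ` L 1 a b"
    unfolding L_eq_qspan image_qspan by simp
  obtain e w where e: "e \<noteq> 0" "emb (e, 0) \<otimes>\<^bsub>R\<^esub> x = emb w" using common_denominator by blast
  have "qm w ` L 1 a b \<subseteq> qm (e, 0) ` L 1 a b"
  proof (rule image_subsetI)
    fix j assume j: "j \<in> L 1 a b"
    then have zM: "qm (c, 0) j \<in> M" using Lc L by blast
    define z where "z = qm (c, 0) j"
    have zM': "emb z \<otimes>\<^bsub>R\<^esub> x [^]\<^bsub>R\<^esub> k \<in> range emb" for k :: nat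
      using zM unfolding M_def z_def[symmetric] mem_Collect_eq by (rule spec)
    have "x [^]\<^bsub>R\<^esub> Suc 0 = x" by (simp del: R_simps add: R_simps(1))
    then have "emb z \<otimes>\<^bsub>R\<^esub> x \<in> range emb" using zM'[of "Suc 0"] by (simp only:)
    then obtain z' where z': "emb z \<otimes>\<^bsub>R\<^esub> x = emb z'" by (rule rangeE)
    have "z' \<in> M" unfolding M_def
    proof (intro CollectI allI)
      fix k :: nat
      have "emb z' \<otimes>\<^bsub>R\<^esub> x [^]\<^bsub>R\<^esub> k = emb z \<otimes>\<^bsub>R\<^esub> x [^]\<^bsub>R\<^esub> Suc k"
        unfolding z'[symmetric] by (simp del: R_simps add: R_simps(1) R.m_ac)
      then show "emb z' \<otimes>\<^bsub>R\<^esub> x [^]\<^bsub>R\<^esub> k \<in> range emb" using zM'[of "Suc k"] by (simp only:)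
    qed
    then obtain j' where j': "j' \<in> L 1 a b" "z' = qm (c, 0) j'" using L Lc by blast
    have "emb (qm (c, 0) (qm w j)) = emb w \<otimes>\<^bsub>R\<^esub> emb z"
      unfolding z_def emb_qm by (simp del: R_simps add: R_simps(1) R.m_ac)
    also have "\<dots> = emb (e, 0) \<otimes>\<^bsub>R\<^esub> emb z'"
      unfolding e(2)[symmetric] z'[symmetric] by (simp del: R_simps add: R_simps(1) R.m_ac)
    also have "\<dots> = emb (qm (c, 0) (qm (e, 0) j'))"
      unfolding j'(2) emb_qm by (simp del: R_simps add: R_simps(1) R.m_ac)
    finally have "qm w j = qm (e, 0) j'" unfolding emb_eq_iff qm_left_cancel[OF c0] .
    then show "qm w j \<in> qm (e, 0) ` L 1 a b" using j' by blast
  qed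
  then obtain y where "w = qm (e, 0) y" by (rule multiplier_integral[OF e(1) a0])
  then have "emb (e, 0) \<otimes>\<^bsub>R\<^esub> x = emb (e, 0) \<otimes>\<^bsub>R\<^esub> emb y" unfolding e(2) emb_qm[symmetric] by simp
  then have "x = emb y" by (rule emb_scalar_cancel[OF e(1)])
  then show ?thesis by blast
qed

lemma O_ring_eq: "O_ring = R\<lparr>carrier := range emb\<rparr>"
proof -
  have "{x \<in> carrier R. integral_over R (range (\<lambda>p. (to_fract p, 0))) x} = range emb"
    using integral_emb integral_in_range_emb by auto
  then show ?thesis unfolding O_ring_def integral_closure_def by simp
qed

lemma ring_O_ring: "ring O_ring"
proof -
  interpret R: cring R by (rule cring_R)
  have "subring (range emb) R"
  proof (rule R.subringI)
    show "\<one>\<^bsub>R\<^esub> \<in> range emb" using emb_one by (metis rangeI)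
    show "\<ominus>\<^bsub>R\<^esub> h \<in> range emb" if "h \<in> range emb" for h
    proof -
      obtain z where z: "h = emb z" using \<open>h \<in> range emb\<close> by blast
      have "emb (qm (- 1, 0) z) \<oplus>\<^bsub>R\<^esub> h = \<zero>\<^bsub>R\<^esub>" unfolding z by (simp add: emb_def)
      then have "\<ominus>\<^bsub>R\<^esub> h = emb (qm (- 1, 0) z)" using R.minus_equality[of "emb (qm (- 1, 0) z)" h] by simp
      then show ?thesis by simp
    qed
  qed (auto simp del: R_simps simp add: R_simps(1) simp flip: emb_qm emb_qa)
  then show ?thesis unfolding O_ring_eq by (rule R.subring_is_ring)
qed

lemma O_ring_simps [simp]:
  "carrier O_ring = range emb" "\<zero>\<^bsub>O_ring\<^esub> = emb (0, 0)"
  "emb z \<oplus>\<^bsub>O_ring\<^esub> emb w = emb (qa z w)" "emb z \<otimes>\<^bsub>O_ring\<^esub> emb w = emb (qm z w)"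
  unfolding O_ring_eq by (simp_all add: emb_qa emb_qm emb_zero del: R_simps add: R_simps(2))

section \<open>Ideals of the integral closure and their classes\<close>

lemma ideal_O_ring_iff: "ideal I O_ring \<longleftrightarrow> (\<exists>J. qideal J \<and> I = emb ` J)"
proof
  assume I: "ideal I O_ring"
  interpret ideal I O_ring by (rule I)
  define J where "J = {z. emb z \<in> I}"
  have "I \<subseteq> range emb" using a_subset by simp
  then have IJ: "I = emb ` J" unfolding J_def by blast
  have "qideal J" unfolding qideal_def
  proof (intro conjI ballI allI)
    show "(0, 0) \<in> J" using additive_subgroup.zero_closed[OF is_additive_subgroup] by (simp add: J_def)
    fix z assume z: "z \<in> J"
    show "qa z w \<in> J" if "w \<in> J" for w using additive_subgroup.a_closed[OF is_additive_subgroup, of "emb z" "emb w"] z that by (simp add: J_def)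
    show "qm w z \<in> J" for w using I_l_closed[of "emb z" "emb w"] z by (simp add: J_def)
  qed
  then show "\<exists>J. qideal J \<and> I = emb ` J" using IJ by blast
next
  assume "\<exists>J. qideal J \<and> I = emb ` J"
  then obtain J where J: "qideal J" "I = emb ` J" by blast
  have J0: "(0, 0) \<in> J" and Ja: "\<And>z w. z \<in> J \<Longrightarrow> w \<in> J \<Longrightarrow> qa z w \<in> J" and Jm: "\<And>z w. z \<in> J \<Longrightarrow> qm w z \<in> J"
    using J(1) by (auto simp: qideal_def)
  interpret S: ring O_ring by (rule ring_O_ring)
  have l: "x \<otimes>\<^bsub>O_ring\<^esub> y \<in> I" if "y \<in> I" "x \<in> carrier O_ring" for x y
  proof -
    obtain z w where "y = emb z" "z \<in> J" "x = emb w" using \<open>y \<in> I\<close> \<open>x \<in> carrier O_ring\<close> J(2) by auto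
    then show ?thesis using Jm J(2) by simp
  qed
  have rr: "y \<otimes>\<^bsub>O_ring\<^esub> x \<in> I" if "y \<in> I" "x \<in> carrier O_ring" for x y
  proof -
    obtain z w where "y = emb z" "z \<in> J" "x = emb w" using \<open>y \<in> I\<close> \<open>x \<in> carrier O_ring\<close> J(2) by auto
    then show ?thesis using Jm J(2) by (simp add: qm_comm[of z w])
  qed
  have sub: "I \<subseteq> carrier O_ring" using J(2) by auto
  show "ideal I O_ring"
  proof (rule idealI[OF ring_O_ring])
    show "subgroup I (add_monoid O_ring)"
    proof (rule subgroup.intro)
      show "I \<subseteq> carrier (add_monoid O_ring)" using sub by simp
      show "x \<otimes>\<^bsub>add_monoid O_ring\<^esub> y \<in> I" if "x \<in> I" "y \<in> I" for x y
      proof -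
        obtain z w where "x = emb z" "z \<in> J" "y = emb w" "w \<in> J" using \<open>x \<in> I\<close> \<open>y \<in> I\<close> J(2) by blast
        then show ?thesis using Ja J(2) by simp
      qed
      show "\<one>\<^bsub>add_monoid O_ring\<^esub> \<in> I" using J0 J(2) by simp
      show "inv\<^bsub>add_monoid O_ring\<^esub> x \<in> I" if "x \<in> I" for x
      proof -
        have xc: "x \<in> carrier O_ring" using sub that by blast
        have "inv\<^bsub>add_monoid O_ring\<^esub> x = \<ominus>\<^bsub>O_ring\<^esub> x" by (simp only: a_inv_def)
        also have "\<dots> = \<ominus>\<^bsub>O_ring\<^esub> (\<one>\<^bsub>O_ring\<^esub> \<otimes>\<^bsub>O_ring\<^esub> x)" using S.l_one[OF xc] by simp
        also have "\<dots> = (\<ominus>\<^bsub>O_ring\<^esub> \<one>\<^bsub>O_ring\<^esub>) \<otimes>\<^bsub>O_ring\<^esub> x" using S.l_minus[OF S.one_closed xc] by simp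
        also have "\<dots> \<in> I" by (rule l[OF that S.a_inv_closed[OF S.one_closed]])
        finally show ?thesis .
      qed
    qed
  qed (use l rr in blast)+
qed

lemma nonzero_ideals_O_ring: "nonzero_ideals O_ring = (`) emb ` qideals"
proof -
  have "emb ` J = {emb (0, 0)} \<longleftrightarrow> J = {(0, 0)}" for J
    using inj_image_eq_iff[OF inj_emb, of J "{(0, 0)}"] by simp
  then show ?thesis unfolding nonzero_ideals_def qideals_def ideal_O_ring_iff O_ring_simps by blast
qed

lemma ideal_class_rel_O_ring:
  assumes "I \<in> qideals" "J \<in> qideals"
  shows "(emb ` I, emb ` J) \<in> ideal_class_rel O_ring \<longleftrightarrow> (I, J) \<in> qrel"
proof -
  have l: "emb z <#\<^bsub>O_ring\<^esub> (emb ` K) = emb ` (qm z ` K)" for z K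
    by (auto simp: l_coset_def)
  have eq: "emb z <#\<^bsub>O_ring\<^esub> (emb ` I) = emb w <#\<^bsub>O_ring\<^esub> (emb ` J) \<longleftrightarrow> qm z ` I = qm w ` J" for z w
    unfolding l inj_image_eq_iff[OF inj_emb] ..
  have nz: "emb z \<in> carrier O_ring - {\<zero>\<^bsub>O_ring\<^esub>} \<longleftrightarrow> z \<noteq> (0, 0)" for z
    by (simp add: emb_eq_iff)
  have ex: "(\<exists>x\<in>carrier O_ring - {\<zero>\<^bsub>O_ring\<^esub>}. F x) \<longleftrightarrow> (\<exists>z. z \<noteq> (0, 0) \<and> F (emb z))" for F
  proof
    assume "\<exists>x\<in>carrier O_ring - {\<zero>\<^bsub>O_ring\<^esub>}. F x"
    then obtain z where "F (emb z)" "emb z \<noteq> emb (0, 0)" unfolding O_ring_simps by blast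
    then show "\<exists>z. z \<noteq> (0, 0) \<and> F (emb z)" unfolding emb_eq_iff by blast
  qed (use nz in blast)
  show ?thesis
    unfolding ideal_class_rel_def qrel_def mem_Collect_eq prod.case ex eq nonzero_ideals_O_ring
    using assms imageI[OF assms(1), of "(`) emb"] imageI[OF assms(2), of "(`) emb"]
    by (simp only: simp_thms ex_simps)
qed

end

lemma card_quotient_bij:
  assumes f: "inj_on f A" and r: "equiv A r"
    and s: "s \<subseteq> f ` A \<times> f ` A" and rs: "\<And>x y. x \<in> A \<Longrightarrow> y \<in> A \<Longrightarrow> (f x, f y) \<in> s \<longleftrightarrow> (x, y) \<in> r"
  shows "card ((f ` A) // s) = card (A // r)"
proof -
  have rA: "r `` {x} \<subseteq> A" for x using r equiv_type by blast
  have img: "s `` {f x} = f ` (r `` {x})" if x: "x \<in> A" for x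
  proof
    show "s `` {f x} \<subseteq> f ` (r `` {x})"
    proof
      fix y assume "y \<in> s `` {f x}"
      then have ys: "(f x, y) \<in> s" by simp
      then obtain y' where "y = f y'" "y' \<in> A" using s by blast
      then show "y \<in> f ` (r `` {x})" using ys rs[OF x] by blast
    qed
    show "f ` (r `` {x}) \<subseteq> s `` {f x}" using rs[OF x] rA by blast
  qed
  have "(f ` A) // s = (`) f ` (A // r)"
    unfolding quotient_def using img by auto
  moreover have "inj_on ((`) f) (A // r)"
  proof (rule inj_onI)
    fix C D assume "C \<in> A // r" "D \<in> A // r" "f ` C = f ` D"
    moreover from this have "C \<subseteq> A" "D \<subseteq> A" using r by (meson in_quotient_imp_subset)+
    ultimately show "C = D" using inj_on_image_eq_iff[OF f] by blast
  qed
  ultimately show ?thesis by (simp add: card_image)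
qed

context odd_prime_poly
begin

lemma quad_class_number_eq: "quad_class_number (- P) = card (qideals // qrel)"
proof -
  have "inj_on ((`) emb) qideals" using inj_image_eq_iff[OF inj_emb] by (auto simp: inj_on_def)
  moreover have "ideal_class_rel O_ring \<subseteq> (`) emb ` qideals \<times> (`) emb ` qideals"
    unfolding ideal_class_rel_def nonzero_ideals_O_ring by blast
  ultimately show ?thesis
    unfolding quad_class_number_def R_def[symmetric] O_ring_def[symmetric] class_number_def nonzero_ideals_O_ring
    by (rule card_quotient_bij[OF _ equiv_qrel]) (rule ideal_class_rel_O_ring)
qed

text \<open>Dividing out the content \<open>c\<close> stays within the class, so every class
  contains a reduced ideal, to which the count applies. The threshold depends on that
  representative.\<close>

lemma card_class_eventually:
  assumes C: "C \<in> qideals // qrel" and d: "degree P = 2 * g + 1"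
  shows "\<exists>k0. \<forall>k\<ge>k0. card (C \<inter> ideals_of_degree k) = CARD('a) ^ (k - g)"
proof -
  obtain J where J: "C = qrel `` {J}" "J \<in> qideals" using C by (rule quotientE)
  obtain c a b where L: "lead_coeff c = 1" "lead_coeff a = 1" "b \<in> rho_set a" "J = L c a b"
    by (rule qideals_eq_L[OF J(2)])
  interpret reduced_ideal P a b by unfold_locales (use L in simp_all)
  have "(c, 0) \<noteq> (0, 0)" using L by auto
  then have "(L 1 a b, J) \<in> qrel"
    by (intro qrelI[OF L_in_qideals' J(2), of "(c, 0)" "(1, 0)"]) (simp_all only: L(4) L_eq_qspan image_qspan, simp_all)
  then have "C = qrel `` {L 1 a b}" using equiv_class_eq[OF equiv_qrel] J(1) by blast
  then have "C \<inter> ideals_of_degree k = {I \<in> ideals_of_degree k. (L 1 a b, I) \<in> qrel}" for k by auto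
  then have "card (C \<inter> ideals_of_degree k) = CARD('a) ^ (k - g)" if "k > degree P + degree a" for k
    using card_class_of_degree[OF d that] by simp
  then show ?thesis by (intro exI[of _ "Suc (degree P + degree a)"]) simp
qed

text \<open>Each class brings its own threshold, so a common one is available for finite sets of
  classes; distinct classes are disjoint and their counts add up.\<close>

lemma card_classes_of_degree:
  assumes F: "finite F" "F \<subseteq> qideals // qrel" and d: "degree P = 2 * g + 1"
  shows "\<exists>k\<ge>2 * g. card (\<Union>C\<in>F. C \<inter> ideals_of_degree k) = card F * CARD('a) ^ (k - g)"
proof -
  have "\<forall>C\<in>F. \<exists>k0. \<forall>k\<ge>k0. card (C \<inter> ideals_of_degree k) = CARD('a) ^ (k - g)"
    using card_class_eventually[OF _ d] F by blast
  then obtain k0 where k0: "\<And>C k. C \<in> F \<Longrightarrow> k \<ge> k0 C \<Longrightarrow> card (C \<inter> ideals_of_degree k) = CARD('a) ^ (k - g)"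
    by metis
  \<comment> \<open>The sum dominates every single threshold, and the summand 2g makes the closed
    formula for the number of all ideals available at the same degree.\<close>
  define k where "k = 2 * g + (\<Sum>C\<in>F. k0 C)"
  have "k0 C \<le> k" if "C \<in> F" for C
    using member_le_sum[OF that _ F(1), of k0] by (simp add: k_def)
  then have c: "card (C \<inter> ideals_of_degree k) = CARD('a) ^ (k - g)" if "C \<in> F" for C using k0 that by blast
  have "card (\<Union>C\<in>F. C \<inter> ideals_of_degree k) = (\<Sum>C\<in>F. card (C \<inter> ideals_of_degree k))"
  proof (rule card_UN_disjoint[OF F(1)])
    show "\<forall>C\<in>F. finite (C \<inter> ideals_of_degree k)" using finite_ideals_of_degree by simp
    show "\<forall>C\<in>F. \<forall>D\<in>F. C \<noteq> D \<longrightarrow> C \<inter> ideals_of_degree k \<inter> (D \<inter> ideals_of_degree k) = {}"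
      using quotient_disj[OF equiv_qrel] F(2) by blast
  qed
  also have "\<dots> = card F * CARD('a) ^ (k - g)" using c by simp
  finally show ?thesis by (intro exI[of _ k]) (simp add: k_def)
qed

text \<open>\<open>chi_sum\<close> vanishes from degree deg P = 2g + 1 on, so the sum stops at 2g
  and q^(k-2g) factors out.\<close>

lemma card_ideals_of_degree_large:
  assumes d: "degree P = 2 * g + 1" and k: "k \<ge> 2 * g"
  shows "int (card (ideals_of_degree k)) = int CARD('a) ^ (k - 2 * g) * (\<Sum>j\<le>2 * g. chi_sum j * int CARD('a) ^ (2 * g - j))"
proof -
  have "int (card (ideals_of_degree k)) = (\<Sum>j\<le>k. chi_sum j * int CARD('a) ^ (k - j))"
    unfolding card_ideals_of_degree by (rule card_ideal_triples)
  also have "\<dots> = (\<Sum>j\<le>2 * g. chi_sum j * int CARD('a) ^ (k - j))"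
    using k d chi_sum_eq_0 by (intro sum.mono_neutral_right) auto
  also have "\<dots> = (\<Sum>j\<le>2 * g. int CARD('a) ^ (k - 2 * g) * (chi_sum j * int CARD('a) ^ (2 * g - j)))"
    using k by (intro sum.cong) (simp_all add: power_add[symmetric])
  finally show ?thesis by (simp add: sum_distrib_left)
qed

text \<open>Both counts are divided by q^(k-2g). A finite set of classes accounts for some of the
  ideals only, and the resulting inequality bounds its size; once finiteness is known, the classes
  exhaust all ideals and equality holds.\<close>

lemma class_number_formula:
  assumes d: "degree P = 2 * g + 1"
  shows "int (card (qideals // qrel)) * int CARD('a) ^ g = (\<Sum>j\<le>2 * g. chi_sum j * int CARD('a) ^ (2 * g - j))" (is "_ = ?Z")
proof -
  have q: "int CARD('a) \<ge> 1" using finite_field_card_gt_1[where 'a = 'a] by simp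
  have split: "int CARD('a) ^ (k - g) = int CARD('a) ^ (k - 2 * g) * int CARD('a) ^ g" if "k \<ge> 2 * g" for k
    using that by (simp add: power_add[symmetric])
  have bound: "card F \<le> nat ?Z" if F: "F \<subseteq> qideals // qrel" "finite F" for F
  proof -
    obtain k where k: "k \<ge> 2 * g" "card (\<Union>C\<in>F. C \<inter> ideals_of_degree k) = card F * CARD('a) ^ (k - g)"
      using card_classes_of_degree[OF F(2,1) d] by blast
    have "card (\<Union>C\<in>F. C \<inter> ideals_of_degree k) \<le> card (ideals_of_degree k)"
      by (rule card_mono[OF finite_ideals_of_degree]) blast
    then have "int (card F * CARD('a) ^ (k - g)) \<le> int CARD('a) ^ (k - 2 * g) * ?Z"
      unfolding k(2) card_ideals_of_degree_large[OF d k(1), symmetric] by (simp only: of_nat_le_iff)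
    then have "int CARD('a) ^ (k - 2 * g) * (int (card F) * int CARD('a) ^ g) \<le> int CARD('a) ^ (k - 2 * g) * ?Z"
      using split[OF k(1)] by (simp add: mult_ac)
    then have "int (card F) * int CARD('a) ^ g \<le> ?Z" using q by (subst (asm) mult_le_cancel_left_pos) simp_all
    moreover have "int (card F) * 1 \<le> int (card F) * int CARD('a) ^ g" using q by (intro mult_left_mono) simp_all
    ultimately show ?thesis by linarith
  qed
  have fin: "finite (qideals // qrel)" using finite_if_finite_subsets_card_bdd[of "qideals // qrel"] bound by blast
  obtain k where k: "k \<ge> 2 * g"
    "card (\<Union>C\<in>qideals // qrel. C \<inter> ideals_of_degree k) = card (qideals // qrel) * CARD('a) ^ (k - g)"
    using card_classes_of_degree[OF fin subset_refl d] by blast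
  have "(\<Union>C\<in>qideals // qrel. C \<inter> ideals_of_degree k) = ideals_of_degree k"
    using Union_quotient[OF equiv_qrel] ideals_of_degree_subset[of k] by blast
  then have "int (card (qideals // qrel) * CARD('a) ^ (k - g)) = int CARD('a) ^ (k - 2 * g) * ?Z"
    using k(2) card_ideals_of_degree_large[OF d k(1)] by simp
  then have "int CARD('a) ^ (k - 2 * g) * (int (card (qideals // qrel)) * int CARD('a) ^ g) = int CARD('a) ^ (k - 2 * g) * ?Z"
    using split[OF k(1)] by (simp add: mult_ac)
  then show ?thesis using q by simp
qed

text \<open>There are q^j summands, an odd number, and each is 1 or -1 because a monic of degree
  below deg P is prime to \<open>P\<close>.\<close>

lemma odd_chi_sum:
  assumes "j < degree P" shows "odd (chi_sum j)"
proof -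
  have o: "odd (chi m)" if "m \<in> monics j" for m
  proof -
    have "m \<noteq> 0" "degree m < degree P" using that assms by (auto simp: monics_def)
    then have "\<not> P dvd m" using dvd_imp_degree_le[of P m] by linarith
    then show ?thesis by (simp add: chi_def)
  qed
  have "odd (\<Sum>m\<in>A. chi m) \<longleftrightarrow> odd (card A)" if "finite A" "A \<subseteq> monics j" for A
    using that by (induction A rule: finite_induct) (auto simp: o)
  then have "odd (chi_sum j) \<longleftrightarrow> odd (card (monics j :: 'a poly set))" unfolding chi_sum_def by simp
  then show ?thesis using odd_card by (simp add: card_monics)
qed

definition chi_total :: int where "chi_total = (\<Sum>j<degree P. chi_sum j)"

text \<open>Since \<open>q\<close> is \<open>-1\<close> modulo 4 and each character sum in degree below \<open>deg P\<close> is odd, Artin's formula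
  follows modulo 4 without the functional equation of the zeta function.\<close>

lemma class_number_mod_4: "odd chi_total" "[int (card (qideals // qrel)) = chi_total] (mod 4)"
proof -
  obtain g where d: "degree P = 2 * g + 1" using odd_degree_P by (rule oddE)
  have tot: "chi_total = (\<Sum>j\<le>2 * g. chi_sum j)" unfolding chi_total_def d by (simp add: lessThan_Suc_atMost)
  have q: "[int CARD('a) = - 1] (mod 4)"
  proof -
    have "int CARD('a) mod 4 = 3" using card_mod_4 by presburger
    then show ?thesis by (simp add: cong_def)
  qed
  have "[(\<Sum>j\<le>2 * g. chi_sum j * int CARD('a) ^ (2 * g - j)) = (\<Sum>j\<le>2 * g. chi_sum j * (- 1) ^ (2 * g - j))] (mod 4)"
    by (intro cong_sum cong_mult cong_pow q cong_refl)
  also have "(\<Sum>j\<le>2 * g. chi_sum j * (- 1) ^ (2 * g - j)) = (\<Sum>j\<le>2 * g. chi_sum j * (- 1) ^ j)"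
    by (intro sum.cong refl) (simp add: minus_one_power_iff)
  finally have Z: "[int (card (qideals // qrel)) * int CARD('a) ^ g = (\<Sum>j\<le>2 * g. chi_sum j * (- 1) ^ j)] (mod 4)"
    unfolding class_number_formula[OF d] .
  \<comment> \<open>Two degrees are added at a time. The alternating sum takes c =
    \<open>chi_sum (2 * n + 1)\<close> with a minus sign, a change of -2c, which is 2 modulo 4
    because c is odd.\<close>
  have "n \<le> g \<Longrightarrow> odd (\<Sum>j\<le>2 * n. chi_sum j) \<and>
      [(\<Sum>j\<le>2 * n. chi_sum j * (- 1) ^ j) = (\<Sum>j\<le>2 * n. chi_sum j) + 2 * int n] (mod 4)" for n
  proof (induction n)
    case 0
    then show ?case using odd_chi_sum[of 0] d by simp
  next
    case (Suc n)
    then have o: "odd (chi_sum (2 * n + 1))" "odd (chi_sum (2 * n + 2))" using odd_chi_sum d by simp_all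
    have s: "(\<Sum>j\<le>2 * Suc n. f j) = (\<Sum>j\<le>2 * n. f j) + f (2 * n + 1) + f (2 * n + 2)" for f :: "nat \<Rightarrow> int" by simp
    have IH: "odd (\<Sum>j\<le>2 * n. chi_sum j)"
      "[(\<Sum>j\<le>2 * n. chi_sum j * (- 1) ^ j) = (\<Sum>j\<le>2 * n. chi_sum j) + 2 * int n] (mod 4)" using Suc by simp_all
    have p: "(- 1 :: int) ^ (2 * n + 1) = - 1" "(- 1 :: int) ^ (2 * n + 2) = 1" by simp_all
    have "even (chi_sum (2 * n + 1) + 1)" using o(1) by simp
    then have "2 * 2 dvd 2 * (chi_sum (2 * n + 1) + 1)" by (rule mult_dvd_mono[OF dvd_refl])
    then have d2: "4 dvd 2 * (chi_sum (2 * n + 1) + 1)" by simp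
    have dv: "4 dvd ((\<Sum>j\<le>2 * n. chi_sum j * (- 1) ^ j) - ((\<Sum>j\<le>2 * n. chi_sum j) + 2 * int n))
        - 2 * (chi_sum (2 * n + 1) + 1)"
      by (rule dvd_diff[OF IH(2)[unfolded cong_iff_dvd_diff] d2])
    have eq: "((\<Sum>j\<le>2 * n. chi_sum j * (- 1) ^ j) - ((\<Sum>j\<le>2 * n. chi_sum j) + 2 * int n))
        - 2 * (chi_sum (2 * n + 1) + 1) = (\<Sum>j\<le>2 * n. chi_sum j * (- 1) ^ j) + chi_sum (2 * n + 1) * - 1 + chi_sum (2 * n + 2) * 1
        - ((\<Sum>j\<le>2 * n. chi_sum j) + chi_sum (2 * n + 1) + chi_sum (2 * n + 2) + 2 * int (Suc n))"
      by (simp add: algebra_simps)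
    have "[(\<Sum>j\<le>2 * n. chi_sum j * (- 1) ^ j) + chi_sum (2 * n + 1) * - 1 + chi_sum (2 * n + 2) * 1
        = (\<Sum>j\<le>2 * n. chi_sum j) + chi_sum (2 * n + 1) + chi_sum (2 * n + 2) + 2 * int (Suc n)] (mod 4)"
      using dv unfolding eq cong_iff_dvd_diff .
    moreover have "odd ((\<Sum>j\<le>2 * n. chi_sum j) + chi_sum (2 * n + 1) + chi_sum (2 * n + 2))" using IH(1) o by simp
    ultimately show ?case unfolding s p by blast
  qed
  then have *: "odd (\<Sum>j\<le>2 * g. chi_sum j)"
    "[(\<Sum>j\<le>2 * g. chi_sum j * (- 1) ^ j) = (\<Sum>j\<le>2 * g. chi_sum j) + 2 * int g] (mod 4)" by blast+
  then show o: "odd chi_total" by (simp add: tot)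
  have red: "[int (card (qideals // qrel)) * int CARD('a) ^ g = int (card (qideals // qrel)) * (- 1) ^ g] (mod 4)"
    by (intro cong_mult cong_pow q cong_refl)
  have c: "[int (card (qideals // qrel)) * (- 1) ^ g = chi_total + 2 * int g] (mod 4)"
    by (rule cong_trans[OF cong_trans[OF cong_sym[OF red] Z] *(2)[folded tot]])
  \<comment> \<open>For even g both (-1)^g and 2g drop out. For odd g the congruence reads -h = H +
    2, which means h = H since H is odd and hence 2H + 2 = 0 modulo 4.\<close>
  show "[int (card (qideals // qrel)) = chi_total] (mod 4)"
  proof (cases "even g")
    case True
    then have "2 * 2 dvd 2 * int g" by (intro mult_dvd_mono) simp_all
    then have "4 dvd (int (card (qideals // qrel)) - (chi_total + 2 * int g)) + 2 * int g"
      using c True unfolding cong_iff_dvd_diff by (intro dvd_add) simp_all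
    then show ?thesis unfolding cong_iff_dvd_diff by simp
  next
    case False
    then have "2 * 2 dvd 2 * (chi_total + int g)" using o by (intro mult_dvd_mono) simp_all
    then have "4 dvd (- int (card (qideals // qrel)) - (chi_total + 2 * int g)) + 2 * (chi_total + int g)"
      using c False unfolding cong_iff_dvd_diff by (intro dvd_add) simp_all
    also have "\<dots> = - (int (card (qideals // qrel)) - chi_total)" by simp
    finally show ?thesis unfolding cong_iff_dvd_diff dvd_minus_iff .
  qed
qed

section \<open>The product over a half system\<close>

definition monics_below :: "nat \<Rightarrow> 'a poly set" where
  "monics_below n = {m. lead_coeff m = 1 \<and> degree m < n}"

definition coprime_monics :: "nat \<Rightarrow> 'a poly set" where
  "coprime_monics n = {m \<in> monics_below n. \<not> P dvd m}"

lemma monics_below_eq: "monics_below n = (\<Union>j<n. monics j)"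
  by (auto simp: monics_below_def monics_def)

lemma finite_monics_below [simp]: "finite (monics_below n)"
  by (simp add: monics_below_eq)

lemma finite_coprime_monics [simp]: "finite (coprime_monics n)"
  by (simp add: coprime_monics_def)

lemma card_monics_below: "card (monics_below n) = (\<Sum>j<n. CARD('a) ^ j)"
proof -
  have "card (monics_below n) = (\<Sum>j<n. card (monics j :: 'a poly set))"
    unfolding monics_below_eq by (rule card_UN_disjoint) (simp_all add: disjoint_monics)
  then show ?thesis by (simp add: card_monics)
qed

text \<open>With d = deg P, removing the multiples of \<open>P\<close> leaves the sum of q^j over
  (e-1)d <= j < ed. Modulo 4 these d terms alternate in sign, and d is odd, so one term
  (-1)^((e-1)d) = (-1)^(e-1) survives.\<close>

lemma card_coprime_monics:
  assumes "e \<ge> 1"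
  shows "[int (card (coprime_monics (e * degree P))) = (- 1) ^ (e - 1)] (mod 4)"
proof -
  let ?d = "degree P"
  obtain r where r: "e = Suc r" using assms by (cases e) auto
  have n: "e * ?d = r * ?d + ?d" by (simp add: r)
  have "coprime_monics (e * ?d) = monics_below (e * ?d) - (*) P ` monics_below (r * ?d)"
  proof -
    have "m \<in> (*) P ` monics_below (r * ?d)" if m: "m \<in> monics_below (e * ?d)" "P dvd m" for m
    proof -
      from m(2) obtain w where w: "m = P * w" by (rule dvdE)
      have "lead_coeff w = 1" using m(1) monic_P unfolding w monics_below_def mem_Collect_eq
        by (elim conjE) (rule monic_factor)
      moreover from this have "w \<noteq> 0" by auto
      then have "degree m = ?d + degree w" unfolding w using P_nonzero by (simp add: degree_mult_eq)
      then have "degree w < r * ?d" using m(1) n by (simp add: monics_below_def)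
      ultimately show ?thesis unfolding w by (intro imageI) (simp add: monics_below_def)
    qed
    then show ?thesis by (auto simp: coprime_monics_def)
  qed
  moreover have "(*) P ` monics_below (r * ?d) \<subseteq> monics_below (e * ?d)"
  proof (rule image_subsetI)
    fix w assume w: "w \<in> monics_below (r * ?d)"
    then have "w \<noteq> 0" by (auto simp: monics_below_def)
    then have "degree (P * w) < e * ?d" using w P_nonzero n by (simp add: monics_below_def degree_mult_eq)
    moreover have "lead_coeff (P * w) = 1" using w by (intro monic_mult monic_P) (simp add: monics_below_def)
    ultimately show "P * w \<in> monics_below (e * ?d)" unfolding monics_below_def by blast
  qed
  moreover have "inj_on ((*) P) (monics_below (r * ?d))" using P_nonzero by (simp add: inj_on_def)
  ultimately have "card (coprime_monics (e * ?d)) = (\<Sum>j<e * ?d. CARD('a) ^ j) - (\<Sum>j<r * ?d. CARD('a) ^ j)"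
    by (simp add: card_Diff_subset card_image card_monics_below)
  also have "(\<Sum>j<e * ?d. CARD('a) ^ j) = (\<Sum>j<r * ?d. CARD('a) ^ j) + (\<Sum>j<?d. CARD('a) ^ (r * ?d + j))"
  proof -
    have "(\<Sum>j<k + l. f j) = (\<Sum>j<k. f j) + (\<Sum>j<l. f (k + j))" for k l and f :: "nat \<Rightarrow> nat"
      by (induction l) simp_all
    then show ?thesis unfolding n .
  qed
  finally have c: "int (card (coprime_monics (e * ?d))) = (\<Sum>j<?d. int CARD('a) ^ (r * ?d + j))" by simp
  have q: "[int CARD('a) = - 1] (mod 4)"
  proof -
    have "int CARD('a) mod 4 = 3" using card_mod_4 by presburger
    then show ?thesis by (simp add: cong_def)
  qed
  have "[(\<Sum>j<?d. int CARD('a) ^ (r * ?d + j)) = (\<Sum>j<?d. (- 1) ^ (r * ?d + j))] (mod 4)"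
    by (intro cong_sum cong_pow q)
  also have "(\<Sum>j<?d. (- 1 :: int) ^ (r * ?d + j)) = (- 1) ^ (r * ?d) * (\<Sum>j<?d. (- 1) ^ j)"
    by (simp add: power_add sum_distrib_left)
  also have "(\<Sum>j<k. (- 1 :: int) ^ j) = (if odd k then 1 else 0)" for k
    by (induction k) (auto simp: minus_one_power_iff)
  also have "(- 1 :: int) ^ (r * ?d) = (- 1) ^ (e - 1)" using odd_degree_P by (simp add: r minus_one_power_iff)
  finally show ?thesis unfolding c using odd_degree_P by simp
qed

lemma odd_card_coprime_monics:
  assumes "e \<ge> 1" shows "odd (card (coprime_monics (e * degree P)))"
proof -
  have "2 dvd (4 :: int)" by simp
  then have "[int (card (coprime_monics (e * degree P))) = (- 1) ^ (e - 1)] (mod 2)"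
    using card_coprime_monics[OF assms] cong_dvd_modulus by blast
  then have "even (int (card (coprime_monics (e * degree P))) - (- 1) ^ (e - 1))"
    unfolding cong_iff_dvd_diff .
  then show ?thesis by simp
qed

lemma sum_chi_coprime_monics:
  assumes "e \<ge> 1" shows "(\<Sum>m\<in>coprime_monics (e * degree P). chi m) = chi_total"
proof -
  let ?n = "e * degree P"
  have "(\<Sum>m\<in>coprime_monics ?n. chi m) = (\<Sum>m\<in>monics_below ?n. chi m)"
    by (rule sum.mono_neutral_left) (auto simp: coprime_monics_def chi_eq_0_iff)
  also have "\<dots> = (\<Sum>j<?n. chi_sum j)"
    unfolding monics_below_eq chi_sum_def by (rule sum.UNION_disjoint) (simp_all add: disjoint_monics)
  also have "\<dots> = chi_total"
    unfolding chi_total_def using assms chi_sum_eq_0 by (intro sum.mono_neutral_right) auto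
  finally show ?thesis .
qed

text \<open>\<open>k\<close> is the number of \<open>m\<close> with character -1: each contributes a
  factor -1 to the product and 2 to the difference between the number of terms and their
  sum.\<close>

lemma prod_chi_coprime_monics:
  assumes "e \<ge> 1"
  obtains k :: nat where "(\<Prod>m\<in>coprime_monics (e * degree P). chi m) = (- 1) ^ k"
    "int (card (coprime_monics (e * degree P))) - chi_total = 2 * int k"
proof -
  have "\<exists>k :: nat. (\<Prod>m\<in>A. chi m) = (- 1) ^ k \<and> int (card A) - (\<Sum>m\<in>A. chi m) = 2 * int k"
    if "finite A" "\<forall>m\<in>A. chi m = 1 \<or> chi m = - 1" for A
    using that
  proof (induction A rule: finite_induct)
    case empty
    then show ?case by (intro exI[of _ 0]) simp
  next
    case (insert x A)
    then obtain k :: nat where k: "(\<Prod>m\<in>A. chi m) = (- 1) ^ k" "int (card A) - (\<Sum>m\<in>A. chi m) = 2 * int k" by auto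
    have "chi x = 1 \<or> chi x = - 1" using insert.prems by simp
    then show ?case
    proof
      assume "chi x = 1"
      then show ?thesis using k insert.hyps by (intro exI[of _ k]) simp
    next
      assume "chi x = - 1"
      then show ?thesis using k insert.hyps by (intro exI[of _ "Suc k"]) simp
    qed
  qed
  moreover have "\<forall>m\<in>coprime_monics (e * degree P). chi m = 1 \<or> chi m = - 1"
    using chi_cases chi_eq_0_iff by (auto simp: coprime_monics_def)
  ultimately show ?thesis using that sum_chi_coprime_monics[OF assms] finite_coprime_monics by metis
qed

definition with_leading_coeff :: "nat \<Rightarrow> 'a set \<Rightarrow> 'a poly set" where
  "with_leading_coeff n T = {g. g \<noteq> 0 \<and> lead_coeff g \<in> T \<and> degree g < n \<and> \<not> P dvd g}"

text \<open>Used twice: \<open>T = S\<close> gives \<open>G f S\<close>, and the set of all non-zero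
  constants gives the product of all units modulo the prime power.\<close>

lemma prod_with_leading_coeff:
  assumes "0 \<notin> T"
  shows "\<Prod>(with_leading_coeff n T) = [:\<Prod>T:] ^ card (coprime_monics n) * \<Prod>(coprime_monics n) ^ card T"
proof -
  have "bij_betw (\<lambda>(\<alpha>, m). smult \<alpha> m) (T \<times> coprime_monics n) (with_leading_coeff n T)"
  proof (rule bij_betw_byWitness[where f' = "\<lambda>g. (lead_coeff g, smult (inverse (lead_coeff g)) g)"])
    show "\<forall>z\<in>T \<times> coprime_monics n. (\<lambda>g. (lead_coeff g, smult (inverse (lead_coeff g)) g)) ((\<lambda>(\<alpha>, m). smult \<alpha> m) z) = z"
    proof
      fix z assume z: "z \<in> T \<times> coprime_monics n"
      obtain \<alpha> m where zz: "z = (\<alpha>, m)" by (cases z)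
      then have "\<alpha> \<noteq> 0" "lead_coeff m = 1" using z assms by (auto simp: coprime_monics_def monics_below_def)
      moreover from this have lm: "lead_coeff (smult \<alpha> m) = \<alpha>" unfolding lead_coeff_smult by simp
      ultimately show "(\<lambda>g. (lead_coeff g, smult (inverse (lead_coeff g)) g)) ((\<lambda>(\<alpha>, m). smult \<alpha> m) z) = z"
        unfolding zz prod.case lm by simp
    qed
    show "\<forall>g\<in>with_leading_coeff n T. (\<lambda>(\<alpha>, m). smult \<alpha> m) (lead_coeff g, smult (inverse (lead_coeff g)) g) = g"
      by (simp add: with_leading_coeff_def)
    show "(\<lambda>(\<alpha>, m). smult \<alpha> m) ` (T \<times> coprime_monics n) \<subseteq> with_leading_coeff n T"
    proof (rule image_subsetI)
      fix z assume z: "z \<in> T \<times> coprime_monics n"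
      obtain \<alpha> m where zz: "z = (\<alpha>, m)" by (cases z)
      have \<alpha>: "\<alpha> \<in> T" "\<alpha> \<noteq> 0" and m: "lead_coeff m = 1" "degree m < n" "\<not> P dvd m"
        using z zz assms by (auto simp: coprime_monics_def monics_below_def)
      have "lead_coeff (smult \<alpha> m) = \<alpha>" using m(1) unfolding lead_coeff_smult by simp
      moreover have "m \<noteq> 0" using m(1) by auto
      ultimately show "(\<lambda>(\<alpha>, m). smult \<alpha> m) z \<in> with_leading_coeff n T"
        unfolding zz with_leading_coeff_def using \<alpha> m by (simp add: dvd_smult_iff)
    qed
    show "(\<lambda>g. (lead_coeff g, smult (inverse (lead_coeff g)) g)) ` with_leading_coeff n T \<subseteq> T \<times> coprime_monics n"
      unfolding with_leading_coeff_def coprime_monics_def monics_below_def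
      by (auto simp: dvd_smult_iff)
  qed
  then have "\<Prod>(with_leading_coeff n T) = (\<Prod>z\<in>T \<times> coprime_monics n. (\<lambda>(\<alpha>, m). smult \<alpha> m) z)"
    by (rule prod.reindex_bij_betw[symmetric, of _ _ _ "\<lambda>g. g"])
  also have "\<dots> = (\<Prod>\<alpha>\<in>T. \<Prod>m\<in>coprime_monics n. [:\<alpha>:] * m)"
    by (simp add: prod.cartesian_product)
  also have "\<dots> = (\<Prod>\<alpha>\<in>T. [:\<alpha>:]) ^ card (coprime_monics n) * \<Prod>(coprime_monics n) ^ card T"
    by (simp only: prod.distrib prod_constant prod_power_distrib)
  also have "(\<Prod>\<alpha>\<in>T. [:\<alpha>:]) = [:\<Prod>T:]"
    by (induction T rule: infinite_finite_induct) (simp_all add: one_pCons)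
  finally show ?thesis .
qed

lemma minus_one_ne_one: "(- 1 :: 'a) \<noteq> 1"
proof
  assume "(- 1 :: 'a) = 1"
  then have "(1 + 1 :: 'a) = 0" by (metis add.left_inverse)
  then show False using two_ne_0 unfolding one_add_one by simp
qed

lemma odd_half_card: "odd ((CARD('a) - 1) div 2)"
  using card_mod_4 by presburger

lemma minus_one_not_square: "x\<^sup>2 \<noteq> (- 1 :: 'a)"
proof
  assume x: "x\<^sup>2 = (- 1 :: 'a)"
  then have x0: "x \<noteq> 0" by auto
  have "x ^ card (UNIV - {0 :: 'a}) = 1" by (rule power_card_eq_1) (use x0 in auto)
  then have "x ^ (CARD('a) - 1) = 1" by (simp add: card_Diff_singleton)
  moreover have "CARD('a) - 1 = 2 * ((CARD('a) - 1) div 2)" using odd_card by simp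
  ultimately have "(x\<^sup>2) ^ ((CARD('a) - 1) div 2) = 1" by (metis power_mult)
  then have "(- 1 :: 'a) = 1" unfolding x using odd_half_card by simp
  then show False using minus_one_ne_one by blast
qed

text \<open>\<open>S\<close> and its negatives partition the non-zero constants and |S| is odd, so
  the product of the latter is minus the square of that of \<open>S\<close>. By inversion it squares
  to 1, and the value 1 would make the product of \<open>S\<close> a square root of -1.\<close>

lemma half_system_products:
  assumes S: "S \<subseteq> UNIV - {0 :: 'a}" "card S = (CARD('a) - 1) div 2" "\<And>\<alpha>. \<alpha> \<in> S \<Longrightarrow> - \<alpha> \<notin> S"
  shows "(\<Prod>S)\<^sup>2 = 1" "\<Prod>(UNIV - {0 :: 'a}) = - 1"
proof -
  let ?U = "UNIV - {0 :: 'a}"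
  have disj: "S \<inter> uminus ` S = {}" using S(3) by auto
  have "card (S \<union> uminus ` S) = card S + card (uminus ` S)" using disj by (intro card_Un_disjoint) auto
  also have "card (uminus ` S) = card S" by (intro card_image) (simp add: inj_on_def)
  also have "card S + card S = card ?U"
  proof -
    have "card S + card S = 2 * ((CARD('a) - 1) div 2)" unfolding S(2) by (rule mult_2[symmetric])
    also have "\<dots> = CARD('a) - 1" using odd_card by simp
    finally show ?thesis by (simp add: card_Diff_singleton)
  qed
  finally have U: "S \<union> uminus ` S = ?U" using S(1) by (intro card_subset_eq) auto
  have "\<Prod>?U = \<Prod>S * \<Prod>(uminus ` S)" unfolding U[symmetric] using disj by (intro prod.union_disjoint) auto
  also have "\<Prod>(uminus ` S) = (\<Prod>\<alpha>\<in>S. (- 1) * \<alpha>)" by (subst prod.reindex) (simp_all add: inj_on_def)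
  also have "\<dots> = - \<Prod>S" using odd_half_card S(2) by (simp only: prod.distrib prod_constant) simp
  finally have W: "\<Prod>?U = - ((\<Prod>S)\<^sup>2)" by (simp add: power2_eq_square)
  have "\<Prod>?U = (\<Prod>\<alpha>\<in>?U. inverse \<alpha>)"
    by (rule prod.reindex_bij_witness[of _ inverse inverse]) auto
  then have "\<Prod>?U * \<Prod>?U = (\<Prod>\<alpha>\<in>?U. \<alpha> * inverse \<alpha>)" by (simp only: prod.distrib)
  also have "\<dots> = 1" by (rule prod.neutral) simp
  finally have "(\<Prod>?U)\<^sup>2 = 1" by (simp add: power2_eq_square)
  then have "\<Prod>?U = 1 \<or> \<Prod>?U = - 1" by (simp only: power2_eq_1_iff)
  moreover have "\<Prod>?U \<noteq> 1"
  proof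
    assume "\<Prod>?U = 1"
    then have "(\<Prod>S)\<^sup>2 = - 1" using W by (metis minus_minus)
    then show False using minus_one_not_square by blast
  qed
  ultimately show "\<Prod>?U = - 1" by blast
  then show "(\<Prod>S)\<^sup>2 = 1" using W by simp
qed

text \<open>\<open>x - 1\<close> and \<open>x + 1\<close> differ by the non-zero constant 2, so
  \<open>P\<close> divides at most one of them and the other takes the full power.\<close>

lemma square_root_of_one_mod_power:
  assumes "P ^ e dvd x\<^sup>2 - 1" shows "P ^ e dvd x - 1 \<or> P ^ e dvd x + 1"
proof -
  have d: "P ^ e dvd (x - 1) * (x + 1)" using assms by (simp add: power2_eq_square algebra_simps)
  have "\<not> P dvd x - 1 \<or> \<not> P dvd x + 1"
  proof (rule ccontr)
    assume "\<not> ?thesis"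
    then have "P dvd (x + 1) - (x - 1)" using dvd_diff by blast
    moreover have "(x + 1) - (x - 1) = [:2:]" by (simp add: one_pCons)
    ultimately have "P dvd [:2:]" by simp
    moreover have "[:2::'a:] \<noteq> 0" using two_ne_0 by simp
    ultimately show False using dvd_imp_degree_le[of P "[:2:]"] degree_P_pos by simp
  qed
  then show ?thesis
  proof
    assume "\<not> P dvd x - 1"
    then have "coprime (P ^ e) (x - 1)"
      using irreducible_coprime_poly[OF irreducible_P] coprime_power_poly coprime_commute by metis
    then show ?thesis using d coprime_dvd_mult_poly by blast
  next
    assume "\<not> P dvd x + 1"
    then have "coprime (P ^ e) (x + 1)"
      using irreducible_coprime_poly[OF irreducible_P] coprime_power_poly coprime_commute by metis
    then show ?thesis using d coprime_dvd_mult_poly by (metis mult.commute)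
  qed
qed

text \<open>Inversion modulo \<open>P ^ e\<close> permutes the reduced units, so their product also
  equals the product of their inverses; pairing g with \<open>h g\<close> makes the square congruent
  to 1.\<close>

lemma prod_units_square:
  assumes "e \<ge> 1"
  shows "P ^ e dvd (\<Prod>(with_leading_coeff (e * degree P) (UNIV - {0})))\<^sup>2 - 1"
proof -
  let ?f = "P ^ e"
  let ?U = "with_leading_coeff (e * degree P) (UNIV - {0})"
  have f0: "?f \<noteq> 0" using P_nonzero by simp
  have Pf: "P dvd ?f" using assms by simp
  have df: "degree ?f = e * degree P" using P_nonzero by (simp add: degree_power_eq)
  have U: "g \<in> ?U \<longleftrightarrow> g \<in> polys (degree ?f) \<and> \<not> P dvd g" for g
    by (auto simp: with_leading_coeff_def polys_iff df)
  have "\<exists>h. h \<in> ?U \<and> ?f dvd g * h - 1" if g: "g \<in> ?U" for g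
  proof -
    have "coprime (P ^ e) g" using g U irreducible_coprime_poly[OF irreducible_P] coprime_power_poly coprime_commute by metis
    then obtain x y where "x * ?f + y * g = 1" using coprime_bezout_poly by blast
    then have "g * y - 1 = ?f * (- x)" by (simp add: algebra_simps)
    then have fy: "?f dvd g * y - 1" by simp
    have "[g * (y mod ?f) = g * y] (mod ?f)" by (intro cong_mult) simp_all
    then have "[g * (y mod ?f) = 1] (mod ?f)" using fy by (metis cong_iff_dvd_diff cong_trans)
    then have h: "?f dvd g * (y mod ?f) - 1" by (simp add: cong_iff_dvd_diff)
    have "\<not> P dvd y mod ?f"
    proof
      assume "P dvd y mod ?f"
      then have "P dvd g * (y mod ?f)" by simp
      moreover have "P dvd g * (y mod ?f) - 1" using h Pf dvd_trans by blast
      ultimately have "P dvd 1" by (metis dvd_diffD1 dvd_diff_commute dvd_add_right_iff diff_add_cancel)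
      then show False using irreducible_P irreducible_not_unit by blast
    qed
    then show ?thesis using h U mod_in_polys[OF f0] by blast
  qed
  then obtain h where h: "\<And>g. g \<in> ?U \<Longrightarrow> h g \<in> ?U" "\<And>g. g \<in> ?U \<Longrightarrow> ?f dvd g * h g - 1" by metis
  have hc: "[g * h g = 1] (mod ?f)" if "g \<in> ?U" for g using h(2)[OF that] by (simp add: cong_iff_dvd_diff)
  have hh: "h (h g) = g" if g: "g \<in> ?U" for g
  proof -
    have c1: "[g * (h g * h (h g)) = g * 1] (mod ?f)" by (intro cong_mult cong_refl hc h g)
    have c2: "[(g * h g) * h (h g) = 1 * h (h g)] (mod ?f)" by (intro cong_mult cong_refl hc g)
    have "[h (h g) = g] (mod ?f)"
      by (rule cong_trans[OF cong_sym[OF c2[unfolded mult.assoc mult_1]] c1[unfolded mult_1_right]])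
    moreover have "h (h g) \<in> polys (degree ?f)" "g \<in> polys (degree ?f)" using U h(1) g by blast+
    ultimately show ?thesis using polys_cong_eq by blast
  qed
  have "(\<Prod>g\<in>?U. h g) = \<Prod>?U"
    by (rule prod.reindex_bij_witness[of _ h h]) (use h hh in auto)
  then have "(\<Prod>?U)\<^sup>2 = (\<Prod>g\<in>?U. g * h g)" by (simp add: prod.distrib power2_eq_square)
  moreover have "[(\<Prod>g\<in>?U. g * h g) = (\<Prod>g\<in>?U. 1)] (mod ?f)" by (intro cong_prod hc)
  ultimately show ?thesis by (simp add: cong_iff_dvd_diff)
qed

text \<open>Since \<open>-1\<close> is not a square modulo \<open>P\<close>, the sign of the product can be read off its quadratic character.\<close>

lemma prod_coprime_monics_power:
  assumes e: "e \<ge> 1" and S: "S \<subseteq> UNIV - {0 :: 'a}" "card S = (CARD('a) - 1) div 2" "\<And>\<alpha>. \<alpha> \<in> S \<Longrightarrow> - \<alpha> \<notin> S"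
  shows "P ^ e dvd \<Prod>(coprime_monics (e * degree P)) ^ card S - of_int (\<Prod>m\<in>coprime_monics (e * degree P). chi m)"
proof -
  let ?M = "\<Prod>(coprime_monics (e * degree P))"
  let ?N = "card (coprime_monics (e * degree P))"
  have Pe: "P dvd P ^ e" using e by simp
  have N: "odd ?N" using odd_card_coprime_monics[OF e] .
  have s: "odd (card S)" using odd_half_card S(2) by simp
  have "CARD('a) - 1 = 2 * ((CARD('a) - 1) div 2)" using odd_card by simp
  then have q1: "card (UNIV - {0 :: 'a}) = card S * 2" using S(2) by (simp add: card_Diff_singleton)
  have "[:- 1 :: 'a:] = - 1" by (simp add: one_pCons)
  \<comment> \<open>In the product of all units the constants contribute (-1)^N = -1, N being odd,
    and the monics contribute M^(q-1), the square of M^|S|.\<close>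
  then have W: "\<Prod>(with_leading_coeff (e * degree P) (UNIV - {0})) = - ((?M ^ card S)\<^sup>2)"
    using prod_with_leading_coeff[of "UNIV - {0}" "e * degree P"] N
    unfolding q1 by (simp add: half_system_products(2)[OF S] power_mult)
  \<comment> \<open>So M^|S| has fourth power 1. Its square is 1 or -1, and -1 is excluded because
    it is not a square modulo \<open>P\<close>; hence M^|S| itself is 1 or -1.\<close>
  have "P ^ e dvd ((?M ^ card S)\<^sup>2)\<^sup>2 - 1" using prod_units_square[OF e] unfolding W by simp
  then have "P ^ e dvd (?M ^ card S)\<^sup>2 - 1 \<or> P ^ e dvd (?M ^ card S)\<^sup>2 + 1" by (rule square_root_of_one_mod_power)
  moreover have "\<not> P ^ e dvd (?M ^ card S)\<^sup>2 + 1"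
  proof
    assume "P ^ e dvd (?M ^ card S)\<^sup>2 + 1"
    then have "P dvd (?M ^ card S)\<^sup>2 - (- 1)" using Pe dvd_trans by auto
    moreover have "\<not> P dvd - 1" using irreducible_P irreducible_not_unit by simp
    ultimately have "chi (- 1) = 1" unfolding chi_def by auto
    then show False using chi_uminus[of 1] chi_1 by simp
  qed
  ultimately have "P ^ e dvd (?M ^ card S)\<^sup>2 - 1" by blast
  then have ex: "P ^ e dvd ?M ^ card S - 1 \<or> P ^ e dvd ?M ^ card S + 1" by (rule square_root_of_one_mod_power)
  have "chi (?M ^ card S) = chi ?M ^ card S" by (rule chi_power)
  moreover have "chi ?M = (\<Prod>m\<in>coprime_monics (e * degree P). chi m)" by (rule chi_prod)
  moreover obtain k :: nat where "(\<Prod>m\<in>coprime_monics (e * degree P). chi m) = (- 1) ^ k"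
    using prod_chi_coprime_monics[OF e] by blast
  \<comment> \<open>|S| is odd, so raising the sign \<open>chi ?M\<close> to this power leaves it
    unchanged.\<close>
  ultimately have c: "chi (?M ^ card S) = (\<Prod>m\<in>coprime_monics (e * degree P). chi m)"
    using s by (cases "even k") (simp_all add: minus_one_power_iff)
  from ex show ?thesis
  proof
    assume a: "P ^ e dvd ?M ^ card S - 1"
    then have "P dvd ?M ^ card S - 1" using Pe dvd_trans by blast
    then have "chi (?M ^ card S) = 1" using chi_cong chi_1 by metis
    then show ?thesis using a c by simp
  next
    assume a: "P ^ e dvd ?M ^ card S + 1"
    then have "P dvd ?M ^ card S - (- 1)" using Pe dvd_trans by auto
    then have "chi (?M ^ card S) = - 1" using chi_cong chi_1 chi_uminus[of 1] by metis
    then show ?thesis using a c by simp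
  qed
qed

end

theorem theorem4p6:
  fixes S :: "'a::{finite,field} set" and a :: 'a and P f :: "'a poly" and e :: nat
  assumes "CARD('a) mod 4 = 3"
    and "S \<subseteq> UNIV - {0}" and "card S = (CARD('a) - 1) div 2"
    and "\<And>\<alpha>. \<alpha> \<in> S \<Longrightarrow> - \<alpha> \<notin> S"
    and "a \<noteq> 0"
    and "lead_coeff P = 1" and "irreducible P" and "odd (degree P)"
    and "e \<ge> 1"
    and "f = smult a (P ^ e)"
  shows "[G f S = [:(-1) powi (int e + (int (quad_class_number (- P)) - 3) div 2) * \<delta> S:]] (mod f)"
proof -
  interpret odd_prime_poly P by unfold_locales (use assms in simp_all)
  note S = assms(2,3,4) and e = assms(9)
  let ?n = "e * degree P"
  define h where "h = int (quad_class_number (- P))"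
  have deg: "degree f = ?n" using assms(5,10) P_nonzero by (simp add: degree_power_eq)
  have cop: "coprime g f \<longleftrightarrow> \<not> P dvd g" for g
  proof
    assume "coprime g f"
    moreover have "P dvd f" using assms(10) e by (simp add: dvd_smult)
    ultimately show "\<not> P dvd g" using irreducible_P by (meson coprime_common_divisor irreducible_not_unit)
  next
    assume "\<not> P dvd g"
    then have "coprime g (P ^ e)"
      using irreducible_coprime_poly[OF irreducible_P] coprime_power_poly coprime_commute by metis
    then show "coprime g f" by (rule coprime_imp_coprime) (use assms(5,10) in \<open>auto simp: dvd_smult_iff\<close>)
  qed
  have "G f S = \<Prod>(with_leading_coeff ?n S)"
    unfolding G_def with_leading_coeff_def deg cop ..
  moreover have "0 \<notin> S" using S by blast
  ultimately have G: "G f S = [:\<delta> S:] ^ card (coprime_monics ?n) * \<Prod>(coprime_monics ?n) ^ card S"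
    using prod_with_leading_coeff[of S ?n] by (simp add: \<delta>_def)
  obtain k :: nat where k: "(\<Prod>m\<in>coprime_monics ?n. chi m) = (- 1) ^ k" "int (card (coprime_monics ?n)) - chi_total = 2 * int k"
    using prod_chi_coprime_monics[OF e] by blast
  have h: "[h = chi_total] (mod 4)" unfolding h_def quad_class_number_eq by (rule class_number_mod_4)
  have N: "[int (card (coprime_monics ?n)) = (- 1) ^ (e - 1)] (mod 4)" by (rule card_coprime_monics[OF e])
  obtain t where t: "h - chi_total = 4 * t" using h unfolding cong_iff_dvd_diff by (rule dvdE)
  \<comment> \<open>N - H = 2k together with H = h and N = (-1)^(e-1) modulo 4 shows that h - 3 is
    even, so the integer division is exact and the parity of \<open>k\<close> can be read off from
    it.\<close>
  have par: "even k \<longleftrightarrow> even (int e + (h - 3) div 2)"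
  proof (cases "even e")
    case True
    then have "(- 1 :: int) ^ (e - 1) = - 1" using e by simp
    then have "4 dvd int (card (coprime_monics ?n)) + 1" using N unfolding cong_iff_dvd_diff by simp
    then obtain s where s: "int (card (coprime_monics ?n)) + 1 = 4 * s" by (rule dvdE)
    have "h - 3 = 2 * (2 * s + 2 * t - 2 - int k)" using s t k(2) by (simp add: algebra_simps)
    then have "(h - 3) div 2 = 2 * s + 2 * t - 2 - int k" by simp
    then show ?thesis using True by simp
  next
    case False
    then have "(- 1 :: int) ^ (e - 1) = 1" using e by simp
    then have "4 dvd int (card (coprime_monics ?n)) - 1" using N unfolding cong_iff_dvd_diff by simp
    then obtain s where s: "int (card (coprime_monics ?n)) - 1 = 4 * s" by (rule dvdE)
    have "h - 3 = 2 * (2 * s + 2 * t - 1 - int k)" using s t k(2) by (simp add: algebra_simps)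
    then have "(h - 3) div 2 = 2 * s + 2 * t - 1 - int k" by simp
    then show ?thesis using False by simp
  qed
  have oddN: "odd (card (coprime_monics ?n))" using e by (rule odd_card_coprime_monics)
  \<comment> \<open>\<delta>(S) squares to 1 and N is odd, so a single factor \<delta>(S) remains of
    the N-th power.\<close>
  have "[:\<delta> S:]\<^sup>2 = 1" using half_system_products(1)[OF S] by (simp add: \<delta>_def power2_eq_square one_pCons)
  then have dN: "[:\<delta> S:] ^ card (coprime_monics ?n) = [:\<delta> S:]"
    using oddN by (elim oddE) (simp add: power_mult)
  have sign: "[:(- 1) powi (int e + (h - 3) div 2) * \<delta> S:] = [:\<delta> S:] * of_int ((- 1) ^ k)"
    using par by (cases "even k") (simp_all add: power_int_minus_left)
  have "P ^ e dvd \<Prod>(coprime_monics ?n) ^ card S - of_int ((- 1) ^ k)"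
    using prod_coprime_monics_power[OF e S] k(1) by simp
  then have "P ^ e dvd [:\<delta> S:] * (\<Prod>(coprime_monics ?n) ^ card S - of_int ((- 1) ^ k))" by (rule dvd_mult)
  then have "f dvd G f S - [:(- 1) powi (int e + (h - 3) div 2) * \<delta> S:]"
    unfolding sign G dN unfolding assms(10) using assms(5) by (simp only: right_diff_distrib smult_dvd_iff) simp
  then show ?thesis unfolding h_def[symmetric] by (simp only: cong_iff_dvd_diff)
qed

end
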